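(* Let $U\subset\mathbb{R}^n$ be an open subset. Let $F=\sqrt[m]{A}$ be an $m$-th root Finsler metric on $U$, where $A=a_{i_1\dots i_m}(x)y^{i_1}\cdots y^{i_m}$ is irreducible. Let $\beta=b_i(x)y^i$ be a 1-form on $U$ and let $\bar F=\frac{F^2}{\beta}$ be the Kropina change of $F$. Then $\bar F$ is locally projectively flat if and only if it is locally Minkowskian.
   Context: The summation convention is used. An $m$-th root Finsler metric is a Finsler metric of the form $F=\sqrt[m]{A}$ with $A(x,y)=a_{i_1\dots i_m}(x)y^{i_1}\cdots y^{i_m}$, where $a_{i_1\dots i_m}$ is symmetric in all its indices; it is assumed that $A_{ij}=\frac{\partial^2A}{\partial y^i\partial y^j}$ defines a positive definite tensor. Irreducibility of $A$ means irreducibility as a polynomial in $y$. The Kropina change of $F$ by a 1-form $\beta=b_i(x)y^i$ is $\bar F(x,y)=F^2(x,y)/\beta(x,y)$ (considered where $\beta\neq0$). A Finsler metric is locally projectively flat if at any point there is a local coordinate system in which the geodesics are straight lines as point sets; equivalently, in such coordinates its geodesic (spray) coefficients $G^i=\frac14g^{il}\left[(F^2)_{x^ky^l}y^k-(F^2)_{x^l}\right]$ have the form $G^i(x,y)=P(x,y)y^i$ with $P(x,\lambda y)=\lambda P(x,y)$ for $\lambda>0$. A Finsler metric is locally Minkowskian if around each point there are local coordinates $(x^i)$ in which, with the induced coordinates $(x^i,y^i)$ on the tangent bundle, the metric does not depend on $x$.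
   Formalization: The formal theorem assumes m ≥ 3; for m = 2 the claim is false, e.g. A = f(x¹)(y¹)² + (y²)² with f > 0 and f′ ≠ 0, and β = y¹, gives a projectively flat Kropina change that is not locally Minkowskian. *)

theory Defs
  imports
    "HOL-Analysis.Analysis"
    "HOL-Library.Poly_Mapping"
    "HOL-Library.Multiset"
    "HOL-Computational_Algebra.Factorial_Ring"
begin

section \<open>Smooth maps and local coordinates\<close>

text \<open>Meant for open sets only: derivatives are taken with the full neighbourhood filter.\<close>

primrec Ck_on :: "nat \<Rightarrow> 'a::real_normed_vector set \<Rightarrow> ('a \<Rightarrow> 'b::real_normed_vector) \<Rightarrow> bool" where
  "Ck_on 0 S f \<longleftrightarrow> continuous_on S f"
| "Ck_on (Suc k) S f \<longleftrightarrow>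
     (\<forall>x\<in>S. f differentiable (at x)) \<and> (\<forall>v. Ck_on k S (\<lambda>x. frechet_derivative f (at x) v))"

definition smooth_on :: "'a::real_normed_vector set \<Rightarrow> ('a \<Rightarrow> 'b::real_normed_vector) \<Rightarrow> bool" where
  "smooth_on S f \<longleftrightarrow> (\<forall>k. Ck_on k S f)"

definition partial :: "'n::finite \<Rightarrow> (real^'n \<Rightarrow> real) \<Rightarrow> real^'n \<Rightarrow> real" where
  "partial i f p = frechet_derivative f (at p) (axis i 1)"

definition local_coords :: "(real^'n::finite) set \<Rightarrow> (real^'n \<Rightarrow> real^'n) \<Rightarrow> bool" where
  "local_coords V \<phi> \<longleftrightarrow>
     open V \<and> inj_on \<phi> V \<and> open (\<phi> ` V) \<and> smooth_on V \<phi> \<and> smooth_on (\<phi> ` V) (inv_into V \<phi>)"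

text \<open>The induced coordinates \<open>(u, v)\<close> on the tangent bundle stand for the tangent vector
  \<open>D(\<phi>\<^sup>-\<^sup>1)(u) v\<close> at the point \<open>\<phi>\<^sup>-\<^sup>1(u)\<close>.\<close>

definition coord_metric ::
  "(real^'n::finite) set \<Rightarrow> (real^'n \<Rightarrow> real^'n) \<Rightarrow> (real^'n \<Rightarrow> real^'n \<Rightarrow> real)
     \<Rightarrow> real^'n \<Rightarrow> real^'n \<Rightarrow> real" where
  "coord_metric V \<phi> F u v =
     F (inv_into V \<phi> u) (frechet_derivative (inv_into V \<phi>) (at u) v)"

definition coord_dom ::
  "(real^'n::finite) set \<Rightarrow> (real^'n \<Rightarrow> real^'n) \<Rightarrow> ((real^'n) \<times> (real^'n)) set
     \<Rightarrow> ((real^'n) \<times> (real^'n)) set" where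
  "coord_dom V \<phi> D =
     {(u, v). u \<in> \<phi> ` V \<and> (inv_into V \<phi> u, frechet_derivative (inv_into V \<phi>) (at u) v) \<in> D}"

section \<open>Finsler metrics\<close>

definition fundamental_tensor ::
  "(real^'n::finite \<Rightarrow> real^'n \<Rightarrow> real) \<Rightarrow> real^'n \<Rightarrow> real^'n \<Rightarrow> real^'n^'n" where
  "fundamental_tensor F x y =
     (\<chi> i j. 1/2 * partial i (\<lambda>y. partial j (\<lambda>y. (F x y)\<^sup>2) y) y)"

definition positive_definite :: "real^'n^'n::finite \<Rightarrow> bool" where
  "positive_definite M \<longleftrightarrow>
     (\<forall>v. v \<noteq> 0 \<longrightarrow> (\<Sum>i\<in>UNIV. \<Sum>j\<in>UNIV. M $ i $ j * v $ i * v $ j) > 0)"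

definition finsler_metric_on ::
  "(real^'n::finite) set \<Rightarrow> (real^'n \<Rightarrow> real^'n \<Rightarrow> real) \<Rightarrow> bool" where
  "finsler_metric_on U F \<longleftrightarrow>
     smooth_on {(x, y). x \<in> U \<and> y \<noteq> 0} (\<lambda>(x, y). F x y) \<and>
     (\<forall>x\<in>U. \<forall>y. y \<noteq> 0 \<longrightarrow> F x y > 0) \<and>
     (\<forall>x\<in>U. \<forall>y. \<forall>c>0. F x (c *\<^sub>R y) = c * F x y) \<and>
     (\<forall>x\<in>U. \<forall>y. y \<noteq> 0 \<longrightarrow> positive_definite (fundamental_tensor F x y))"

definition spray_coeff ::
  "(real^'n::finite \<Rightarrow> real^'n \<Rightarrow> real) \<Rightarrow> real^'n \<Rightarrow> real^'n \<Rightarrow> 'n \<Rightarrow> real" where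
  "spray_coeff F x y i =
     1/4 * (\<Sum>l\<in>UNIV. matrix_inv (fundamental_tensor F x y) $ i $ l *
       ((\<Sum>k\<in>UNIV. partial l (\<lambda>y. partial k (\<lambda>x. (F x y)\<^sup>2) x) y * y $ k)
        - partial l (\<lambda>x. (F x y)\<^sup>2) x))"

text \<open>A Kropina metric is defined only on part of the tangent bundle.  In the following two notions
  \<open>F\<close> is a metric whose domain is the set \<open>D\<close> of pairs \<open>(x, y)\<close>; values of \<open>F\<close> outside \<open>D\<close> are
  irrelevant.\<close>

definition locally_projectively_flat ::
  "(real^'n::finite) set \<Rightarrow> ((real^'n) \<times> (real^'n)) set \<Rightarrow> (real^'n \<Rightarrow> real^'n \<Rightarrow> real) \<Rightarrow> bool" where
  "locally_projectively_flat U D F \<longleftrightarrow>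
     (\<forall>p\<in>U. \<exists>V \<phi> P. p \<in> V \<and> V \<subseteq> U \<and> local_coords V \<phi> \<and>
        (\<forall>(u, v) \<in> coord_dom V \<phi> D.
           (\<forall>c>0. P u (c *\<^sub>R v) = c * P u v) \<and>
           (\<forall>i. spray_coeff (coord_metric V \<phi> F) u v i = P u v * v $ i)))"

text \<open>That the metric does not depend on the point includes that its domain does not:
  the fibre of the domain is the same set \<open>E\<close> at every point.\<close>

definition locally_minkowskian ::
  "(real^'n::finite) set \<Rightarrow> ((real^'n) \<times> (real^'n)) set \<Rightarrow> (real^'n \<Rightarrow> real^'n \<Rightarrow> real) \<Rightarrow> bool" where
  "locally_minkowskian U D F \<longleftrightarrow>
     (\<forall>p\<in>U. \<exists>V \<phi> E \<Phi>. p \<in> V \<and> V \<subseteq> U \<and> local_coords V \<phi> \<and>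
        coord_dom V \<phi> D = \<phi> ` V \<times> E \<and>
        (\<forall>u\<in>\<phi> ` V. \<forall>v\<in>E. coord_metric V \<phi> F u v = \<Phi> v))"

section \<open>Roots of forms and the Kropina change\<close>

text \<open>The coefficient with indices \<open>i\<^sub>1, \<dots>, i\<^sub>m\<close> is \<open>a x [i\<^sub>1, \<dots>, i\<^sub>m]\<close>; only lists of length \<open>m\<close>
  matter.\<close>

definition form :: "nat \<Rightarrow> ('n::finite list \<Rightarrow> real) \<Rightarrow> real^'n \<Rightarrow> real" where
  "form m c y = (\<Sum>is | length is = m. c is * prod_list (map (\<lambda>i. y $ i) is))"

text \<open>The same form as an element of the polynomial ring over the reals in indeterminates
  indexed by \<open>'n\<close>, which is the monoid algebra of the exponent vectors
  \<^typ>\<open>'n \<Rightarrow>\<^sub>0 nat\<close>.\<close>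

definition form_poly :: "nat \<Rightarrow> ('n::finite list \<Rightarrow> real) \<Rightarrow> ('n \<Rightarrow>\<^sub>0 nat) \<Rightarrow>\<^sub>0 real" where
  "form_poly m c =
     (\<Sum>is | length is = m.
        Poly_Mapping.single (sum_list (map (\<lambda>i. Poly_Mapping.single i 1) is)) (c is))"

definition mth_root :: "nat \<Rightarrow> (real^'n::finite \<Rightarrow> 'n list \<Rightarrow> real) \<Rightarrow> real^'n \<Rightarrow> real^'n \<Rightarrow> real" where
  "mth_root m a x y = root m (form m (a x) y)"

text \<open>No bound on \<open>m\<close> is built in here.  For \<open>m = 2\<close> these are the Riemannian metrics, and for
  them a locally projectively flat Kropina change need not be locally Minkowskian: take
  \<open>A = f(x\<^sup>1) (y\<^sup>1)\<^sup>2 + (y\<^sup>2)\<^sup>2\<close> with \<open>f > 0\<close> not constant, and \<open>\<beta> = y\<^sup>1\<close>.\<close>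

definition mth_root_finsler_on ::
  "(real^'n::finite) set \<Rightarrow> nat \<Rightarrow> (real^'n \<Rightarrow> 'n list \<Rightarrow> real) \<Rightarrow> bool" where
  "mth_root_finsler_on U m a \<longleftrightarrow>
     (\<forall>is. length is = m \<longrightarrow> smooth_on U (\<lambda>x. a x is)) \<and>
     (\<forall>x\<in>U. \<forall>is js. length is = m \<longrightarrow> mset is = mset js \<longrightarrow> a x is = a x js) \<and>
     finsler_metric_on U (mth_root m a) \<and>
     (\<forall>x\<in>U. \<forall>y. y \<noteq> 0 \<longrightarrow>
        positive_definite (\<chi> i j. partial i (\<lambda>y. partial j (\<lambda>y. form m (a x) y) y) y))"

definition one_form :: "(real^'n::finite \<Rightarrow> real^'n) \<Rightarrow> real^'n \<Rightarrow> real^'n \<Rightarrow> real" where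
  "one_form b x y = (\<Sum>i\<in>UNIV. b x $ i * y $ i)"

definition kropina_change ::
  "(real^'n::finite \<Rightarrow> real^'n \<Rightarrow> real) \<Rightarrow> (real^'n \<Rightarrow> real^'n \<Rightarrow> real) \<Rightarrow> real^'n \<Rightarrow> real^'n \<Rightarrow> real" where
  "kropina_change F \<beta> x y = (F x y)\<^sup>2 / \<beta> x y"

definition kropina_dom ::
  "(real^'n::finite) set \<Rightarrow> (real^'n \<Rightarrow> real^'n \<Rightarrow> real) \<Rightarrow> ((real^'n) \<times> (real^'n)) set" where
  "kropina_dom U \<beta> = {(x, y). x \<in> U \<and> \<beta> x y \<noteq> 0}"

end

theory Submission
  imports Defs
begin

text \<open>In coordinates \<open>(u, v)\<close> let \<open>A\<close> be the form, \<open>\<beta> = b \<bullet> v\<close>, and let \<open>\<Lambda> = (4/m) ln A - 2 ln \<bar>\<beta>\<bar>\<close>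
  be the logarithm of the squared Kropina metric.  The metric is nondegenerate, so \<open>G\<^sup>i = P v\<^sup>i\<close> amounts to
  \<open>1/2 \<Lambda>\<^sub>l \<Lambda>\<^sub>0 + \<Lambda>\<^sub>0\<^sub>l - \<partial>\<^sub>l \<Lambda> = 0\<close>, where the index \<open>0\<close> is contraction of an \<open>u\<close>-derivative with \<open>v\<close>.
  Clearing denominators, \<open>A\<close> divides \<open>A\<^sub>0 A\<^sub>l \<beta>\<^sup>2\<close>.  Since \<open>A\<close> is irreducible, hence prime, and \<open>m > 2\<close>, it divides
  \<open>A\<^sub>0\<close>; similarly \<open>\<beta>\<close> divides \<open>\<beta>\<^sub>0\<close>.  This forces
  \<open>\<partial>\<^sub>l A = (p \<bullet> v) A\<^sub>l + q\<^sub>l A\<close> and \<open>\<partial>\<^sub>l b = b\<^sub>l p + d\<^sub>l b\<close> with \<open>p = (2/m) q - d\<close>.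

  The second equation is a linear differential equation for \<open>b\<close> with bounded coefficients, so near a
  point \<open>b\<close> either vanishes identically or nowhere.  In the latter case the mixed second derivatives of
  \<open>A\<close> and \<open>b\<close>, with primality of \<open>A\<close> once more, give \<open>\<partial>\<^sub>k p = p\<^sub>k p\<close>, so \<open>p = p\<^sub>0 / (1 - p\<^sub>0 \<bullet> (u - u\<^sub>0))\<close>, and the
  projective transformation \<open>u \<mapsto> (u - u\<^sub>0) / (1 - p\<^sub>0 \<bullet> (u - u\<^sub>0))\<close> makes the metric independent of the point.\<close>

section \<open>Gauss's lemma for subrings of an integral domain\<close>

text \<open>Irreducibility is given point by point, for polynomials in the fibre variable, so every
  divisibility is argued in one tangent space and yields the covectors \<open>p\<close>,
  \<open>q\<close>, \<open>d\<close> by pointwise choice, with no control where \<open>b\<close>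
  vanishes. Two things compensate. Bounds for them come from \<open>A\<close> alone, uniformly on
  compact sets, so the zeros of \<open>b\<close> can be handled by a Gronwall inequality that works
  for merely bounded coefficients; where \<open>b\<close> is nonzero, explicit formulas restore
  differentiability. The exponent enters through the factor \<open>4 m - 8\<close>, which is zero in
  the Riemannian case \<open>m = 2\<close>, and through degree comparisons of \<open>A\<close> with
  forms of degree 1 and 2. That irreducible implies prime is obtained from Gauss's lemma for subsets
  of a fixed integral domain: the induction over the variables then runs through subrings of one
  type. The converse is short: in coordinates where neither the metric nor its domain depends on the
  point, the spray vanishes.\<close>

definition subring_of :: "'a::idom set \<Rightarrow> bool" where
  "subring_of R \<longleftrightarrow> 0 \<in> R \<and> 1 \<in> R \<and> (\<forall>a\<in>R. \<forall>b\<in>R. a + b \<in> R \<and> a * b \<in> R \<and> - a \<in> R)"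

definition unit_in :: "'a::idom set \<Rightarrow> 'a \<Rightarrow> bool" where
  "unit_in R u \<longleftrightarrow> u \<in> R \<and> (\<exists>v\<in>R. u * v = 1)"

definition dvd_in :: "'a::idom set \<Rightarrow> 'a \<Rightarrow> 'a \<Rightarrow> bool" where
  "dvd_in R p a \<longleftrightarrow> (\<exists>e\<in>R. a = p * e)"

definition prime_in :: "'a::idom set \<Rightarrow> 'a \<Rightarrow> bool" where
  "prime_in R p \<longleftrightarrow> p \<in> R \<and> p \<noteq> 0 \<and> \<not> unit_in R p \<and>
     (\<forall>a\<in>R. \<forall>b\<in>R. dvd_in R p (a * b) \<longrightarrow> dvd_in R p a \<or> dvd_in R p b)"

text \<open>The index counts the prime factors. It is recorded because it drops by exactly one when
  a prime is cancelled, which makes it a termination measure.\<close>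

inductive prime_prod :: "'a::idom set \<Rightarrow> nat \<Rightarrow> 'a \<Rightarrow> bool" for R where
  unit: "unit_in R u \<Longrightarrow> prime_prod R 0 u"
| step: "prime_in R p \<Longrightarrow> prime_prod R n x \<Longrightarrow> prime_prod R (Suc n) (p * x)"

text \<open>Factoriality is stated as existence of prime factorizations; with primes instead of
  irreducible elements, uniqueness up to units is automatic.\<close>

definition ufd_in :: "'a::idom set \<Rightarrow> bool" where
  "ufd_in R \<longleftrightarrow> subring_of R \<and> (\<forall>x\<in>R. x \<noteq> 0 \<longrightarrow> (\<exists>n. prime_prod R n x))"

definition polys_over :: "'a::idom set \<Rightarrow> 'a poly set" where
  "polys_over R = {q. \<forall>k. coeff q k \<in> R}"

lemma subring_ofD:
  assumes "subring_of R"
  shows "0 \<in> R" "1 \<in> R" "a \<in> R \<Longrightarrow> b \<in> R \<Longrightarrow> a + b \<in> R" "a \<in> R \<Longrightarrow> b \<in> R \<Longrightarrow> a * b \<in> R"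
    "a \<in> R \<Longrightarrow> - a \<in> R" "a \<in> R \<Longrightarrow> b \<in> R \<Longrightarrow> a - b \<in> R"
proof -
  show "a - b \<in> R" if "a \<in> R" "b \<in> R"
    using assms that unfolding subring_of_def by (metis diff_conv_add_uminus)
qed (use assms in \<open>auto simp: subring_of_def\<close>)

lemma subring_of_sum:
  assumes "subring_of R" "\<And>i. i \<in> I \<Longrightarrow> f i \<in> R"
  shows "sum f I \<in> R"
  using assms(2)
  by (induction I rule: infinite_finite_induct) (auto intro: subring_ofD[OF assms(1)])

lemma subring_polys_over:
  assumes R: "subring_of R"
  shows "subring_of (polys_over R)"
  using subring_ofD[OF R] subring_of_sum[OF R]
  unfolding subring_of_def[of "polys_over R"]
  by (auto simp: coeff_mult polys_over_def intro!: subring_of_sum[OF R])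

lemma smult_polys_over: "subring_of R \<Longrightarrow> r \<in> R \<Longrightarrow> q \<in> polys_over R \<Longrightarrow> smult r q \<in> polys_over R"
  by (auto simp: polys_over_def intro: subring_ofD)

lemma monom_polys_over: "subring_of R \<Longrightarrow> r \<in> R \<Longrightarrow> monom r n \<in> polys_over R"
  by (auto simp: polys_over_def intro: subring_ofD)

lemma coeff_polys_over: "q \<in> polys_over R \<Longrightarrow> coeff q k \<in> R"
  by (auto simp: polys_over_def)

section \<open>Products of primes and cancellation\<close>

lemma prime_prod_in:
  assumes "subring_of R" "prime_prod R n x"
  shows "x \<in> R \<and> x \<noteq> 0"
  using assms(2) by induction (auto simp: unit_in_def prime_in_def intro: subring_ofD[OF assms(1)])

lemma unit_in_mult:
  assumes "subring_of R" "unit_in R u" "unit_in R v"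
  shows "unit_in R (u * v)"
proof -
  obtain u' v' where "u' \<in> R" "v' \<in> R" "u * u' = 1" "v * v' = 1"
    using assms by (auto simp: unit_in_def)
  moreover from this have "(u * v) * (u' * v') = 1" by (metis mult.assoc mult.commute mult.right_neutral)
  ultimately show ?thesis using assms by (auto simp: unit_in_def intro!: subring_ofD bexI[of _ "u' * v'"])
qed

lemma prime_prod_unit_mult:
  assumes "subring_of R" "unit_in R u" "prime_prod R n x"
  shows "prime_prod R n (u * x)"
  using assms(3)
proof induction
  case (unit v)
  then show ?case using unit_in_mult assms by (blast intro: prime_prod.unit)
next
  case (step p n x)
  then show ?case by (metis mult.left_commute prime_prod.step)
qed

lemma prime_prod_mult:
  assumes "subring_of R" "prime_prod R n x" "prime_prod R k y"
  shows "\<exists>l. prime_prod R l (x * y)"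
  using assms(2)
proof induction
  case (unit u)
  then show ?case using prime_prod_unit_mult assms by blast
next
  case (step p n x)
  then show ?case by (metis mult.assoc prime_prod.step)
qed

text \<open>Since \<open>p\<close> is prime, it divides the leading prime of the product or the
  remaining tail. The first case makes the two primes associates, the second is the induction
  hypothesis.\<close>

lemma prime_prod_cancel:
  assumes "subring_of R" "prime_in R p" "prime_prod R n x" "x = p * y" "y \<in> R"
  shows "\<exists>k. n = Suc k \<and> prime_prod R k y"
  using assms(3-5)
proof (induction arbitrary: y)
  case (unit u)
  then obtain v where "v \<in> R" "u * v = 1" by (auto simp: unit_in_def)
  then have "p * (y * v) = 1" "y * v \<in> R" using unit assms(1) by (auto simp: mult.assoc intro: subring_ofD)
  then show ?case using assms(2) by (auto simp: prime_in_def unit_in_def)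
next
  case (step q n x)
  have R: "q \<in> R" "x \<in> R" "p \<in> R" "p \<noteq> 0" "q \<noteq> 0"
    using step prime_prod_in[OF assms(1) step.hyps(2)] assms(2) by (auto simp: prime_in_def)
  have "dvd_in R p (q * x)" using step by (auto simp: dvd_in_def)
  then consider "dvd_in R p q" | "dvd_in R p x" using assms(2) R by (auto simp: prime_in_def)
  then show ?case
  proof cases
    case 1
    then obtain e where e: "e \<in> R" "q = p * e" by (auto simp: dvd_in_def)
    then have "dvd_in R q (p * e)" using subring_ofD(2)[OF assms(1)] by (auto simp: dvd_in_def)
    \<comment> \<open>\<open>q\<close> divides \<open>p * e\<close> and is itself prime. If it
      divides \<open>p\<close>, then \<open>e\<close> is invertible; if it divides \<open>e\<close>,
      then \<open>p\<close> would be invertible.\<close>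
    then consider f where "f \<in> R" "p = q * f" | f where "f \<in> R" "e = q * f"
      using step.hyps(1) R e unfolding prime_in_def dvd_in_def by metis
    then have "unit_in R e"
    proof cases
      case 1
      then have "p * (e * f) = p * 1" using e by (simp add: mult.assoc)
      then have "e * f = 1" using R by simp
      then show ?thesis using 1 e by (auto simp: unit_in_def)
    next
      case 2
      then have "e * (p * f) = e * 1" using e by (simp add: mult_ac)
      moreover have "e \<noteq> 0" using e R by auto
      ultimately have "p * f = 1" by (simp only: mult_cancel_left) simp
      then have "unit_in R p" using 2 R by (auto simp: unit_in_def)
      then show ?thesis using assms(2) by (auto simp: prime_in_def)
    qed
    moreover have "y = e * x" using e step.prems R by (simp add: mult.assoc)
    ultimately show ?thesis using prime_prod_unit_mult step assms(1) by blast
  next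
    case 2
    then obtain e where e: "e \<in> R" "x = p * e" by (auto simp: dvd_in_def)
    then obtain k where k: "n = Suc k" "prime_prod R k e" using step by blast
    have "y = q * e" using e step.prems R by (simp add: mult.left_commute)
    then show ?thesis using k step.hyps prime_prod.step by blast
  qed
qed

lemma dvd_in_sum:
  assumes "subring_of R" "\<And>i. i \<in> I \<Longrightarrow> dvd_in R p (f i)"
  shows "dvd_in R p (sum f I)"
  using assms(2)
proof (induction I rule: infinite_finite_induct)
  case (insert i I)
  then obtain a b where "a \<in> R" "b \<in> R" "f i = p * a" "sum f I = p * b"
    unfolding dvd_in_def by (metis insertI1 insertI2)
  then have "sum f (insert i I) = p * (a + b)" using insert by (simp add: distrib_left)
  then show ?case using \<open>a \<in> R\<close> \<open>b \<in> R\<close> assms(1) subring_ofD unfolding dvd_in_def by blast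
qed (use assms(1) subring_ofD in \<open>auto simp: dvd_in_def intro!: bexI[of _ 0]\<close>)

lemma dvd_in_mult:
  assumes "subring_of R" "dvd_in R p a" "b \<in> R"
  shows "dvd_in R p (a * b)" "dvd_in R p (b * a)"
proof -
  obtain e where e: "e \<in> R" "a = p * e" using assms by (auto simp: dvd_in_def)
  then have "e * b \<in> R" "a * b = p * (e * b)" "b * a = p * (e * b)"
    using assms subring_ofD by (auto simp: mult_ac)
  then show "dvd_in R p (a * b)" "dvd_in R p (b * a)" unfolding dvd_in_def by blast+
qed

section \<open>Primes of the coefficient ring and division without fractions\<close>

lemma dvd_in_smult_iff:
  assumes "subring_of R" "p \<noteq> 0"
  shows "(\<exists>e\<in>polys_over R. a = smult p e) \<longleftrightarrow> (\<forall>k. dvd_in R p (coeff a k))"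
proof
  assume "\<forall>k. dvd_in R p (coeff a k)"
  then obtain e where e: "\<And>k. e k \<in> R" "\<And>k. coeff a k = p * e k" unfolding dvd_in_def by metis
  have "e k = 0" if "k > degree a" for k using e(2)[of k] that assms by (simp add: coeff_eq_0)
  then have "coeff (Abs_poly e) = e" by (intro coeff_Abs_poly[of "degree a"]) auto
  then have "Abs_poly e \<in> polys_over R" "a = smult p (Abs_poly e)"
    using e by (auto simp: polys_over_def intro: poly_eqI)
  then show "\<exists>e\<in>polys_over R. a = smult p e" by blast
qed (auto simp: dvd_in_def polys_over_def)

text \<open>Let \<open>i\<close> and \<open>j\<close> be the first indices whose coefficients in
  \<open>a\<close> and \<open>b\<close> escape \<open>p\<close>. Every other summand of the
  coefficient of degree \<open>i + j\<close> in \<open>a * b\<close> is divisible by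
  \<open>p\<close>, so the product of these two coefficients would be as well.\<close>

lemma prime_in_polys_over:
  assumes R: "subring_of R" and p: "prime_in R p" and P: "a \<in> polys_over R" "b \<in> polys_over R" "c \<in> polys_over R"
    and eq: "a * b = smult p c"
  shows "(\<exists>e\<in>polys_over R. a = smult p e) \<or> (\<exists>e\<in>polys_over R. b = smult p e)"
proof (rule ccontr)
  assume contra: "\<not> ?thesis"
  have p0: "p \<noteq> 0" using p by (auto simp: prime_in_def)
  obtain i0 j0 where "\<not> dvd_in R p (coeff a i0)" "\<not> dvd_in R p (coeff b j0)"
    using contra dvd_in_smult_iff[OF R p0] by blast
  define i where "i = (LEAST i. \<not> dvd_in R p (coeff a i))"
  define j where "j = (LEAST j. \<not> dvd_in R p (coeff b j))"
  have i: "\<not> dvd_in R p (coeff a i)" "\<And>k. k < i \<Longrightarrow> dvd_in R p (coeff a k)"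
    unfolding i_def using LeastI[of "\<lambda>i. \<not> dvd_in R p (coeff a i)" i0] \<open>\<not> dvd_in R p (coeff a i0)\<close>
    by (auto dest: not_less_Least)
  have j: "\<not> dvd_in R p (coeff b j)" "\<And>k. k < j \<Longrightarrow> dvd_in R p (coeff b k)"
    unfolding j_def using LeastI[of "\<lambda>j. \<not> dvd_in R p (coeff b j)" j0] \<open>\<not> dvd_in R p (coeff b j0)\<close>
    by (auto dest: not_less_Least)
  let ?f = "\<lambda>k. coeff a k * coeff b (i + j - k)"
  have "coeff (a * b) (i + j) = sum ?f {..i + j}" by (simp add: coeff_mult)
  also have "\<dots> = ?f i + sum ?f ({..i + j} - {i})" by (rule sum.remove) auto
  finally have *: "coeff a i * coeff b j = p * coeff c (i + j) - sum ?f ({..i + j} - {i})"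
    using eq by simp
  have "dvd_in R p (sum ?f ({..i + j} - {i}))"
  proof (rule dvd_in_sum[OF R])
    fix k assume k: "k \<in> {..i + j} - {i}"
    show "dvd_in R p (?f k)"
    proof (cases "k < i")
      case True
      then show ?thesis using i P coeff_polys_over dvd_in_mult[OF R] by blast
    next
      case False
      then have "i + j - k < j" using k by auto
      then show ?thesis using j P coeff_polys_over dvd_in_mult[OF R] by blast
    qed
  qed
  then obtain e where "e \<in> R" "sum ?f ({..i + j} - {i}) = p * e" by (auto simp: dvd_in_def)
  then have "coeff a i * coeff b j = p * (coeff c (i + j) - e)" using * by (simp add: right_diff_distrib)
  then have "dvd_in R p (coeff a i * coeff b j)"
    using \<open>e \<in> R\<close> P coeff_polys_over subring_ofD(6)[OF R] unfolding dvd_in_def by blast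
  then show False using p i(1) j(1) P coeff_polys_over unfolding prime_in_def by metis
qed

text \<open>Plays the role of content 1, phrased through primes instead of greatest common divisors
  of the coefficients.\<close>

definition primitive_over :: "'a::idom set \<Rightarrow> 'a poly \<Rightarrow> bool" where
  "primitive_over R q \<longleftrightarrow> (\<forall>p. prime_in R p \<longrightarrow> \<not> (\<exists>e\<in>polys_over R. q = smult p e))"

text \<open>Every prime factor of \<open>r\<close> divides \<open>q * h\<close>, and by Gauss it
  divides \<open>h\<close>, as it cannot divide the primitive \<open>q\<close>. The factors are
  removed one at a time.\<close>

lemma primitive_cancel:
  assumes R: "subring_of R" and q: "q \<in> polys_over R" "primitive_over R q"
    and r: "prime_prod R n r" and P: "s \<in> polys_over R" "h \<in> polys_over R" and eq: "q * h = smult r s"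
  shows "\<exists>h'\<in>polys_over R. h = smult r h' \<and> s = q * h'"
  using r P eq
proof (induction arbitrary: s h)
  case (unit u)
  then obtain v where v: "v \<in> R" "u * v = 1" by (auto simp: unit_in_def)
  then have "h = smult u (smult v h)" by simp
  moreover have "s = q * smult v h"
    using unit v arg_cong[OF unit(4), of "smult v"] by (simp add: mult.commute)
  ultimately show ?case using v unit smult_polys_over[OF R] by blast
next
  case (step p n x)
  have x: "x \<in> R" "p \<noteq> 0" using prime_prod_in[OF R] step by (auto simp: prime_in_def)
  have "q * h = smult p (smult x s)" using step by simp
  then obtain h1 where h1: "h1 \<in> polys_over R" "h = smult p h1"
    using prime_in_polys_over[OF R step(1) q(1) step(5), of "smult x s"] q(2) step smult_polys_over[OF R] x
    unfolding primitive_over_def by blast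
  then have "smult p (q * h1) = smult p (smult x s)" using step by simp
  then have "q * h1 = smult x s" using x by (simp only: smult_cancel)
  then show ?case using step h1 by (metis smult_smult)
qed

text \<open>Each prime of the scalar \<open>r\<close> divides \<open>a\<close> or \<open>f\<close>
  and is divided out there. This does the work of descending a factorization from the fraction field
  to \<open>R\<close>.\<close>

lemma scaled_factorization:
  assumes R: "subring_of R" and r: "prime_prod R n r"
    and P: "q \<in> polys_over R" "a \<in> polys_over R" "f \<in> polys_over R" and eq: "a * f = smult r q"
  shows "\<exists>r1\<in>R. \<exists>r2\<in>R. \<exists>a'\<in>polys_over R. \<exists>f'\<in>polys_over R. a = smult r1 a' \<and> f = smult r2 f' \<and> q = a' * f'"
  using r P eq
proof (induction arbitrary: q a f)
  case (unit u)
  then obtain v where v: "v \<in> R" "u * v = 1" by (auto simp: unit_in_def)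
  then have "a = smult u (smult v a)" by simp
  moreover have "q = smult v a * f"
    using unit v arg_cong[OF unit(5), of "smult v"] by (simp add: mult.commute)
  ultimately show ?case using v unit smult_polys_over[OF R] subring_ofD(2)[OF R]
    by (metis smult_1_left unit_in_def)
next
  case (step p n x)
  have x: "x \<in> R" "p \<noteq> 0" "p \<in> R" using prime_prod_in[OF R] step by (auto simp: prime_in_def)
  have "a * f = smult p (smult x q)" using step by simp
  from prime_in_polys_over[OF R step(1) step(5,6) smult_polys_over[OF R x(1) step(4)] this]
  consider a1 where "a1 \<in> polys_over R" "a = smult p a1" | f1 where "f1 \<in> polys_over R" "f = smult p f1"
    by auto
  then show ?case
  proof cases
    case 1
    then have "smult p (a1 * f) = smult p (smult x q)" using step by simp
    then have "a1 * f = smult x q" using x by (simp only: smult_cancel)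
    then obtain r1 r2 a' f' where *: "r1 \<in> R" "r2 \<in> R" "a' \<in> polys_over R" "f' \<in> polys_over R"
      "a1 = smult r1 a'" "f = smult r2 f'" "q = a' * f'" using step.IH[OF step(4) 1(1) step(6)] by blast
    then have "a = smult (p * r1) a'" "p * r1 \<in> R" using 1 x subring_ofD[OF R] by auto
    then show ?thesis using * by blast
  next
    case 2
    then have "smult p (a * f1) = smult p (smult x q)" using step by simp
    then have "a * f1 = smult x q" using x by (simp only: smult_cancel)
    then obtain r1 r2 a' f' where *: "r1 \<in> R" "r2 \<in> R" "a' \<in> polys_over R" "f' \<in> polys_over R"
      "a = smult r1 a'" "f1 = smult r2 f'" "q = a' * f'" using step.IH[OF step(4,5) 2(1)] by blast
    then have "f = smult (p * r2) f'" "p * r2 \<in> R" using 2 x subring_ofD[OF R] by auto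
    then show ?thesis using * by blast
  qed
qed

text \<open>Euclidean division in which the leading coefficient of \<open>f\<close> is absorbed into
  the scalar \<open>r\<close> at each step, so that the division stays inside
  \<open>R\<close>.\<close>

lemma pseudo_division_over:
  assumes R: "subring_of R" and f: "f \<in> polys_over R" "f \<noteq> 0" and e: "e \<in> polys_over R"
  shows "\<exists>r\<in>R. \<exists>s\<in>polys_over R. \<exists>t\<in>polys_over R. r \<noteq> 0 \<and> smult r e = s * f + t \<and> (t = 0 \<or> degree t < degree f)"
  using e
\<comment> \<open>The measure puts the zero polynomial below nonzero constants, so that cancelling
  the leading term of a constant still counts as a decrease.\<close>
proof (induction "if e = 0 then 0 else Suc (degree e)" arbitrary: e rule: less_induct)
  case less
  note P = subring_ofD[OF subring_polys_over[OF R]] and Rs = subring_ofD[OF R]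
  show ?case
  proof (cases "e = 0 \<or> degree e < degree f")
    case True
    then have "smult 1 e = 0 * f + e" by simp
    then show ?thesis using True less P Rs by (metis one_neq_zero)
  next
    case False
    define n where "n = degree e - degree f"
    define g where "g = monom (lead_coeff e) n * f"
    define e1 where "e1 = smult (lead_coeff f) e - g"
    have lc: "lead_coeff f \<in> R" "lead_coeff e \<in> R" "lead_coeff f \<noteq> 0" "lead_coeff e \<noteq> 0"
      using f less False coeff_polys_over by auto
    have mono: "monom (lead_coeff e) n \<in> polys_over R" using monom_polys_over[OF R lc(2)] .
    have g: "g \<in> polys_over R" unfolding g_def by (rule P(4)[OF mono f(1)])
    have e1: "e1 \<in> polys_over R" unfolding e1_def by (rule P(6)[OF smult_polys_over[OF R lc(1) less(2)] g])
    have dg: "degree g = degree e" "lead_coeff g = lead_coeff e * lead_coeff f"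
    proof -
      show "degree g = degree e"
        unfolding g_def using lc f False by (simp add: degree_mult_eq degree_monom_eq n_def monom_eq_0_iff)
      show "lead_coeff g = lead_coeff e * lead_coeff f"
        unfolding g_def by (simp only: lead_coeff_mult lead_coeff_monom)
    qed
    have "degree e1 \<le> degree e" unfolding e1_def
      by (intro degree_diff_le) (auto simp: dg degree_smult_le)
    moreover have "coeff e1 (degree e) = 0" unfolding e1_def using dg by (simp add: mult.commute)
    ultimately have "e1 = 0 \<or> degree e1 < degree e" using leading_coeff_0_iff[of e1] le_neq_implies_less by metis
    then have "(if e1 = 0 then 0 else Suc (degree e1)) < (if e = 0 then 0 else Suc (degree e))"
      using False by auto
    from less(1)[OF this e1] obtain r s t where IH: "r \<in> R" "s \<in> polys_over R" "t \<in> polys_over R" "r \<noteq> 0"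
      "smult r e1 = s * f + t" "t = 0 \<or> degree t < degree f" by blast
    have "smult (r * lead_coeff f) e = smult r e1 + smult r g" unfolding e1_def
      by (simp add: smult_diff_right)
    also have "\<dots> = (s + smult r (monom (lead_coeff e) n)) * f + t"
      unfolding IH g_def by (simp add: algebra_simps)
    finally have "smult (r * lead_coeff f) e = (s + smult r (monom (lead_coeff e) n)) * f + t" .
    moreover have "s + smult r (monom (lead_coeff e) n) \<in> polys_over R"
      by (rule P(3)[OF IH(2) smult_polys_over[OF R IH(1) mono]])
    moreover have "r * lead_coeff f \<in> R" "r * lead_coeff f \<noteq> 0" using Rs IH lc by auto
    ultimately show ?thesis using IH by blast
  qed
qed

text \<open>The multipliers \<open>f\<close> with \<open>q\<close> dividing \<open>f * h\<close>
  form an ideal that contains \<open>q\<close> and \<open>g\<close>; a nonzero element of least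
  degree divides all of them up to scalars. If it is constant, primitivity of \<open>q\<close> gives
  that \<open>q\<close> divides \<open>h\<close>. Otherwise it divides a scalar multiple of
  \<open>q\<close>, and the assumption on factorizations makes it a scalar multiple of
  \<open>q\<close>, so that \<open>q\<close> divides \<open>g\<close>.\<close>

lemma prime_in_polys_overI:
  assumes ufd: "ufd_in R" and q: "q \<in> polys_over R" "primitive_over R q" "degree q \<ge> 1"
    and irr: "\<And>f g. f \<in> polys_over R \<Longrightarrow> g \<in> polys_over R \<Longrightarrow> q = f * g \<Longrightarrow> degree f = 0 \<or> degree g = 0"
  shows "prime_in (polys_over R) q"
proof -
  have R: "subring_of R" using ufd by (auto simp: ufd_in_def)
  note P = subring_ofD[OF subring_polys_over[OF R]] and Rs = subring_ofD[OF R]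
  have q0: "q \<noteq> 0" using q by auto
  have fac: "\<exists>n. prime_prod R n r" if "r \<in> R" "r \<noteq> 0" for r using ufd that by (auto simp: ufd_in_def)
  have "dvd_in (polys_over R) q g"
    if g: "g \<in> polys_over R" and h: "h \<in> polys_over R" and gh: "dvd_in (polys_over R) q (g * h)"
      and nh: "\<not> dvd_in (polys_over R) q h" for g h
  proof -
    define I where "I = {f\<in>polys_over R. dvd_in (polys_over R) q (f * h)}"
    have qI: "q \<in> I" using q h by (auto simp: I_def dvd_in_def)
    have gI: "g \<in> I" using g gh by (auto simp: I_def)
    define f where "f = arg_min degree (\<lambda>f. f \<in> I \<and> f \<noteq> 0)"
    have "f \<in> I \<and> f \<noteq> 0" unfolding f_def by (rule arg_min_natI[where k = q]) (use qI q0 in auto)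
    then have f: "f \<in> I" "f \<noteq> 0" "f \<in> polys_over R" by (auto simp: I_def)
    have fmin: "degree f \<le> degree e" if "e \<in> I" "e \<noteq> 0" for e
      unfolding f_def by (rule arg_min_nat_le) (use that in auto)
    have div: "\<exists>r\<in>R. \<exists>s\<in>polys_over R. r \<noteq> 0 \<and> smult r e = s * f" if eI: "e \<in> I" for e
    proof -
      have "e \<in> polys_over R" using eI by (auto simp: I_def)
      then obtain r s t where *: "r \<in> R" "s \<in> polys_over R" "t \<in> polys_over R" "r \<noteq> 0"
        "smult r e = s * f + t" "t = 0 \<or> degree t < degree f"
        using pseudo_division_over[OF R f(3,2), of e] by auto
      obtain x y where xy: "x \<in> polys_over R" "y \<in> polys_over R" "e * h = q * x" "f * h = q * y"
        using f eI by (auto simp: I_def dvd_in_def)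
      have t: "t = smult r e - s * f" using * by simp
      have "t * h = smult r (e * h) - s * (f * h)" unfolding t by (simp add: algebra_simps)
      also have "\<dots> = q * (smult r x - s * y)" unfolding xy by (simp add: algebra_simps)
      finally have "t * h = q * (smult r x - s * y)" .
      moreover have "smult r x - s * y \<in> polys_over R"
        by (rule P(6)[OF smult_polys_over[OF R *(1) xy(1)] P(4)[OF *(2) xy(2)]])
      ultimately have "t \<in> I" using * by (auto simp: I_def dvd_in_def)
      \<comment> \<open>The remainder lies in \<open>I\<close> and would have smaller degree than
        the minimal \<open>f\<close>.\<close>
      then have "t = 0" using fmin[of t] * by fastforce
      then show ?thesis using * by auto
    qed
    show ?thesis
    proof (cases "degree f = 0")
      case True
      then obtain r where r: "f = [:r:]" using degree_eq_zeroE by blast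
      then have r2: "r \<in> R" "r \<noteq> 0" using f coeff_polys_over[of f R 0] by auto
      obtain y where "y \<in> polys_over R" "f * h = q * y" using f by (auto simp: I_def dvd_in_def)
      then have y: "y \<in> polys_over R" "q * y = smult r h" using r by auto
      obtain n where "prime_prod R n r" using fac r2 by blast
      then have "\<exists>h'\<in>polys_over R. y = smult r h' \<and> h = q * h'"
        using primitive_cancel[OF R q(1,2) _ h y] by blast
      then show ?thesis using nh by (auto simp: dvd_in_def)
    next
      case False
      obtain r s where rs: "r \<in> R" "s \<in> polys_over R" "r \<noteq> 0" "s * f = smult r q"
        using div[OF qI] by metis
      then obtain n where "prime_prod R n r" using fac by blast
      from scaled_factorization[OF R this q(1) rs(2) f(3) rs(4)]
      obtain r1 r2 a' f' where *: "r1 \<in> R" "r2 \<in> R" "a' \<in> polys_over R" "f' \<in> polys_over R"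
        "s = smult r1 a'" "f = smult r2 f'" "q = a' * f'" by blast
      have "r2 \<noteq> 0" "degree f' \<noteq> 0" using * f False by auto
      then have "degree a' = 0" using irr[OF *(3,4,7)] by simp
      then obtain u where u: "a' = [:u:]" using degree_eq_zeroE by blast
      have u2: "u \<in> R" "u \<noteq> 0" using * u coeff_polys_over[of a' R 0] q0 by auto
      then obtain k where k: "prime_prod R k u" using fac by blast
      have qf: "q = smult u f'" using * u by simp
      \<comment> \<open>A prime factor of \<open>u\<close> would divide every coefficient of the
        primitive \<open>q\<close>.\<close>
      have "unit_in R u" using k
      proof cases
        case (step p n x)
        then have "q = smult p (smult x f')" using qf by simp
        moreover have "smult x f' \<in> polys_over R"
          using smult_polys_over[OF R] prime_prod_in[OF R] step * by blast
        ultimately show ?thesis using q(2) step(3) unfolding primitive_over_def by blast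
      qed auto
      then obtain v where v: "v \<in> R" "u * v = 1" by (auto simp: unit_in_def)
      then have f'q: "f' = smult v q" using qf by (simp add: mult.commute)
      obtain r' s' where rs': "r' \<in> R" "s' \<in> polys_over R" "r' \<noteq> 0" "smult r' g = s' * f"
        using div[OF gI] by metis
      have "s' * f = s' * smult (r2 * v) q" by (subst *(6), subst f'q) simp
      then have "q * smult (r2 * v) s' = smult r' g" using rs'(4) by (simp add: mult.commute)
      moreover have "smult (r2 * v) s' \<in> polys_over R" by (rule smult_polys_over[OF R Rs(4)[OF *(2) v(1)] rs'(2)])
      moreover obtain l where "prime_prod R l r'" using fac rs' by blast
      ultimately have "\<exists>h'\<in>polys_over R. smult (r2 * v) s' = smult r' h' \<and> g = q * h'"
        using primitive_cancel[OF R q(1,2) _ g] by blast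
      then show ?thesis unfolding dvd_in_def by blast
    qed
  qed
  moreover have "\<not> unit_in (polys_over R) q"
  proof
    assume "unit_in (polys_over R) q"
    then obtain v where "q * v = 1" by (auto simp: unit_in_def)
    moreover from this have "v \<noteq> 0" by auto
    ultimately have "degree q + degree v = 0" using degree_mult_eq[of q v] q0 by simp
    then show False using q by simp
  qed
  ultimately show ?thesis using q q0 unfolding prime_in_def by blast
qed

section \<open>Factorization of polynomials over a factorial ring\<close>

lemma primitive_part_exists:
  assumes ufd: "ufd_in R" and q: "q \<in> polys_over R" "q \<noteq> 0"
  shows "\<exists>c n. \<exists>q'\<in>polys_over R. prime_prod R n c \<and> primitive_over R q' \<and> q = smult c q'"
proof -
  have R: "subring_of R" using ufd by (auto simp: ufd_in_def)
  have "lead_coeff q \<in> R" "lead_coeff q \<noteq> 0" using q coeff_polys_over by auto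
  then obtain n where "prime_prod R n (lead_coeff q)" using ufd by (auto simp: ufd_in_def)
  then show ?thesis using q
  \<comment> \<open>Dividing \<open>q\<close> by a prime of \<open>R\<close> shortens the
    factorization of the leading coefficient by one.\<close>
  proof (induction n arbitrary: q rule: less_induct)
    case (less n)
    show ?case
    proof (cases "primitive_over R q")
      case True
      have "prime_prod R 0 1" by (rule prime_prod.unit) (auto simp: unit_in_def subring_ofD[OF R])
      then show ?thesis using True less.prems by (metis smult_1_left)
    next
      case False
      then obtain p e where p: "prime_in R p" "e \<in> polys_over R" "q = smult p e"
        by (auto simp: primitive_over_def)
      then have "lead_coeff q = p * lead_coeff e" by simp
      then obtain k where k: "n = Suc k" "prime_prod R k (lead_coeff e)"
        using prime_prod_cancel[OF R p(1) less.prems(1)] p coeff_polys_over by blast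
      have "e \<noteq> 0" using p less.prems by auto
      then obtain c l q' where "q' \<in> polys_over R" "prime_prod R l c" "primitive_over R q'" "e = smult c q'"
        using less.IH[of k e] k p by auto
      then show ?thesis using p prime_prod.step[OF p(1)] by (metis smult_smult)
    qed
  qed
qed

text \<open>Induction on the degree after the primitive part is split off: that part is constant, a
  product of two polynomials of positive degree, or prime by
  \<open>prime_in_polys_overI\<close>.\<close>

theorem ufd_in_polys_over:
  assumes ufd: "ufd_in R"
  shows "ufd_in (polys_over R)"
proof -
  have R: "subring_of R" using ufd by (auto simp: ufd_in_def)
  have P: "subring_of (polys_over R)" by (rule subring_polys_over[OF R])
  have const_in: "[:a:] \<in> polys_over R" if "a \<in> R" for a
    using that subring_ofD(1)[OF R] by (auto simp: polys_over_def coeff_pCons split: nat.splits)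
  have unit_const: "unit_in (polys_over R) [:u:]" if u: "unit_in R u" for u
  proof -
    obtain v where "v \<in> R" "u * v = 1" using u by (auto simp: unit_in_def)
    then have "[:u:] * [:v:] = 1" by (simp add: one_pCons mult.commute)
    then show ?thesis using const_in u \<open>v \<in> R\<close> unfolding unit_in_def by blast
  qed
  have nonunit: "\<not> unit_in (polys_over R) [:p:]" if "\<not> unit_in R p" "p \<in> R" for p
  proof
    assume "unit_in (polys_over R) [:p:]"
    then obtain v where "v \<in> polys_over R" "[:p:] * v = 1" by (auto simp: unit_in_def)
    then have "coeff ([:p:] * v) 0 = 1" "coeff v 0 \<in> R" using coeff_polys_over by auto
    then show False using that by (auto simp: unit_in_def)
  qed
  have prime_const: "prime_in (polys_over R) [:p:]" if p: "prime_in R p" for p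
  proof -
    have dvd: "dvd_in (polys_over R) [:p:] a \<longleftrightarrow> (\<exists>e\<in>polys_over R. a = smult p e)" for a
      by (auto simp: dvd_in_def)
    have "dvd_in (polys_over R) [:p:] a \<or> dvd_in (polys_over R) [:p:] b"
      if ab: "a \<in> polys_over R" "b \<in> polys_over R" "dvd_in (polys_over R) [:p:] (a * b)" for a b
    proof -
      obtain c where "c \<in> polys_over R" "a * b = smult p c" using ab dvd by blast
      from prime_in_polys_over[OF R p ab(1,2) this] show ?thesis unfolding dvd .
    qed
    moreover have "[:p:] \<in> polys_over R" "[:p:] \<noteq> 0" "\<not> unit_in (polys_over R) [:p:]"
      using p nonunit const_in by (auto simp: prime_in_def)
    ultimately show ?thesis unfolding prime_in_def by blast
  qed
  have const: "prime_prod (polys_over R) n [:c:]" if "prime_prod R n c" for n c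
    using that
  proof induction
    case (step p n x)
    then have "prime_prod (polys_over R) (Suc n) ([:p:] * [:x:])"
      using prime_const prime_prod.step by blast
    then show ?case by (simp add: mult.commute)
  qed (use unit_const prime_prod.unit in blast)
  have "\<exists>n. prime_prod (polys_over R) n q" if "q \<in> polys_over R" "q \<noteq> 0" for q
    using that
  proof (induction "degree q" arbitrary: q rule: less_induct)
    case less
    obtain c n q' where c: "prime_prod R n c" and q': "q' \<in> polys_over R" "primitive_over R q'" and qc: "q = smult c q'"
      using primitive_part_exists[OF ufd less.prems] by blast
    have dq: "degree q' = degree q" "q' \<noteq> 0" using qc less.prems by auto
    have "\<exists>k. prime_prod (polys_over R) k q'"
    proof (cases "degree q' = 0")
      case True
      then obtain a where a: "q' = [:a:]" using degree_eq_zeroE by blast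
      then have "a \<in> R" "a \<noteq> 0" using q' dq coeff_polys_over[of q' R 0] by auto
      then show ?thesis using a const ufd unfolding ufd_in_def by blast
    next
      case False
      show ?thesis
      proof (cases "\<exists>f\<in>polys_over R. \<exists>g\<in>polys_over R. q' = f * g \<and> degree f \<noteq> 0 \<and> degree g \<noteq> 0")
        case True
        then obtain f g where fg: "f \<in> polys_over R" "g \<in> polys_over R" "q' = f * g" "degree f \<noteq> 0" "degree g \<noteq> 0"
          by blast
        have "f \<noteq> 0" "g \<noteq> 0" using fg dq by auto
        moreover from this have "degree q' = degree f + degree g" using fg degree_mult_eq by blast
        ultimately show ?thesis
          using less.hyps[of f] less.hyps[of g] fg dq prime_prod_mult[OF P] by force
      next
        case False2: False
        have "prime_in (polys_over R) q'"
          by (rule prime_in_polys_overI[OF ufd q']) (use False False2 in auto)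
        moreover have "prime_prod (polys_over R) 0 1"
          by (rule prime_prod.unit) (auto simp: unit_in_def subring_ofD[OF P])
        ultimately show ?thesis using prime_prod.step by fastforce
      qed
    qed
    moreover have "q = [:c:] * q'" using qc by simp
    ultimately show ?case using prime_prod_mult[OF P const[OF c]] by blast
  qed
  then show ?thesis using P by (auto simp: ufd_in_def)
qed

text \<open>Meant to carry factoriality from the polynomials over \<open>pf_in S\<close> to
  \<open>pf_in (insert i S)\<close>. Prime factorizations speak of products alone, so a
  multiplicative bijection transports them.\<close>

lemma ufd_in_image:
  assumes ufd: "ufd_in R" and S: "subring_of S" and bij: "bij_betw h R S"
    and h: "\<And>a b. a \<in> R \<Longrightarrow> b \<in> R \<Longrightarrow> h (a * b) = h a * h b" "h 0 = 0" "h 1 = 1"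
  shows "ufd_in S"
proof -
  have R: "subring_of R" using ufd by (auto simp: ufd_in_def)
  note Rs = subring_ofD[OF R]
  have inj: "h a = h b \<longleftrightarrow> a = b" if "a \<in> R" "b \<in> R" for a b
    using bij that by (auto simp: bij_betw_def inj_on_def)
  have onto: "\<exists>a\<in>R. y = h a" if "y \<in> S" for y using bij that by (auto simp: bij_betw_def)
  have into: "h a \<in> S" if "a \<in> R" for a using bij that by (auto simp: bij_betw_def)
  have unit: "unit_in S (h u) \<longleftrightarrow> unit_in R u" if "u \<in> R" for u
    using that onto into inj h Rs unfolding unit_in_def by metis
  have dvd: "dvd_in S (h a) (h b) \<longleftrightarrow> dvd_in R a b" if "a \<in> R" "b \<in> R" for a b
    using that onto into inj h Rs unfolding dvd_in_def by metis
  have prime: "prime_in S (h p)" if p: "prime_in R p" for p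
  proof -
    have pR: "p \<in> R" "p \<noteq> 0" "\<not> unit_in R p" using p by (auto simp: prime_in_def)
    have "dvd_in S (h p) a \<or> dvd_in S (h p) b" if ab: "a \<in> S" "b \<in> S" "dvd_in S (h p) (a * b)" for a b
    proof -
      obtain a' b' where "a' \<in> R" "b' \<in> R" "a = h a'" "b = h b'" using onto ab by metis
      then show ?thesis using ab p pR dvd Rs h(1) unfolding prime_in_def by metis
    qed
    moreover have "h p \<noteq> 0" using pR inj[of p 0] h Rs by auto
    ultimately show ?thesis using pR unit into unfolding prime_in_def by blast
  qed
  have "prime_prod S n (h x)" if "prime_prod R n x" for n x
    using that
  proof induction
    case (unit u)
    then have "unit_in S (h u)" using \<open>\<And>u. u \<in> R \<Longrightarrow> _ = unit_in R u\<close>[of u] by (auto simp: unit_in_def)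
    then show ?case by (rule prime_prod.unit)
  next
    case (step p n x)
    then have "h (p * x) = h p * h x" using h prime_prod_in[OF R] by (auto simp: prime_in_def)
    then show ?case using step prime prime_prod.step by metis
  qed
  moreover have "\<exists>a\<in>R. y = h a \<and> a \<noteq> 0" if "y \<in> S" "y \<noteq> 0" for y using onto that h by metis
  ultimately show ?thesis using S ufd unfolding ufd_in_def by metis
qed

section \<open>Unique factorization of polynomial functions\<close>

lemmas rpf_linear = real_polynomial_function.intros(1)
  and rpf_const = real_polynomial_function.intros(2)
  and rpf_add = real_polynomial_function.intros(3)
  and rpf_mult = real_polynomial_function.intros(4)

text \<open>Polynomial functions are made a type so that they form an integral domain to which the
  theory of subrings applies.\<close>

typedef (overloaded) ('n::finite) pf = "{f :: real^'n \<Rightarrow> real. real_polynomial_function f}"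
  morphisms pf_apply Abs_pf
  by (auto intro: rpf_const)

setup_lifting type_definition_pf

text \<open>Restriction to a line reduces questions about several variables to univariate
  polynomials, where a degree is available and nonzero polynomials have finitely many zeros.\<close>

lemma rpf_line:
  assumes "real_polynomial_function (f :: 'a::real_normed_vector \<Rightarrow> real)"
  shows "\<exists>q::real poly. \<forall>t. f (v + t *\<^sub>R w) = poly q t"
  using assms
proof induction
  case (linear f)
  then have "f (v + t *\<^sub>R w) = poly [:f v, f w:] t" for t
    by (simp add: linear_simps bounded_linear.linear)
  then show ?case by blast
next
  case (const c)
  have "\<forall>t. c = poly [:c:] t" by simp
  then show ?case by blast
next
  case (add f g)
  then show ?case by (metis poly_add)
next
  case (mult f g)
  then show ?case by (metis poly_mult)
qed

lemma rpf_no_zero_divisors: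
  fixes f g :: "'a::real_normed_vector \<Rightarrow> real"
  assumes "real_polynomial_function f" "real_polynomial_function g" "\<And>v. f v * g v = 0"
  shows "(\<forall>v. f v = 0) \<or> (\<forall>v. g v = 0)"
proof (rule ccontr)
  assume "\<not> ?thesis"
  then obtain v w where vw: "f v \<noteq> 0" "g w \<noteq> 0" by blast
  \<comment> \<open>The line passes through \<open>v\<close> at parameter 0 and through
    \<open>w\<close> at parameter 1, so neither restriction is the zero polynomial.\<close>
  obtain p q where p: "\<And>t. f (v + t *\<^sub>R (w - v)) = poly p t" and q: "\<And>t. g (v + t *\<^sub>R (w - v)) = poly q t"
    using rpf_line[OF assms(1)] rpf_line[OF assms(2)] by metis
  have "poly (p * q) t = 0" for t using assms(3) p q by (metis poly_mult)
  then have "p * q = 0" using poly_all_0_iff_0 by blast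
  moreover have "poly p 0 \<noteq> 0" "poly q 1 \<noteq> 0" using p[of 0] q[of 1] vw by auto
  ultimately show False by auto
qed

instantiation pf :: (finite) idom
begin

lift_definition zero_pf :: "'a pf" is "\<lambda>x. 0" by (rule rpf_const)
lift_definition one_pf :: "'a pf" is "\<lambda>x. 1" by (rule rpf_const)
lift_definition plus_pf :: "'a pf \<Rightarrow> 'a pf \<Rightarrow> 'a pf" is "\<lambda>f g x. f x + g x"
  by (rule rpf_add)
lift_definition times_pf :: "'a pf \<Rightarrow> 'a pf \<Rightarrow> 'a pf" is "\<lambda>f g x. f x * g x"
  by (rule rpf_mult)
lift_definition uminus_pf :: "'a pf \<Rightarrow> 'a pf" is "\<lambda>f x. - f x"
  by (rule real_polynomial_function_minus)
lift_definition minus_pf :: "'a pf \<Rightarrow> 'a pf \<Rightarrow> 'a pf" is "\<lambda>f g x. f x - g x"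
  by (rule real_polynomial_function_diff)

instance
proof
  fix a b :: "'a pf"
  show "a * b \<noteq> 0" if "a \<noteq> 0" "b \<noteq> 0"
    using that by transfer (use rpf_no_zero_divisors in \<open>force simp: fun_eq_iff\<close>)
qed (transfer; simp add: fun_eq_iff algebra_simps)+

end

lemma pf_apply_simps [simp]:
  "pf_apply 0 v = 0" "pf_apply 1 v = 1" "pf_apply (a + b) v = pf_apply a v + pf_apply b v"
  "pf_apply (a * b) v = pf_apply a v * pf_apply b v" "pf_apply (- a) v = - pf_apply a v"
  by (transfer, simp)+

lemma pf_eqI: "(\<And>v. pf_apply a v = pf_apply b v) \<Longrightarrow> a = b"
  by transfer auto

lemma pf_apply_Abs_pf: "real_polynomial_function f \<Longrightarrow> pf_apply (Abs_pf f) v = f v"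
  by (simp add: Abs_pf_inverse)

lemma rpf_pf_apply: "real_polynomial_function (pf_apply a)"
  using pf_apply[of a] by simp

definition restrict_vec :: "'n set \<Rightarrow> real^'n \<Rightarrow> real^'n" where
  "restrict_vec S v = (\<chi> i. if i \<in> S then v $ i else 0)"

lemma linear_restrict_vec: "linear (restrict_vec S)"
  by (rule linearI) (auto simp: restrict_vec_def vec_eq_iff)

text \<open>The functions that depend only on the coordinates in \<open>S\<close>. They remain
  functions on the full space, so all stages of the induction over the variables are subrings of one
  domain.\<close>

definition pf_in :: "'n::finite set \<Rightarrow> 'n pf set" where
  "pf_in S = {a. \<forall>v. pf_apply a (restrict_vec S v) = pf_apply a v}"

lemma pf_inD: "a \<in> pf_in S \<Longrightarrow> pf_apply a (restrict_vec S v) = pf_apply a v"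
  by (simp add: pf_in_def)

definition pf_var :: "'n::finite \<Rightarrow> 'n pf" where
  "pf_var i = Abs_pf (\<lambda>v. v $ i)"

lemma pf_apply_pf_var [simp]: "pf_apply (pf_var i) v = v $ i"
  unfolding pf_var_def by (intro pf_apply_Abs_pf rpf_linear bounded_linear_vec_nth)

lemma subring_of_pf_in: "subring_of (pf_in S)"
  by (auto simp: subring_of_def pf_in_def)

lemma ufd_in_pf_in_empty: "ufd_in (pf_in {} :: 'n::finite pf set)"
proof -
  have "unit_in (pf_in {}) x" if x: "x \<in> pf_in {}" "x \<noteq> 0" for x :: "'n pf"
  proof -
    define c where "c = pf_apply x 0"
    have "restrict_vec {} v = 0" for v :: "real^'n" by (simp add: restrict_vec_def vec_eq_iff)
    then have *: "pf_apply x v = c" for v using pf_inD[OF x(1), of v] by (simp add: c_def)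
    then have "c \<noteq> 0" using x pf_eqI[of x 0] by auto
    moreover have y: "pf_apply (Abs_pf (\<lambda>v. inverse c)) v = inverse c" for v :: "real^'n"
      by (intro pf_apply_Abs_pf rpf_const)
    ultimately have "x * Abs_pf (\<lambda>v. inverse c) = 1" by (intro pf_eqI) (simp add: *)
    moreover have "Abs_pf (\<lambda>v. inverse c) \<in> pf_in ({} :: 'n set)" by (simp add: pf_in_def y)
    ultimately show ?thesis using x unfolding unit_in_def by blast
  qed
  then show ?thesis unfolding ufd_in_def by (metis subring_of_pf_in prime_prod.unit)
qed

lemma pf_apply_sum: "pf_apply (sum f I) v = (\<Sum>i\<in>I. pf_apply (f i) v)"
  by (induction I rule: infinite_finite_induct) auto

lemma pf_apply_power: "pf_apply (a ^ n) v = pf_apply a v ^ n"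
  by (induction n) auto

lemma pf_apply_poly: "pf_apply (poly q (pf_var i)) v = (\<Sum>k\<le>degree q. pf_apply (coeff q k) v * (v $ i) ^ k)"
  by (simp add: poly_altdef pf_apply_sum pf_apply_power)

text \<open>A member of \<open>pf_in (insert i S)\<close> may be built from terms that involve
  further variables. Composition with \<open>restrict_vec\<close> gives a statement about every
  polynomial function, which the induction over their construction can prove.\<close>

lemma pf_in_insert_surj:
  assumes i: "i \<notin> S" and f: "real_polynomial_function f"
  shows "\<exists>q\<in>polys_over (pf_in S). \<forall>v. pf_apply (poly q (pf_var i)) v = f (restrict_vec (insert i S) v)"
proof -
  note P = subring_ofD[OF subring_polys_over[OF subring_of_pf_in[of S]]]
  show ?thesis using f
  proof induction
    case (linear f)
    define a where "a = Abs_pf (\<lambda>v. f (restrict_vec S v))"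
    define b where "b = Abs_pf (\<lambda>v::real^'a. f (axis i 1))"
    have a: "pf_apply a v = f (restrict_vec S v)" for v
      unfolding a_def using linear linear_restrict_vec[of S]
      by (intro pf_apply_Abs_pf rpf_linear)
        (simp add: bounded_linear_compose linear_conv_bounded_linear)
    have b: "pf_apply b v = f (axis i 1)" for v
      unfolding b_def by (intro pf_apply_Abs_pf rpf_const)
    have "restrict_vec S (restrict_vec S v) = restrict_vec S v" for v :: "real^'a" by (simp add: restrict_vec_def vec_eq_iff)
    then have "a \<in> pf_in S" "b \<in> pf_in S" by (auto simp: pf_in_def a b)
    then have "[:a, b:] \<in> polys_over (pf_in S)"
      using subring_ofD(1)[OF subring_of_pf_in] by (auto simp: polys_over_def coeff_pCons split: nat.splits)
    moreover have "pf_apply (poly [:a, b:] (pf_var i)) v = f (restrict_vec (insert i S) v)" for v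
    proof -
      have "restrict_vec (insert i S) v = restrict_vec S v + (v $ i) *\<^sub>R axis i 1"
        using i by (auto simp: restrict_vec_def vec_eq_iff axis_def)
      then show ?thesis using linear by (simp add: a b linear_simps bounded_linear.linear)
    qed
    ultimately show ?case by blast
  next
    case (const c)
    have c: "pf_apply (Abs_pf (\<lambda>v. c)) v = c" for v :: "real^'a"
      by (intro pf_apply_Abs_pf rpf_const)
    then have "Abs_pf (\<lambda>v. c) \<in> pf_in S" by (auto simp: pf_in_def)
    then have "[:Abs_pf (\<lambda>v. c):] \<in> polys_over (pf_in S)"
      using subring_ofD(1)[OF subring_of_pf_in] by (auto simp: polys_over_def coeff_pCons split: nat.splits)
    then show ?case using c by (intro bexI[of _ "[:Abs_pf (\<lambda>v. c):]"]) auto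
  next
    case (add f g)
    then obtain p q where "p \<in> polys_over (pf_in S)" "q \<in> polys_over (pf_in S)"
      "\<And>v. pf_apply (poly p (pf_var i)) v = f (restrict_vec (insert i S) v)"
      "\<And>v. pf_apply (poly q (pf_var i)) v = g (restrict_vec (insert i S) v)" by blast
    then show ?case using P by (intro bexI[of _ "p + q"]) auto
  next
    case (mult f g)
    then obtain p q where "p \<in> polys_over (pf_in S)" "q \<in> polys_over (pf_in S)"
      "\<And>v. pf_apply (poly p (pf_var i)) v = f (restrict_vec (insert i S) v)"
      "\<And>v. pf_apply (poly q (pf_var i)) v = g (restrict_vec (insert i S) v)" by blast
    then show ?case using P by (intro bexI[of _ "p * q"]) auto
  qed
qed

text \<open>With the other coordinates frozen, the values of the coefficients of \<open>q\<close> at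
  \<open>v\<close> are the coefficients of a univariate polynomial that has every real number as a
  zero.\<close>

lemma pf_in_insert_inj:
  assumes i: "i \<notin> S" and q: "q \<in> polys_over (pf_in S)" and 0: "poly q (pf_var i) = 0"
  shows "q = 0"
proof (rule poly_eqI)
  fix k
  have "pf_apply (coeff q k) v = 0" for v
  proof -
    define p where "p = (\<Sum>k\<le>degree q. monom (pf_apply (coeff q k) v) k)"
    have "poly p t = 0" for t
    proof -
      define w where "w = (\<chi> j. if j = i then t else v $ j)"
      have "restrict_vec S w = restrict_vec S v" using i by (auto simp: restrict_vec_def w_def vec_eq_iff)
      then have "pf_apply (coeff q k) w = pf_apply (coeff q k) v" for k
        using pf_inD[OF coeff_polys_over[OF q], of k v] pf_inD[OF coeff_polys_over[OF q], of k w] by simp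
      moreover have "w $ i = t" by (simp add: w_def)
      moreover have "(\<Sum>k\<le>degree q. pf_apply (coeff q k) w * (w $ i) ^ k) = 0"
        using pf_apply_poly[of q i w] 0 by simp
      ultimately show ?thesis by (simp add: p_def poly_sum poly_monom)
    qed
    then have "p = 0" using poly_all_0_iff_0 by blast
    moreover have "coeff p k = (if k \<le> degree q then pf_apply (coeff q k) v else 0)"
      by (simp add: p_def coeff_sum)
    ultimately show ?thesis by (cases "k \<le> degree q") (auto simp: coeff_eq_0)
  qed
  then show "coeff q k = coeff 0 k" by (auto intro: pf_eqI)
qed

text \<open>Substituting the new coordinate function for the indeterminate identifies the
  polynomials over \<open>pf_in S\<close> with \<open>pf_in (insert i S)\<close>.\<close>

lemma ufd_in_pf_in: "ufd_in (pf_in S)"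
proof (induction S rule: finite_induct[OF finite])
  case 1
  then show ?case by (rule ufd_in_pf_in_empty)
next
  case (2 i S)
  note P = subring_polys_over[OF subring_of_pf_in[of S]]
  have "bij_betw (\<lambda>q. poly q (pf_var i)) (polys_over (pf_in S)) (pf_in (insert i S))"
    unfolding bij_betw_def
  proof (intro conjI inj_onI equalityI subsetI)
    fix p q assume "p \<in> polys_over (pf_in S)" "q \<in> polys_over (pf_in S)" "poly p (pf_var i) = poly q (pf_var i)"
    then show "p = q" using pf_in_insert_inj[OF 2(2), of "p - q"] subring_ofD(6)[OF P] by simp
  next
    fix a assume "a \<in> (\<lambda>q. poly q (pf_var i)) ` polys_over (pf_in S)"
    then obtain q where q: "q \<in> polys_over (pf_in S)" "a = poly q (pf_var i)" by blast
    have "pf_apply (coeff q k) (restrict_vec (insert i S) v) = pf_apply (coeff q k) v" for k v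
    proof -
      have "restrict_vec S (restrict_vec (insert i S) v) = restrict_vec S v"
        by (simp add: restrict_vec_def vec_eq_iff)
      then show ?thesis using pf_inD[OF coeff_polys_over[OF q(1)], of k v]
          pf_inD[OF coeff_polys_over[OF q(1)], of k "restrict_vec (insert i S) v"] by simp
    qed
    moreover have "restrict_vec (insert i S) v $ i = v $ i" for v :: "real^'a" by (simp add: restrict_vec_def)
    ultimately show "a \<in> pf_in (insert i S)" unfolding pf_in_def q by (simp add: pf_apply_poly)
  next
    fix a assume "a \<in> pf_in (insert i S)"
    then have "pf_apply a (restrict_vec (insert i S) v) = pf_apply a v" for v by (simp add: pf_in_def)
    moreover obtain q where "q \<in> polys_over (pf_in S)"
      "\<And>v. pf_apply (poly q (pf_var i)) v = pf_apply a (restrict_vec (insert i S) v)"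
      using pf_in_insert_surj[OF 2(2) rpf_pf_apply[of a]] by blast
    ultimately have "a = poly q (pf_var i)" by (intro pf_eqI) simp
    then show "a \<in> (\<lambda>q. poly q (pf_var i)) ` polys_over (pf_in S)"
      using \<open>q \<in> _\<close> by blast
  qed
  then show ?case
    by (rule ufd_in_image[OF ufd_in_polys_over[OF 2(3)] subring_of_pf_in]) auto
qed

text \<open>Nonzero constants also satisfy this; where primality is claimed, a zero of
  \<open>f\<close> excludes them.\<close>

definition rpf_irreducible :: "(real^'n::finite \<Rightarrow> real) \<Rightarrow> bool" where
  "rpf_irreducible f \<longleftrightarrow> real_polynomial_function f \<and> (\<exists>v. f v \<noteq> 0) \<and>
     (\<forall>g h. real_polynomial_function g \<longrightarrow> real_polynomial_function h \<longrightarrow> (\<forall>v. f v = g v * h v) \<longrightarrow>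
        (\<exists>c. \<forall>v. g v = c) \<or> (\<exists>c. \<forall>v. h v = c))"

text \<open>Having a zero, \<open>f\<close> is not a unit and has a prime factor. The complementary
  factor is constant by irreducibility, so \<open>f\<close> is that prime up to a unit.\<close>

theorem rpf_irreducible_dvd_mult:
  fixes f :: "real^'n::finite \<Rightarrow> real"
  assumes f: "rpf_irreducible f" "f z = 0"
    and g: "real_polynomial_function g" "real_polynomial_function h" "real_polynomial_function k"
    and eq: "\<And>v. g v * h v = f v * k v"
  obtains e where "real_polynomial_function e" "\<And>v. g v = f v * e v"
    | e where "real_polynomial_function e" "\<And>v. h v = f v * e v"
proof -
  have inU: "a \<in> pf_in UNIV" for a :: "'n pf" by (simp add: pf_in_def restrict_vec_def)
  let ?D = "dvd_in (pf_in UNIV)"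
  define F where "F = Abs_pf f"
  have rf: "real_polynomial_function f" using f by (simp add: rpf_irreducible_def)
  have F: "pf_apply F v = f v" for v unfolding F_def by (rule pf_apply_Abs_pf[OF rf])
  have F0: "F \<noteq> 0" using f F unfolding rpf_irreducible_def by (metis pf_apply_simps(1))
  then obtain n where "prime_prod (pf_in UNIV) n F" using ufd_in_pf_in inU unfolding ufd_in_def by blast
  then have "\<exists>p x. F = p * x \<and> prime_in (pf_in UNIV) p"
  proof cases
    case unit
    then obtain v where "F * v = 1" by (auto simp: unit_in_def)
    then have "pf_apply (F * v) z = 1" by simp
    then show ?thesis using f by (simp add: F)
  qed blast
  then obtain p x where p: "F = p * x" "prime_in (pf_in UNIV) p" by blast
  have const: "unit_in (pf_in UNIV) a" if a: "pf_apply a = (\<lambda>v. c)" "a \<noteq> 0" for a :: "'n pf" and c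
  proof -
    have "c \<noteq> 0" using a pf_eqI[of a 0] by auto
    moreover have "pf_apply (Abs_pf (\<lambda>v. inverse c)) v = inverse c" for v :: "real^'n"
      by (intro pf_apply_Abs_pf rpf_const)
    ultimately have "a * Abs_pf (\<lambda>v. inverse c) = 1" by (intro pf_eqI) (simp add: a)
    then show ?thesis using inU unfolding unit_in_def by blast
  qed
  have px: "p \<noteq> 0" "x \<noteq> 0" using p F0 by auto
  have "f v = pf_apply p v * pf_apply x v" for v using F p by (metis pf_apply_simps(4))
  then have "(\<exists>c. \<forall>v. pf_apply p v = c) \<or> (\<exists>c. \<forall>v. pf_apply x v = c)"
    using f rpf_pf_apply unfolding rpf_irreducible_def by metis
  then have "unit_in (pf_in UNIV) x"
    using const px p(2) unfolding prime_in_def by (metis ext)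
  then obtain y where y: "x * y = 1" by (auto simp: unit_in_def)
  define G H K where "G = Abs_pf g" and "H = Abs_pf h" and "K = Abs_pf k"
  have GHK: "pf_apply G v = g v" "pf_apply H v = h v" "pf_apply K v = k v" for v
    unfolding G_def H_def K_def using g by (auto intro: pf_apply_Abs_pf)
  have "G * H = F * K" by (rule pf_eqI) (simp add: GHK F eq)
  then have "?D p (G * H)" using p inU unfolding dvd_in_def by (metis mult.assoc)
  then have "?D p G \<or> ?D p H" using p(2) inU unfolding prime_in_def by blast
  moreover have "\<exists>e. a = F * e" if "?D p a" for a
  proof -
    obtain e where "a = p * e" using \<open>?D p a\<close> by (auto simp: dvd_in_def)
    then have "a = F * (y * e)" using p y by (metis mult.assoc mult.left_commute mult.right_neutral)
    then show ?thesis by blast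
  qed
  ultimately consider e where "G = F * e" | e where "H = F * e" by blast
  then show thesis
  proof cases
    case 1
    then have "g v = f v * pf_apply e v" for v using GHK F by (metis pf_apply_simps(4))
    then show thesis using that rpf_pf_apply by blast
  next
    case 2
    then have "h v = f v * pf_apply e v" for v using GHK F by (metis pf_apply_simps(4))
    then show thesis using that rpf_pf_apply by blast
  qed
qed

section \<open>Forms as polynomial functions\<close>

definition monomial_eval :: "('n::finite \<Rightarrow>\<^sub>0 nat) \<Rightarrow> real^'n \<Rightarrow> real" where
  "monomial_eval k v = (\<Prod>i\<in>UNIV. (v $ i) ^ Poly_Mapping.lookup k i)"

definition poly_eval :: "(('n::finite \<Rightarrow>\<^sub>0 nat) \<Rightarrow>\<^sub>0 real) \<Rightarrow> real^'n \<Rightarrow> real" where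
  "poly_eval p v = (\<Sum>k\<in>Poly_Mapping.keys p. Poly_Mapping.lookup p k * monomial_eval k v)"

lemma monomial_eval_add: "monomial_eval (k + l) v = monomial_eval k v * monomial_eval l v"
  by (simp add: monomial_eval_def lookup_add power_add prod.distrib)

lemma monomial_eval_0 [simp]: "monomial_eval 0 v = 1"
  by (simp add: monomial_eval_def)

lemma monomial_eval_single [simp]: "monomial_eval (Poly_Mapping.single i (Suc 0)) v = v $ i"
proof -
  have "monomial_eval (Poly_Mapping.single i (Suc 0)) v = (\<Prod>j\<in>UNIV. if j = i then v $ i else 1)"
    unfolding monomial_eval_def by (rule prod.cong) (auto simp: lookup_single when_def)
  then show ?thesis by simp
qed

lemma poly_eval_single [simp]: "poly_eval (Poly_Mapping.single k c) v = c * monomial_eval k v"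
  by (simp add: poly_eval_def)

lemma poly_eval_add: "poly_eval (p + q) v = poly_eval p v + poly_eval q v"
  unfolding poly_eval_def
  by (rule setsum_keys_plus_distrib[where f = "\<lambda>k a. a * monomial_eval k v"]) (auto simp: algebra_simps)

lemma poly_eval_0 [simp]: "poly_eval 0 v = 0"
  by (simp add: poly_eval_def)

lemma poly_eval_sum: "poly_eval (sum f I) v = (\<Sum>i\<in>I. poly_eval (f i) v)"
  by (induction I rule: infinite_finite_induct) (auto simp: poly_eval_add)

lemma sum_single_keys:
  fixes p :: "'a \<Rightarrow>\<^sub>0 'b::comm_monoid_add"
  shows "(\<Sum>k\<in>Poly_Mapping.keys p. Poly_Mapping.single k (Poly_Mapping.lookup p k)) = p"
proof (rule poly_mapping_eqI)
  fix l
  have "Poly_Mapping.lookup (\<Sum>k\<in>Poly_Mapping.keys p. Poly_Mapping.single k (Poly_Mapping.lookup p k)) l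
      = (\<Sum>k\<in>Poly_Mapping.keys p. if k = l then Poly_Mapping.lookup p l else 0)"
    unfolding lookup_sum by (rule sum.cong) (auto simp: lookup_single when_def)
  also have "\<dots> = Poly_Mapping.lookup p l" by (auto simp: in_keys_iff)
  finally show "Poly_Mapping.lookup (\<Sum>k\<in>Poly_Mapping.keys p. Poly_Mapping.single k (Poly_Mapping.lookup p k)) l
      = Poly_Mapping.lookup p l" .
qed

lemma poly_eval_mult: "poly_eval (p * q) v = poly_eval p v * poly_eval q v"
proof -
  let ?s = "\<lambda>p k. Poly_Mapping.single k (Poly_Mapping.lookup p k)"
  have "p * q = (\<Sum>k\<in>Poly_Mapping.keys p. ?s p k) * (\<Sum>l\<in>Poly_Mapping.keys q. ?s q l)"
    by (simp only: sum_single_keys)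
  also have "\<dots> = (\<Sum>k\<in>Poly_Mapping.keys p. \<Sum>l\<in>Poly_Mapping.keys q. ?s p k * ?s q l)"
    by (rule sum_product)
  finally have "poly_eval (p * q) v =
      (\<Sum>k\<in>Poly_Mapping.keys p. \<Sum>l\<in>Poly_Mapping.keys q. poly_eval (?s p k * ?s q l) v)"
    by (simp only: poly_eval_sum)
  also have "\<dots> = (\<Sum>k\<in>Poly_Mapping.keys p. \<Sum>l\<in>Poly_Mapping.keys q.
      (Poly_Mapping.lookup p k * monomial_eval k v) * (Poly_Mapping.lookup q l * monomial_eval l v))"
    by (simp add: mult_single monomial_eval_add mult_ac)
  also have "\<dots> = poly_eval p v * poly_eval q v"
    unfolding poly_eval_def by (rule sum_product[symmetric])
  finally show ?thesis .
qed

text \<open>The exponents in \<open>K\<close> may differ only at the variables of \<open>S\<close>.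
  Each step reads the sum as a polynomial in the single variable \<open>i\<close> and keeps the
  terms of one degree in it.\<close>

lemma monomials_independent:
  fixes K :: "('n::finite \<Rightarrow>\<^sub>0 nat) set" and c :: "('n \<Rightarrow>\<^sub>0 nat) \<Rightarrow> real"
  assumes "finite S" "finite K"
    and "\<And>k l i. k \<in> K \<Longrightarrow> l \<in> K \<Longrightarrow> i \<notin> S \<Longrightarrow> Poly_Mapping.lookup k i = Poly_Mapping.lookup l i"
    and "\<And>v. (\<Sum>k\<in>K. c k * (\<Prod>i\<in>S. (v i) ^ Poly_Mapping.lookup k i)) = 0"
    and "k \<in> K"
  shows "c k = 0"
  using assms
proof (induction S arbitrary: K k rule: finite_induct)
  case empty
  have "l = k" if "l \<in> K" for l
    using empty.prems(2)[OF that empty.prems(4)] by (intro poly_mapping_eqI) simp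
  then have "K = {k}" using empty.prems(4) by blast
  then show ?case using empty.prems(3) by simp
next
  case (insert i S)
  define j where "j = Poly_Mapping.lookup k i"
  define K' where "K' = {k \<in> K. Poly_Mapping.lookup k i = j}"
  show ?case
  proof (rule insert.IH[of K'])
    show "finite K'" "k \<in> K'" using insert by (auto simp: K'_def j_def)
    show "Poly_Mapping.lookup k i' = Poly_Mapping.lookup l i'" if "k \<in> K'" "l \<in> K'" "i' \<notin> S" for k l i'
      using that insert.prems(2)[of k l i'] by (cases "i' = i") (auto simp: K'_def)
    fix v :: "'n \<Rightarrow> real"
    let ?P = "\<lambda>k. \<Prod>i\<in>S. (v i) ^ Poly_Mapping.lookup k i"
    define q where "q = (\<Sum>k\<in>K. monom (c k * ?P k) (Poly_Mapping.lookup k i))"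
    have "poly q t = 0" for t
    proof -
      have *: "(\<Prod>l\<in>S. (if l = i then t else v l) ^ Poly_Mapping.lookup k l) = ?P k" for k
        using insert.hyps by (intro prod.cong) auto
      show ?thesis using insert.prems(3)[of "v(i := t)"] insert.hyps
        by (simp add: * q_def poly_sum poly_monom mult_ac)
    qed
    then have "q = 0" using poly_all_0_iff_0 by blast
    then have "0 = coeff q j" by simp
    also have "\<dots> = (\<Sum>k\<in>K. if Poly_Mapping.lookup k i = j then c k * ?P k else 0)"
      unfolding q_def by (simp add: coeff_sum)
    also have "\<dots> = (\<Sum>k\<in>K'. c k * ?P k)"
      unfolding K'_def using insert.prems(1) by (intro sum.inter_filter[symmetric]) auto
    finally show "(\<Sum>k\<in>K'. c k * ?P k) = 0" by simp
  qed
qed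

text \<open>Together with surjectivity and multiplicativity this lets factorizations pass between
  the polynomial ring and the polynomial functions, which is how irreducibility is
  transported.\<close>

lemma poly_eval_inj:
  assumes "\<And>v. poly_eval p v = poly_eval q v"
  shows "p = q"
proof -
  define r where "r = p - q"
  have r: "poly_eval r v = 0" for v
  proof -
    have "poly_eval (r + q) v = poly_eval r v + poly_eval q v" by (rule poly_eval_add)
    then show ?thesis using assms[of v] by (simp add: r_def)
  qed
  have "Poly_Mapping.keys r = {}"
  proof (rule ccontr)
    assume "\<not> ?thesis"
    then obtain k where k: "k \<in> Poly_Mapping.keys r" by blast
    have "Poly_Mapping.lookup r k = 0"
    proof (rule monomials_independent[of UNIV "Poly_Mapping.keys r"])
      fix v :: "'a \<Rightarrow> real"
      show "(\<Sum>k\<in>Poly_Mapping.keys r. Poly_Mapping.lookup r k * (\<Prod>i\<in>UNIV. v i ^ Poly_Mapping.lookup k i)) = 0"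
        using r[of "\<chi> i. v i"] by (simp add: poly_eval_def monomial_eval_def)
    qed (use k in auto)
    then show False using k by (simp add: in_keys_iff)
  qed
  then have "r = 0" by simp
  then show ?thesis by (simp add: r_def)
qed

lemma poly_eval_surj:
  assumes "real_polynomial_function (f :: real^'n::finite \<Rightarrow> real)"
  shows "\<exists>p. \<forall>v. poly_eval p v = f v"
  using assms
proof induction
  case (linear f)
  have "poly_eval (\<Sum>i\<in>UNIV. Poly_Mapping.single (Poly_Mapping.single i 1) (f (axis i 1))) v = f v" for v
  proof -
    have "f v = f (\<Sum>i\<in>UNIV. (v $ i) *\<^sub>R axis i 1)" using basis_expansion[of v] by (simp add: scalar_mult_eq_scaleR)
    also have "\<dots> = (\<Sum>i\<in>UNIV. v $ i * f (axis i 1))"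
      using linear by (simp add: linear_sum linear_cmul bounded_linear.linear)
    finally show ?thesis by (simp add: poly_eval_sum mult.commute)
  qed
  then show ?case by blast
next
  case (const c)
  have "poly_eval (Poly_Mapping.single 0 c) v = c" for v :: "real^'n" by simp
  then show ?case by blast
qed (metis poly_eval_add, metis poly_eval_mult)

lemma finite_lists_length: "finite {is :: 'n::finite list. length is = m}"
  using finite_lists_length_eq[of "UNIV :: 'n set" m] by simp

lemma poly_eval_form_poly: "poly_eval (form_poly m c) v = form m c v"
proof -
  have "monomial_eval (sum_list (map (\<lambda>i. Poly_Mapping.single i 1) is)) v = prod_list (map (\<lambda>i. v $ i) is)" for "is" :: "'a list"
    by (induction "is") (simp_all add: monomial_eval_add)
  then show ?thesis by (simp add: form_poly_def form_def poly_eval_sum)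
qed

text \<open>On the line through 0 and \<open>v\<close> the two restrictions are univariate
  polynomials with product 1, hence of degree 0.\<close>

lemma rpf_unit_const:
  fixes f g :: "real^'n::finite \<Rightarrow> real"
  assumes "real_polynomial_function f" "real_polynomial_function g" "\<And>v. f v * g v = 1"
  shows "f v = f 0"
proof -
  obtain p q where p: "\<And>t. f (0 + t *\<^sub>R v) = poly p t" and q: "\<And>t. g (0 + t *\<^sub>R v) = poly q t"
    using rpf_line[OF assms(1)] rpf_line[OF assms(2)] by metis
  have "poly (p * q) t = poly 1 t" for t using assms(3) p q by (metis poly_mult poly_1)
  then have pq: "p * q = 1" by (metis poly_eqI_degree poly_eq_poly_eq_iff ext)
  then have "p \<noteq> 0" "q \<noteq> 0" by auto
  then have "degree p = 0" using pq degree_mult_eq[of p q] by simp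
  then obtain a where "p = [:a:]" using degree_eq_zeroE by blast
  then show ?thesis using p[of 0] p[of 1] by simp
qed

lemma rpf_coord: "real_polynomial_function (\<lambda>v::real^'n::finite. v $ i)"
  by (intro rpf_linear bounded_linear_vec_nth)

lemma rpf_prod_list: "real_polynomial_function (\<lambda>v::real^'n::finite. prod_list (map (\<lambda>i. v $ i) is))"
  by (induction "is") (auto intro: rpf_const rpf_mult rpf_coord)

lemma rpf_form: "real_polynomial_function (form m c)"
proof -
  have "real_polynomial_function (\<lambda>y. \<Sum>is | length is = m. c is * prod_list (map (\<lambda>i. y $ i) is))"
    by (intro real_polynomial_function_sum finite_lists_length rpf_mult rpf_const rpf_prod_list)
  then show ?thesis by (simp add: form_def[abs_def])
qed

theorem rpf_irreducible_form:
  assumes "irreducible (form_poly m c)"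
  shows "rpf_irreducible (form m c)"
  unfolding rpf_irreducible_def
proof (intro conjI allI impI)
  show "real_polynomial_function (form m c)" by (rule rpf_form)
  have "form_poly m c \<noteq> 0" using assms by (auto simp: irreducible_def)
  then show "\<exists>v. form m c v \<noteq> 0" using poly_eval_inj[of "form_poly m c" 0] by (auto simp: poly_eval_form_poly)
next
  fix g h assume gh: "real_polynomial_function g" "real_polynomial_function h" "\<forall>v. form m c v = g v * h v"
  obtain p q where p: "\<And>v. poly_eval p v = g v" and q: "\<And>v. poly_eval q v = h v"
    using gh poly_eval_surj by metis
  have "form_poly m c = p * q"
    by (rule poly_eval_inj) (simp add: poly_eval_form_poly poly_eval_mult p q gh)
  then have "p dvd 1 \<or> q dvd 1" using assms by (auto simp: irreducible_def)
  moreover have "\<exists>c. \<forall>v. poly_eval r v = c" if r: "r dvd 1" for r :: "('a \<Rightarrow>\<^sub>0 nat) \<Rightarrow>\<^sub>0 real"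
  proof -
    obtain s where s: "r * s = 1" using r by (metis dvdE)
    have rpf: "real_polynomial_function (poly_eval r)" for r :: "('a \<Rightarrow>\<^sub>0 nat) \<Rightarrow>\<^sub>0 real"
      unfolding poly_eval_def[abs_def] monomial_eval_def
      by (intro real_polynomial_function_sum real_polynomial_function_prod rpf_mult rpf_const
          real_polynomial_function_power rpf_coord) auto
    have "poly_eval r v * poly_eval s v = 1" for v
      using poly_eval_single[of 0 1 v] s by (simp flip: poly_eval_mult)
    then show ?thesis using rpf_unit_const[OF rpf rpf] by blast
  qed
  ultimately show "(\<exists>c. \<forall>v. g v = c) \<or> (\<exists>c. \<forall>v. h v = c)" using p q by metis
qed

section \<open>Forms: recursion, the case of one variable, linear substitution\<close>

lemma form_0: "form 0 c v = c []"
proof -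
  have "{is :: 'a list. length is = 0} = {[]}" by auto
  then show ?thesis by (simp add: form_def)
qed

lemma form_Suc: "form (Suc m) c v = (\<Sum>i\<in>UNIV. v $ i * form m (\<lambda>is. c (i # is)) v)"
proof -
  let ?h = "\<lambda>(i, is). i # is"
  have inj: "inj_on ?h (UNIV \<times> {is. length is = m})" by (auto simp: inj_on_def)
  have "{is :: 'a list. length is = Suc m} = ?h ` (UNIV \<times> {is. length is = m})"
    by (auto simp: image_def length_Suc_conv)
  then have "form (Suc m) c v = (\<Sum>p\<in>UNIV \<times> {is. length is = m}. c (?h p) * prod_list (map (\<lambda>i. v $ i) (?h p)))"
    unfolding form_def using sum.reindex[OF inj] by (simp add: o_def)
  also have "\<dots> = (\<Sum>i\<in>UNIV. \<Sum>is | length is = m. c (i # is) * (v $ i * prod_list (map (\<lambda>i. v $ i) is)))"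
    by (simp add: sum.cartesian_product case_prod_beta)
  finally show ?thesis by (simp add: form_def sum_distrib_left mult_ac)
qed

lemma form_scaleR: "form m c (t *\<^sub>R v) = t ^ m * form m c v"
  by (induction m arbitrary: c) (simp_all add: form_0 form_Suc sum_distrib_left mult_ac)

text \<open>In one variable a form of degree at least 2 has the variable as a proper factor. The
  bound later provides a unit vector orthogonal to \<open>p u\<close>.\<close>

lemma card_ge_2_if_irreducible_form:
  fixes c :: "'n::finite list \<Rightarrow> real"
  assumes irr: "rpf_irreducible (form m c)" and m: "m \<ge> 2"
  shows "CARD('n) \<ge> 2"
proof (rule ccontr)
  assume "\<not> CARD('n) \<ge> 2"
  then have "CARD('n) = 1" using zero_less_card_finite[where 'a='n] by linarith
  then obtain i :: 'n where i: "UNIV = {i}" using card_1_singletonE by blast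
  obtain k where k: "m = Suc k" "k > 0" using m by (cases m) auto
  have eq: "form m c v = v $ i * form k (\<lambda>is. c (i # is)) v" for v
    by (simp add: k form_Suc i)
  then have "(\<exists>a. \<forall>v::real^'n. v $ i = a) \<or> (\<exists>a. \<forall>v. form k (\<lambda>is. c (i # is)) v = a)"
    using irr rpf_coord[of i] rpf_form[of k "\<lambda>is. c (i # is)"] unfolding rpf_irreducible_def by meson
  then have zero: "form m c v = 0" for v
  proof
    assume "\<exists>a. \<forall>v::real^'n. v $ i = a"
    then obtain a where "\<And>v::real^'n. v $ i = a" by blast
    from this[of v] this[of 0] have "v $ i = 0" by simp
    then show ?thesis by (simp add: eq)
  next
    assume "\<exists>a. \<forall>v. form k (\<lambda>is. c (i # is)) v = a"
    then obtain a where a: "\<And>v. form k (\<lambda>is. c (i # is)) v = a" by blast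
    \<comment> \<open>A form of positive degree that is constant equals its value at the origin,
      which is 0.\<close>
    from a[of v] a[of "0 *\<^sub>R v"] have "form k (\<lambda>is. c (i # is)) v = 0"
      using k unfolding form_scaleR by (simp add: power_0_left)
    then show ?thesis by (simp add: eq)
  qed
  then show False using irr by (simp add: rpf_irreducible_def)
qed

lemma rpf_compose_linear:
  fixes f :: "real^'n::finite \<Rightarrow> real" and L :: "real^'m::finite \<Rightarrow> real^'n"
  assumes "real_polynomial_function f" "linear L"
  shows "real_polynomial_function (\<lambda>v. f (L v))"
  using assms(1)
proof induction
  case (linear f)
  then show ?case using assms(2)
    by (intro rpf_linear) (simp add: bounded_linear_compose linear_conv_bounded_linear)
qed (auto intro: rpf_const rpf_add rpf_mult)

lemma rpf_irreducible_compose_linear: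
  assumes f: "rpf_irreducible f" and L: "linear L" "linear L'" "\<And>v. L (L' v) = v" "\<And>v. L' (L v) = v"
  shows "rpf_irreducible (\<lambda>v. f (L v))"
  unfolding rpf_irreducible_def
proof (intro conjI allI impI)
  show "real_polynomial_function (\<lambda>v. f (L v))"
    using f L rpf_compose_linear by (auto simp: rpf_irreducible_def)
  show "\<exists>v. f (L v) \<noteq> 0" using f L unfolding rpf_irreducible_def by metis
  fix g h assume gh: "real_polynomial_function g" "real_polynomial_function h" "\<forall>v. f (L v) = g v * h v"
  have "f v = g (L' v) * h (L' v)" for v using gh(3) L(3) by metis
  then have "(\<exists>c. \<forall>v. g (L' v) = c) \<or> (\<exists>c. \<forall>v. h (L' v) = c)"
    using f rpf_compose_linear[OF gh(1) L(2)] rpf_compose_linear[OF gh(2) L(2)]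
    unfolding rpf_irreducible_def by blast
  then show "(\<exists>c. \<forall>v. g v = c) \<or> (\<exists>c. \<forall>v. h v = c)" using L(4) by metis
qed

text \<open>The transformation law of a covariant tensor,
  \<open>M j1 i1 ... M jm im c [j1, ..., jm]\<close> summed over the \<open>j\<close>, with the
  indices contracted one after another.\<close>

fun pullback_coeff :: "('n::finite \<Rightarrow> 'n \<Rightarrow> real) \<Rightarrow> ('n list \<Rightarrow> real) \<Rightarrow> 'n list \<Rightarrow> real" where
  "pullback_coeff M c [] = c []"
| "pullback_coeff M c (i # is) = (\<Sum>j\<in>UNIV. M j i * pullback_coeff M (\<lambda>js. c (j # js)) is)"

lemma form_pullback:
  assumes "\<And>j. w $ j = (\<Sum>i\<in>UNIV. M j i * v $ i)"
  shows "form m c w = form m (pullback_coeff M c) v"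
proof (induction m arbitrary: c)
  case 0
  then show ?case by (simp add: form_0)
next
  case (Suc m)
  have lin: "form m (\<lambda>is. \<Sum>j\<in>UNIV. M j i * pullback_coeff M (\<lambda>js. c (j # js)) is) v
      = (\<Sum>j\<in>UNIV. M j i * form m (pullback_coeff M (\<lambda>js. c (j # js))) v)" for i
    unfolding form_def by (simp add: sum_distrib_left sum_distrib_right sum.swap[of _ UNIV] mult.assoc)
  have "form (Suc m) c w = (\<Sum>j\<in>UNIV. \<Sum>i\<in>UNIV. v $ i * (M j i * form m (pullback_coeff M (\<lambda>js. c (j # js))) v))"
    by (simp add: form_Suc assms Suc sum_distrib_left sum_distrib_right mult_ac)
  also have "\<dots> = (\<Sum>i\<in>UNIV. \<Sum>j\<in>UNIV. v $ i * (M j i * form m (pullback_coeff M (\<lambda>js. c (j # js))) v))"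
    by (rule sum.swap)
  also have "\<dots> = form (Suc m) (pullback_coeff M c) v"
    by (simp add: form_Suc lin sum_distrib_left)
  finally show ?case .
qed

section \<open>Calculus of smooth maps\<close>

lemma Ck_on_cong:
  assumes "open S" "\<And>x. x \<in> S \<Longrightarrow> f x = g x" "Ck_on k S f"
  shows "Ck_on k S g"
  using assms(2,3)
proof (induction k arbitrary: f g)
  case 0
  then show ?case by (simp cong: continuous_on_cong)
next
  case (Suc k)
  have d: "(g has_derivative frechet_derivative f (at x)) (at x)" if "x \<in> S" for x
  proof (rule has_derivative_transform_within_open[OF _ \<open>open S\<close> that])
    show "(f has_derivative frechet_derivative f (at x)) (at x)"
      using Suc.prems(2) that by (simp add: frechet_derivative_works[symmetric])
  qed (use Suc.prems in auto)
  have "Ck_on k S (\<lambda>x. frechet_derivative g (at x) v)" for v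
  proof (rule Suc.IH)
    show "Ck_on k S (\<lambda>x. frechet_derivative f (at x) v)" using Suc.prems(2) by simp
    show "frechet_derivative f (at x) v = frechet_derivative g (at x) v" if "x \<in> S" for x
      using frechet_derivative_at[OF d[OF that]] by simp
  qed
  then show ?case using d by (auto simp: differentiable_def)
qed

lemma Ck_on_SucI:
  assumes "open S" "\<And>x. x \<in> S \<Longrightarrow> (f has_derivative f' x) (at x)" "\<And>v. Ck_on k S (\<lambda>x. f' x v)"
  shows "Ck_on (Suc k) S f"
proof -
  have "f' x v = frechet_derivative f (at x) v" if "x \<in> S" for x v
    using frechet_derivative_at[OF assms(2)[OF that]] by simp
  then have "Ck_on k S (\<lambda>x. frechet_derivative f (at x) v)" for v
    using Ck_on_cong[OF assms(1) _ assms(3)[of v], of "\<lambda>x. frechet_derivative f (at x) v"] by simp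
  then show ?thesis using assms(2) by (auto simp: differentiable_def)
qed

lemma Ck_on_SucD:
  assumes "Ck_on (Suc k) S f"
  shows "x \<in> S \<Longrightarrow> (f has_derivative frechet_derivative f (at x)) (at x)"
    "Ck_on k S (\<lambda>x. frechet_derivative f (at x) v)"
  using assms by (auto simp: frechet_derivative_works[symmetric])

lemma Ck_on_lower: "Ck_on (Suc k) S f \<Longrightarrow> Ck_on k S f"
proof (induction k arbitrary: f)
  case 0
  then have "f differentiable at x" if "x \<in> S" for x using that by simp
  then show ?case
    by (auto simp: continuous_on_eq_continuous_within
        intro: differentiable_imp_continuous_within differentiable_at_withinI)
next
  case (Suc k)
  show ?case unfolding Ck_on.simps(2)[of k] using Suc.prems Suc.IH by (metis Ck_on.simps(2))
qed

lemma Ck_on_const: "open S \<Longrightarrow> Ck_on k S (\<lambda>_. c)"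
proof (induction k arbitrary: c)
  case (Suc k)
  then show ?case by (intro Ck_on_SucI[where f' = "\<lambda>_ _. 0"]) auto
qed auto

lemma Ck_on_bounded_linear: "open S \<Longrightarrow> bounded_linear L \<Longrightarrow> Ck_on k S L"
proof (cases k)
  case (Suc j)
  assume "open S" "bounded_linear L"
  then show ?thesis unfolding Suc
    by (intro Ck_on_SucI[where f' = "\<lambda>_. L"] Ck_on_const bounded_linear_imp_has_derivative) auto
qed (auto intro: linear_continuous_on)

lemma Ck_on_bounded_linear_comp:
  "open S \<Longrightarrow> bounded_linear L \<Longrightarrow> Ck_on k S f \<Longrightarrow> Ck_on k S (\<lambda>x. L (f x))"
proof (induction k arbitrary: f)
  case 0
  then show ?case by (auto intro: bounded_linear.continuous_on)
next
  case (Suc k)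
  note d = Ck_on_SucD[OF Suc.prems(3)]
  show ?case
    by (rule Ck_on_SucI[OF Suc.prems(1), where f' = "\<lambda>x v. L (frechet_derivative f (at x) v)"])
      (use d Suc in \<open>auto intro: bounded_linear.has_derivative\<close>)
qed

lemma Ck_on_add: "open S \<Longrightarrow> Ck_on k S f \<Longrightarrow> Ck_on k S g \<Longrightarrow> Ck_on k S (\<lambda>x. f x + g x)"
proof (induction k arbitrary: f g)
  case 0
  then show ?case by (auto intro: continuous_on_add)
next
  case (Suc k)
  note d = Ck_on_SucD[OF Suc.prems(2)] Ck_on_SucD[OF Suc.prems(3)]
  show ?case
    by (rule Ck_on_SucI[OF Suc.prems(1), where
          f' = "\<lambda>x v. frechet_derivative f (at x) v + frechet_derivative g (at x) v"])
      (use d Suc.IH[OF Suc.prems(1)] in \<open>auto intro: has_derivative_add\<close>)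
qed

lemma Ck_on_scaleR:
  fixes f :: "'a::real_normed_vector \<Rightarrow> real"
  shows "open S \<Longrightarrow> Ck_on k S f \<Longrightarrow> Ck_on k S g \<Longrightarrow> Ck_on k S (\<lambda>x. f x *\<^sub>R g x)"
proof (induction k arbitrary: f g)
  case 0
  then show ?case by (auto intro: continuous_on_scaleR)
next
  case (Suc k)
  note d = Ck_on_SucD[OF Suc.prems(2)] Ck_on_SucD[OF Suc.prems(3)]
  show ?case
    by (rule Ck_on_SucI[OF Suc.prems(1), where
          f' = "\<lambda>x v. f x *\<^sub>R frechet_derivative g (at x) v + frechet_derivative f (at x) v *\<^sub>R g x"])
      (use d Suc.IH[OF Suc.prems(1)] Ck_on_lower[OF Suc.prems(2)] Ck_on_lower[OF Suc.prems(3)] Suc.prems(1)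
        in \<open>auto intro!: has_derivative_scaleR Ck_on_add\<close>)
qed

lemma Ck_on_sum: "open S \<Longrightarrow> (\<And>i. i \<in> I \<Longrightarrow> Ck_on k S (f i)) \<Longrightarrow> Ck_on k S (\<lambda>x. \<Sum>i\<in>I. f i x)"
  by (induction I rule: infinite_finite_induct) (auto intro: Ck_on_const Ck_on_add)

lemma linear_axis_sum:
  fixes L :: "real^'n::finite \<Rightarrow> 'b::real_vector"
  assumes "linear L"
  shows "L v = (\<Sum>i\<in>UNIV. v $ i *\<^sub>R L (axis i 1))"
proof -
  have "L v = L (\<Sum>i\<in>UNIV. v $ i *\<^sub>R axis i 1)"
    using basis_expansion[of v] by (simp add: scalar_mult_eq_scaleR)
  then show ?thesis using assms by (simp add: linear_sum linear_cmul)
qed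

text \<open>The derivative of the composition is expanded along the axes of the intermediate space
  \<open>real^'n\<close>; it becomes a sum of products to which the induction hypothesis
  applies.\<close>

lemma Ck_on_compose:
  fixes f :: "'a::real_normed_vector \<Rightarrow> real^'n::finite"
  shows "open S \<Longrightarrow> f ` S \<subseteq> T \<Longrightarrow> Ck_on k S f \<Longrightarrow> Ck_on k T g \<Longrightarrow> Ck_on k S (\<lambda>x. g (f x))"
proof (induction k arbitrary: g)
  case 0
  then show ?case by (auto intro: continuous_on_compose2)
next
  case (Suc k)
  note d = Ck_on_SucD[OF Suc.prems(3)] Ck_on_SucD[OF Suc.prems(4)]
  let ?f' = "\<lambda>x v. \<Sum>i\<in>UNIV. (frechet_derivative f (at x) v $ i) *\<^sub>R frechet_derivative g (at (f x)) (axis i 1)"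
  show ?case
  proof (rule Ck_on_SucI[OF Suc.prems(1), where f' = ?f'])
    fix x assume x: "x \<in> S"
    then have fx: "f x \<in> T" using Suc.prems by auto
    have "((\<lambda>x. g (f x)) has_derivative (\<lambda>v. frechet_derivative g (at (f x)) (frechet_derivative f (at x) v))) (at x)"
      by (rule has_derivative_compose[OF d(1)[OF x] d(3)[OF fx]])
    moreover have "frechet_derivative g (at (f x)) (frechet_derivative f (at x) v) = ?f' x v" for v
      by (rule linear_axis_sum) (rule has_derivative_linear[OF d(3)[OF fx]])
    ultimately show "((\<lambda>x. g (f x)) has_derivative ?f' x) (at x)" by simp
  next
    fix v
    show "Ck_on k S (\<lambda>x. ?f' x v)"
      by (intro Ck_on_sum Ck_on_scaleR Suc.prems(1)
          Ck_on_bounded_linear_comp[OF Suc.prems(1) bounded_linear_vec_nth] d(2)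
          Suc.IH[OF Suc.prems(1,2) Ck_on_lower[OF Suc.prems(3)]] d(4))
  qed
qed

text \<open>The derivative is again built from the reciprocal of \<open>f\<close>, which is known to
  be differentiable to one order less.\<close>

lemma Ck_on_inverse:
  fixes f :: "'a::real_normed_vector \<Rightarrow> real"
  shows "open S \<Longrightarrow> (\<And>x. x \<in> S \<Longrightarrow> f x \<noteq> 0) \<Longrightarrow> Ck_on k S f \<Longrightarrow> Ck_on k S (\<lambda>x. inverse (f x))"
proof (induction k)
  case 0
  then show ?case by (auto intro: continuous_on_inverse)
next
  case (Suc k)
  note d = Ck_on_SucD[OF Suc.prems(3)]
  have IH: "Ck_on k S (\<lambda>x. inverse (f x))"
    using Suc.IH Suc.prems Ck_on_lower[OF Suc.prems(3)] by blast
  show ?case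
  proof (rule Ck_on_SucI[OF Suc.prems(1), where
        f' = "\<lambda>x v. (inverse (f x) *\<^sub>R inverse (f x)) *\<^sub>R (- frechet_derivative f (at x) v)"])
    fix x assume x: "x \<in> S"
    show "((\<lambda>x. inverse (f x)) has_derivative
        (\<lambda>v. (inverse (f x) *\<^sub>R inverse (f x)) *\<^sub>R (- frechet_derivative f (at x) v))) (at x)"
      using Deriv.has_derivative_inverse[OF Suc.prems(2)[OF x] d(1)[OF x]] by (simp add: mult_ac)
  next
    fix v
    show "Ck_on k S (\<lambda>x. (inverse (f x) *\<^sub>R inverse (f x)) *\<^sub>R (- frechet_derivative f (at x) v))"
      by (intro Ck_on_scaleR Suc.prems(1) IH
          Ck_on_bounded_linear_comp[OF Suc.prems(1) bounded_linear_minus[OF bounded_linear_ident]] d(2))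
  qed
qed

lemma smooth_on_cong: "open S \<Longrightarrow> (\<And>x. x \<in> S \<Longrightarrow> f x = g x) \<Longrightarrow> smooth_on S f \<Longrightarrow> smooth_on S g"
  using Ck_on_cong unfolding smooth_on_def by metis

lemma smooth_on_const: "open S \<Longrightarrow> smooth_on S (\<lambda>_. c)"
  by (simp add: smooth_on_def Ck_on_const)

lemma smooth_on_bounded_linear: "open S \<Longrightarrow> bounded_linear L \<Longrightarrow> smooth_on S L"
  by (simp add: smooth_on_def Ck_on_bounded_linear)

lemma smooth_on_bounded_linear_comp:
  "open S \<Longrightarrow> bounded_linear L \<Longrightarrow> smooth_on S f \<Longrightarrow> smooth_on S (\<lambda>x. L (f x))"
  by (simp add: smooth_on_def Ck_on_bounded_linear_comp)

lemma smooth_on_add: "open S \<Longrightarrow> smooth_on S f \<Longrightarrow> smooth_on S g \<Longrightarrow> smooth_on S (\<lambda>x. f x + g x)"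
  by (simp add: smooth_on_def Ck_on_add)

lemma smooth_on_scaleR:
  fixes f :: "'a::real_normed_vector \<Rightarrow> real"
  shows "open S \<Longrightarrow> smooth_on S f \<Longrightarrow> smooth_on S g \<Longrightarrow> smooth_on S (\<lambda>x. f x *\<^sub>R g x)"
  by (simp add: smooth_on_def Ck_on_scaleR)

lemma smooth_on_mult:
  fixes f :: "'a::real_normed_vector \<Rightarrow> real"
  shows "open S \<Longrightarrow> smooth_on S f \<Longrightarrow> smooth_on S g \<Longrightarrow> smooth_on S (\<lambda>x. f x * g x)"
  using smooth_on_scaleR[of S f g] by simp

lemma smooth_on_sum: "open S \<Longrightarrow> (\<And>i. i \<in> I \<Longrightarrow> smooth_on S (f i)) \<Longrightarrow> smooth_on S (\<lambda>x. \<Sum>i\<in>I. f i x)"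
  by (simp add: smooth_on_def Ck_on_sum)

lemma smooth_on_compose:
  fixes f :: "'a::real_normed_vector \<Rightarrow> real^'n::finite"
  shows "open S \<Longrightarrow> f ` S \<subseteq> T \<Longrightarrow> smooth_on S f \<Longrightarrow> smooth_on T g \<Longrightarrow> smooth_on S (\<lambda>x. g (f x))"
  by (simp add: smooth_on_def Ck_on_compose)

lemma smooth_on_inverse:
  fixes f :: "'a::real_normed_vector \<Rightarrow> real"
  shows "open S \<Longrightarrow> (\<And>x. x \<in> S \<Longrightarrow> f x \<noteq> 0) \<Longrightarrow> smooth_on S f \<Longrightarrow> smooth_on S (\<lambda>x. inverse (f x))"
  by (simp add: smooth_on_def Ck_on_inverse)

lemma smooth_on_has_derivative:
  assumes "smooth_on S f" "x \<in> S"
  shows "(f has_derivative frechet_derivative f (at x)) (at x)"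
  using assms Ck_on_SucD(1)[of 0 S f x] unfolding smooth_on_def by blast

lemma smooth_on_frechet_derivative:
  "smooth_on S f \<Longrightarrow> smooth_on S (\<lambda>x. frechet_derivative f (at x) v)"
  unfolding smooth_on_def using Ck_on_SucD(2) by blast

lemma smooth_on_continuous_on: "smooth_on S f \<Longrightarrow> continuous_on S f"
  unfolding smooth_on_def by (metis Ck_on.simps(1))

lemma smooth_on_subset:
  assumes "smooth_on S f" "T \<subseteq> S"
  shows "smooth_on T f"
proof -
  have "Ck_on k T f" if "Ck_on k S f" for k
    using that
  proof (induction k arbitrary: f)
    case 0
    then show ?case using assms(2) by (auto intro: continuous_on_subset)
  next
    case (Suc k)
    then show ?case using assms(2) by (auto simp: subset_iff)
  qed
  then show ?thesis using assms(1) by (auto simp: smooth_on_def)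
qed

section \<open>Partial derivatives and their symmetry\<close>

lemma smooth_on_partial: "smooth_on S f \<Longrightarrow> smooth_on S (partial i f)"
  using smooth_on_frechet_derivative[of S f "axis i 1"] by (simp add: partial_def[abs_def])

lemma partial_eq: "(f has_derivative f') (at p) \<Longrightarrow> partial i f p = f' (axis i 1)"
  unfolding partial_def using frechet_derivative_at by metis

lemma has_derivative_partial:
  assumes "(f has_derivative f') (at p)"
  shows "(f has_derivative (\<lambda>h. \<Sum>i\<in>UNIV. h $ i * partial i f p)) (at p)"
proof -
  have "f' h = (\<Sum>i\<in>UNIV. h $ i * partial i f p)" for h
    using linear_axis_sum[OF has_derivative_linear[OF assms], of h] by (simp add: partial_eq[OF assms])
  then have "f' = (\<lambda>h. \<Sum>i\<in>UNIV. h $ i * partial i f p)" by (rule ext)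
  then show ?thesis using assms by simp
qed

lemma smooth_on_has_derivative_partial:
  "smooth_on S f \<Longrightarrow> x \<in> S \<Longrightarrow> (f has_derivative (\<lambda>h. \<Sum>i\<in>UNIV. h $ i * partial i f x)) (at x)"
  using smooth_on_has_derivative has_derivative_partial by blast

lemma has_derivative_along_line:
  assumes "(f has_derivative f') (at (x + t *\<^sub>R h))"
  shows "((\<lambda>t. f (x + t *\<^sub>R h)) has_derivative (\<lambda>s. f' (s *\<^sub>R h))) (at t)"
proof -
  have "((\<lambda>t. x + t *\<^sub>R h) has_derivative (\<lambda>s. s *\<^sub>R h)) (at t)"
    by (auto intro!: derivative_eq_intros)
  from has_derivative_compose[OF this assms] show ?thesis .
qed

lemma has_real_derivative_along_line:
  assumes "(f has_derivative f') (at (x + t *\<^sub>R h))"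
  shows "((\<lambda>t. f (x + t *\<^sub>R h)) has_real_derivative f' h) (at t)"
proof -
  have "(\<lambda>s. f' (s *\<^sub>R h)) = (*) (f' h)"
    using linear_cmul[OF has_derivative_linear[OF assms]] by (auto simp: mult.commute)
  then show ?thesis using has_derivative_along_line[OF assms] by (simp add: has_field_derivative_def)
qed

text \<open>The mean value theorem is applied to the increment of \<open>f\<close> in direction
  \<open>b\<close>, regarded as a function along \<open>a\<close>, and then to the
  \<open>a\<close>-derivative along \<open>b\<close>.\<close>

lemma second_difference_mvt:
  fixes f :: "'a::real_normed_vector \<Rightarrow> real"
  assumes S: "\<And>s t. 0 \<le> s \<Longrightarrow> s \<le> h \<Longrightarrow> 0 \<le> t \<Longrightarrow> t \<le> h \<Longrightarrow> x + s *\<^sub>R a + t *\<^sub>R b \<in> S"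
    and f: "\<And>y. y \<in> S \<Longrightarrow> (f has_derivative f' y) (at y)"
    and fa: "\<And>y. y \<in> S \<Longrightarrow> ((\<lambda>y. f' y a) has_derivative A y) (at y)"
    and h: "0 < h"
  shows "\<exists>s t. 0 < s \<and> s < h \<and> 0 < t \<and> t < h \<and>
    f (x + h *\<^sub>R a + h *\<^sub>R b) - f (x + h *\<^sub>R a) - f (x + h *\<^sub>R b) + f x = h * (h * A (x + s *\<^sub>R a + t *\<^sub>R b) b)"
proof -
  let ?F = "\<lambda>s. f ((x + h *\<^sub>R b) + s *\<^sub>R a) - f (x + s *\<^sub>R a)"
  have "\<exists>s>0. s < h \<and> ?F h - ?F 0 = (h - 0) * (f' ((x + h *\<^sub>R b) + s *\<^sub>R a) a - f' (x + s *\<^sub>R a) a)"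
  proof (rule MVT2[OF h])
    fix s :: real assume s: "0 \<le> s" "s \<le> h"
    have "(x + h *\<^sub>R b) + s *\<^sub>R a \<in> S" "x + s *\<^sub>R a \<in> S"
      using S[OF s, of h] S[OF s, of 0] h by (auto simp: ac_simps)
    then show "(?F has_real_derivative f' ((x + h *\<^sub>R b) + s *\<^sub>R a) a - f' (x + s *\<^sub>R a) a) (at s)"
      by (intro DERIV_diff has_real_derivative_along_line f)
  qed
  then obtain s where s: "0 < s" "s < h"
    "?F h - ?F 0 = h * (f' ((x + h *\<^sub>R b) + s *\<^sub>R a) a - f' (x + s *\<^sub>R a) a)" by auto
  let ?G = "\<lambda>t. f' ((x + s *\<^sub>R a) + t *\<^sub>R b) a"
  have "\<exists>t>0. t < h \<and> ?G h - ?G 0 = (h - 0) * A ((x + s *\<^sub>R a) + t *\<^sub>R b) b"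
  proof (rule MVT2[OF h])
    fix t :: real assume t: "0 \<le> t" "t \<le> h"
    have "(x + s *\<^sub>R a) + t *\<^sub>R b \<in> S" using S[OF _ _ t, of s] s by auto
    then show "(?G has_real_derivative A ((x + s *\<^sub>R a) + t *\<^sub>R b) b) (at t)"
      using has_real_derivative_along_line[OF fa] by blast
  qed
  then obtain t where t: "0 < t" "t < h" "?G h - ?G 0 = h * A ((x + s *\<^sub>R a) + t *\<^sub>R b) b" by auto
  have "?F h - ?F 0 = h * (?G h - ?G 0)" using s(3) by (simp add: ac_simps)
  then have "f (x + h *\<^sub>R a + h *\<^sub>R b) - f (x + h *\<^sub>R a) - f (x + h *\<^sub>R b) + f x = h * (h * A (x + s *\<^sub>R a + t *\<^sub>R b) b)"
    unfolding t(3) by (simp add: ac_simps)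
  then show ?thesis using s t by blast
qed

text \<open>The second difference is symmetric in \<open>a\<close> and \<open>b\<close>, and divided
  by the square of \<open>h\<close> it equals either mixed derivative at some nearby point.
  Continuity brings these points to \<open>x\<close>.\<close>

lemma symmetric_second_derivative:
  fixes f :: "'a::real_normed_vector \<Rightarrow> real"
  assumes S: "open S" "x \<in> S"
    and f: "\<And>y. y \<in> S \<Longrightarrow> (f has_derivative f' y) (at y)"
    and fa: "\<And>y. y \<in> S \<Longrightarrow> ((\<lambda>y. f' y a) has_derivative A y) (at y)"
    and fb: "\<And>y. y \<in> S \<Longrightarrow> ((\<lambda>y. f' y b) has_derivative B y) (at y)"
    and cont: "continuous_on S (\<lambda>y. A y b)" "continuous_on S (\<lambda>y. B y a)"
  shows "A x b = B x a"
proof (rule ccontr)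
  assume "A x b \<noteq> B x a"
  \<comment> \<open>Half the gap, so that two errors below \<open>e\<close> contradict it.\<close>
  define e where "e = \<bar>A x b - B x a\<bar> / 2"
  have e: "e > 0" using \<open>A x b \<noteq> B x a\<close> by (simp add: e_def)
  have "isCont (\<lambda>y. A y b) x" "isCont (\<lambda>y. B y a) x"
    using cont S by (auto simp: continuous_on_eq_continuous_at)
  then obtain d1 d2 where d1: "d1 > 0" "\<And>y. dist y x < d1 \<Longrightarrow> dist (A y b) (A x b) < e"
    and d2: "d2 > 0" "\<And>y. dist y x < d2 \<Longrightarrow> dist (B y a) (B x a) < e"
    using e unfolding continuous_at_eps_delta by metis
  obtain r where r: "r > 0" "ball x r \<subseteq> S" using S open_contains_ball by blast
  define d where "d = min r (min d1 d2)"
  have d: "d > 0" "d \<le> r" "d \<le> d1" "d \<le> d2" using r d1 d2 by (auto simp: d_def)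
  \<comment> \<open>Small enough that the whole parallelogram with sides along \<open>a\<close> and
    \<open>b\<close> stays within \<open>d\<close> of \<open>x\<close>; the added 1 keeps the
    denominator positive.\<close>
  define h where "h = d / (2 * (norm a + norm b + 1))"
  have nn: "norm a + norm b + 1 > 0" by (smt (verit) norm_ge_zero)
  have h: "h > 0" using d nn by (simp add: h_def)
  have near: "dist (x + s *\<^sub>R a + t *\<^sub>R b) x < d" if st: "0 \<le> s" "s \<le> h" "0 \<le> t" "t \<le> h" for s t
  proof -
    have "dist (x + s *\<^sub>R a + t *\<^sub>R b) x = norm (s *\<^sub>R a + t *\<^sub>R b)" by (simp add: dist_norm)
    also have "\<dots> \<le> norm (s *\<^sub>R a) + norm (t *\<^sub>R b)" by (rule norm_triangle_ineq)
    also have "\<dots> \<le> h * norm a + h * norm b" using st by (auto intro!: add_mono mult_right_mono)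
    also have "\<dots> \<le> h * (norm a + norm b + 1)" using h by (simp add: algebra_simps)
    also have "\<dots> = d / 2" using nn unfolding h_def by (subst mult_2) (simp add: divide_simps)
    also have "\<dots> < d" using d by simp
    finally show ?thesis .
  qed
  have inS: "x + s *\<^sub>R a + t *\<^sub>R b \<in> S" if "0 \<le> s" "s \<le> h" "0 \<le> t" "t \<le> h" for s t
    using near[OF that] r(2) d(2) by (auto simp: dist_commute)
  obtain s t where st: "0 < s" "s < h" "0 < t" "t < h"
    "f (x + h *\<^sub>R a + h *\<^sub>R b) - f (x + h *\<^sub>R a) - f (x + h *\<^sub>R b) + f x = h * (h * A (x + s *\<^sub>R a + t *\<^sub>R b) b)"
    using second_difference_mvt[OF inS f fa h] by blast
  have inS': "x + s *\<^sub>R b + t *\<^sub>R a \<in> S" if "0 \<le> s" "s \<le> h" "0 \<le> t" "t \<le> h" for s t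
    using inS[OF that(3,4,1,2)] by (simp add: ac_simps)
  obtain s' t' where st': "0 < s'" "s' < h" "0 < t'" "t' < h"
    "f (x + h *\<^sub>R b + h *\<^sub>R a) - f (x + h *\<^sub>R b) - f (x + h *\<^sub>R a) + f x = h * (h * B (x + s' *\<^sub>R b + t' *\<^sub>R a) a)"
    using second_difference_mvt[OF inS' f fb h] by blast
  have "A (x + s *\<^sub>R a + t *\<^sub>R b) b = B (x + s' *\<^sub>R b + t' *\<^sub>R a) a"
  proof -
    have "f (x + h *\<^sub>R b + h *\<^sub>R a) = f (x + h *\<^sub>R a + h *\<^sub>R b)" by (simp add: ac_simps)
    then have "h * (h * A (x + s *\<^sub>R a + t *\<^sub>R b) b) = h * (h * B (x + s' *\<^sub>R b + t' *\<^sub>R a) a)"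
      using st(5) st'(5) by linarith
    then show ?thesis using h by simp
  qed
  moreover have "dist (A (x + s *\<^sub>R a + t *\<^sub>R b) b) (A x b) < e"
    using near[of s t] st d by (intro d1) auto
  moreover have "dist (B (x + s' *\<^sub>R b + t' *\<^sub>R a) a) (B x a) < e"
    using near[of t' s'] st' d by (intro d2) (auto simp: ac_simps)
  ultimately have "dist (A x b) (B x a) < e + e"
    using dist_triangle3[of "A x b" "B x a" "A (x + s *\<^sub>R a + t *\<^sub>R b) b"] by simp
  then show False by (simp add: e_def dist_real_def)
qed

lemma partial_commute:
  fixes f :: "real^'n::finite \<Rightarrow> real"
  assumes "open S" "x \<in> S" "smooth_on S f"
  shows "partial i (partial j f) x = partial j (partial i f) x"
proof -
  let ?f' = "\<lambda>y. frechet_derivative f (at y)"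
  have d: "((\<lambda>y. ?f' y v) has_derivative frechet_derivative (\<lambda>y. ?f' y v) (at y)) (at y)" if "y \<in> S" for y v
    using smooth_on_has_derivative[OF smooth_on_frechet_derivative[OF assms(3)] that] .
  have c: "continuous_on S (\<lambda>y. frechet_derivative (\<lambda>y. ?f' y v) (at y) w)" for v w
    by (intro smooth_on_continuous_on smooth_on_frechet_derivative assms(3))
  show ?thesis
    using symmetric_second_derivative[OF assms(1,2) smooth_on_has_derivative[OF assms(3)] d d c c, of "axis j 1" "axis i 1"]
    by (simp add: partial_def[abs_def])
qed

section \<open>Derivatives and homogeneity of polynomial functions\<close>

lemma sum_axis_mult: "(\<Sum>j\<in>UNIV. axis i (1::real) $ j * g j) = g i"
  for i :: "'n::finite"
proof -
  have "axis i (1::real) $ j * g j = (if j = i then g j else 0)" for j by (simp add: axis_def)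
  then show ?thesis by simp
qed

text \<open>The induction carries a candidate gradient \<open>G\<close> of polynomial functions; its
  components are recognised as the partial derivatives once differentiability is known.\<close>

lemma rpf_partial:
  fixes f :: "real^'n::finite \<Rightarrow> real"
  assumes "real_polynomial_function f"
  shows "real_polynomial_function (partial i f)"
    and "(f has_derivative (\<lambda>h. \<Sum>i\<in>UNIV. h $ i * partial i f v)) (at v)"
proof -
  have *: "\<exists>G. (\<forall>i. real_polynomial_function (G i)) \<and>
      (\<forall>v. (f has_derivative (\<lambda>h. \<Sum>i\<in>UNIV. h $ i * G i v)) (at v))"
    using assms
  proof induction
    case (linear f)
    have "f h = (\<Sum>i\<in>UNIV. h $ i * f (axis i 1))" for h
      using linear_axis_sum[OF bounded_linear.linear[OF linear], of h] by simp
    then have "f = (\<lambda>h. \<Sum>i\<in>UNIV. h $ i * f (axis i 1))" by (rule ext)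
    then have "(f has_derivative (\<lambda>h. \<Sum>i\<in>UNIV. h $ i * f (axis i 1))) (at v)" for v
      using bounded_linear_imp_has_derivative[OF linear, of "at v"] by simp
    then show ?case by (intro exI[of _ "\<lambda>i v. f (axis i 1)"]) (auto intro: rpf_const)
  next
    case (const c)
    show ?case by (intro exI[of _ "\<lambda>i v. 0"]) (auto intro: rpf_const)
  next
    case (add f g)
    then obtain F G where "\<And>i. real_polynomial_function (F i)" "\<And>i. real_polynomial_function (G i)"
      "\<And>v. (f has_derivative (\<lambda>h. \<Sum>i\<in>UNIV. h $ i * F i v)) (at v)"
      "\<And>v. (g has_derivative (\<lambda>h. \<Sum>i\<in>UNIV. h $ i * G i v)) (at v)" by blast
    then show ?case
      by (intro exI[of _ "\<lambda>i v. F i v + G i v"])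
        (auto intro!: rpf_add derivative_eq_intros simp: distrib_left sum.distrib)
  next
    case (mult f g)
    then obtain F G where "\<And>i. real_polynomial_function (F i)" "\<And>i. real_polynomial_function (G i)"
      "\<And>v. (f has_derivative (\<lambda>h. \<Sum>i\<in>UNIV. h $ i * F i v)) (at v)"
      "\<And>v. (g has_derivative (\<lambda>h. \<Sum>i\<in>UNIV. h $ i * G i v)) (at v)" by blast
    then show ?case using mult
      by (intro exI[of _ "\<lambda>i v. f v * G i v + F i v * g v"])
        (auto intro!: rpf_add rpf_mult derivative_eq_intros
          simp: distrib_left sum.distrib sum_distrib_left sum_distrib_right mult_ac)
  qed
  then obtain G where G: "\<And>i. real_polynomial_function (G i)"
    "\<And>v. (f has_derivative (\<lambda>h. \<Sum>i\<in>UNIV. h $ i * G i v)) (at v)" by blast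
  have "partial i f v = G i v" for i v
    using partial_eq[OF G(2)[of v], of i] by (simp add: sum_axis_mult)
  then have "partial i f = G i" for i by (rule ext)
  then show "real_polynomial_function (partial i f)"
    "(f has_derivative (\<lambda>h. \<Sum>i\<in>UNIV. h $ i * partial i f v)) (at v)"
    using G by auto
qed

definition homogeneous :: "nat \<Rightarrow> (real^'n::finite \<Rightarrow> real) \<Rightarrow> bool" where
  "homogeneous k f \<longleftrightarrow> (\<forall>t v. f (t *\<^sub>R v) = t ^ k * f v)"

lemma rpf_isCont: "real_polynomial_function f \<Longrightarrow> isCont f v"
  for f :: "real^'n::finite \<Rightarrow> real"
  using rpf_partial(2) has_derivative_continuous by blast

lemma euler_identity:
  fixes f :: "real^'n::finite \<Rightarrow> real"
  assumes "real_polynomial_function f" "homogeneous k f"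
  shows "(\<Sum>i\<in>UNIV. v $ i * partial i f v) = real k * f v"
proof -
  have "((\<lambda>t. f (0 + t *\<^sub>R v)) has_real_derivative (\<Sum>i\<in>UNIV. v $ i * partial i f v)) (at 1)"
    by (rule has_real_derivative_along_line) (use rpf_partial(2)[OF assms(1)] in simp)
  moreover have "((\<lambda>t. t ^ k * f v) has_real_derivative real k * f v) (at 1)"
    by (auto intro!: derivative_eq_intros)
  moreover have "(\<lambda>t. f (0 + t *\<^sub>R v)) = (\<lambda>t. t ^ k * f v)"
    using assms(2) by (simp add: homogeneous_def)
  ultimately show ?thesis using DERIV_unique by metis
qed

text \<open>For nonzero \<open>t\<close> the homogeneity relation is differentiated. The case
  \<open>t = 0\<close> follows since two univariate polynomials that agree off 0 are equal.\<close>

lemma homogeneous_partial: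
  fixes f :: "real^'n::finite \<Rightarrow> real"
  assumes "real_polynomial_function f" "homogeneous (Suc k) f"
  shows "homogeneous k (partial i f)"
proof -
  have ne: "partial i f (t *\<^sub>R v) = t ^ k * partial i f v" if "t \<noteq> 0" for t v
  proof -
    have "((\<lambda>s. f (t *\<^sub>R v + s *\<^sub>R (t *\<^sub>R axis i 1))) has_real_derivative
        (\<Sum>j\<in>UNIV. (t *\<^sub>R axis i 1) $ j * partial j f (t *\<^sub>R v))) (at 0)"
      by (rule has_real_derivative_along_line) (use rpf_partial(2)[OF assms(1)] in simp)
    moreover have "(\<lambda>s. f (t *\<^sub>R v + s *\<^sub>R (t *\<^sub>R axis i 1))) = (\<lambda>s. t ^ Suc k * f (v + s *\<^sub>R axis i 1))"
    proof
      fix s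
      have "t *\<^sub>R v + s *\<^sub>R (t *\<^sub>R axis i 1) = t *\<^sub>R (v + s *\<^sub>R axis i 1)" by (simp add: scaleR_add_right mult.commute)
      then show "f (t *\<^sub>R v + s *\<^sub>R (t *\<^sub>R axis i 1)) = t ^ Suc k * f (v + s *\<^sub>R axis i 1)"
        using assms(2) unfolding homogeneous_def by metis
    qed
    moreover have "((\<lambda>s. f (v + s *\<^sub>R axis i 1)) has_real_derivative
        (\<Sum>j\<in>UNIV. axis i 1 $ j * partial j f v)) (at 0)"
      by (rule has_real_derivative_along_line) (use rpf_partial(2)[OF assms(1)] in simp)
    then have "((\<lambda>s. t ^ Suc k * f (v + s *\<^sub>R axis i 1)) has_real_derivative
        t ^ Suc k * (\<Sum>j\<in>UNIV. axis i 1 $ j * partial j f v)) (at 0)" by (rule DERIV_cmult)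
    ultimately have "(\<Sum>j\<in>UNIV. (t *\<^sub>R axis i 1) $ j * partial j f (t *\<^sub>R v))
        = t ^ Suc k * (\<Sum>j\<in>UNIV. axis i 1 $ j * partial j f v)" using DERIV_unique by fastforce
    then have "t * partial i f (t *\<^sub>R v) = t ^ Suc k * partial i f v"
      by (simp add: sum_axis_mult mult.assoc flip: sum_distrib_left)
    then show ?thesis using that by simp
  qed
  have "partial i f (t *\<^sub>R v) = t ^ k * partial i f v" for t v
  proof (cases "t = 0")
    case True
    note r = rpf_line[OF rpf_partial(1)[OF assms(1), of i], of 0 v]
    then obtain q where q: "\<And>t. partial i f (t *\<^sub>R v) = poly q t" by auto
    have "poly (q - monom (partial i f v) k) t = 0" if "t \<noteq> 0" for t
      using ne[OF that, of v] q by (simp add: poly_monom)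
    then have "UNIV - {0} \<subseteq> {t. poly (q - monom (partial i f v) k) t = 0}" by auto
    moreover have "infinite (UNIV - {0 :: real})" by (simp add: infinite_UNIV_char_0)
    ultimately have "q - monom (partial i f v) k = 0"
      using poly_roots_finite finite_subset by blast
    then have "q = monom (partial i f v) k" by simp
    then show ?thesis by (simp add: q poly_monom mult.commute)
  qed (use ne in auto)
  then show ?thesis by (simp add: homogeneous_def)
qed

text \<open>Positivity of the divisor \<open>A\<close> away from the origin replaces all degree considerations:
  a quotient inherits its homogeneity, and its behaviour at the origin decides the rest.\<close>

lemma homogeneous_quotient_zero:
  fixes A :: "real^'n::finite \<Rightarrow> real"
  assumes A: "homogeneous m A" "\<And>v. v \<noteq> 0 \<Longrightarrow> A v > 0" and f: "homogeneous k f" "k < m"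
    and g: "real_polynomial_function g" "\<And>v. f v = A v * g v" and v: "v \<noteq> 0"
  shows "f v = 0"
proof -
  obtain q where q: "\<And>t. g (t *\<^sub>R v) = poly q t" using rpf_line[OF g(1), of 0 v] by auto
  \<comment> \<open>On the ray through \<open>v\<close> the quotient has the negative degree
    \<open>k - m\<close>. Multiplied out, this is an identity of polynomials in \<open>t\<close>,
    and \<open>t = 0\<close> gives \<open>g v = 0\<close>.\<close>
  have eq: "t ^ (m - k) * poly q t = g v" if "t \<noteq> 0" for t
  proof -
    have "t ^ k * (A v * g v) = t ^ m * A v * g (t *\<^sub>R v)"
      using f(1) A(1) g(2) unfolding homogeneous_def by metis
    moreover have "t ^ m = t ^ k * t ^ (m - k)" using f(2) by (simp flip: power_add)
    ultimately have "t ^ k * A v * g v = t ^ k * A v * (t ^ (m - k) * poly q t)" by (simp add: q mult_ac)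
    then show ?thesis using A(2)[OF v] that by simp
  qed
  have "poly (monom 1 (m - k) * q - [:g v:]) t = 0" if "t \<noteq> 0" for t
    using eq[OF that] by (simp add: poly_monom)
  then have "UNIV - {0} \<subseteq> {t. poly (monom 1 (m - k) * q - [:g v:]) t = 0}" by auto
  moreover have "infinite (UNIV - {0 :: real})" by (simp add: infinite_UNIV_char_0)
  ultimately have "monom 1 (m - k) * q - [:g v:] = 0" using poly_roots_finite finite_subset by blast
  then have "poly (monom 1 (m - k) * q - [:g v:]) 0 = 0" by simp
  then have "g v = 0" using f(2) by (simp add: poly_monom power_0_left)
  then show ?thesis using g(2) by simp
qed

text \<open>Positivity of \<open>A\<close> permits cancelling it on each ray, so \<open>g\<close> is
  homogeneous of degree 1; a differentiable function of this kind coincides with its derivative at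
  the origin.\<close>

lemma homogeneous_quotient_linear:
  fixes A :: "real^'n::finite \<Rightarrow> real"
  assumes A: "homogeneous m A" "\<And>v. v \<noteq> 0 \<Longrightarrow> A v > 0" and f: "homogeneous (Suc m) f"
    and g: "real_polynomial_function g" "\<And>v. f v = A v * g v"
  shows "\<exists>p. \<forall>v. g v = p \<bullet> v"
proof -
  define p where "p = (\<chi> i. partial i g 0)"
  have "g v = p \<bullet> v" for v
  proof -
    have hom: "g (t *\<^sub>R w) = t * g w" if "t \<noteq> 0" "w \<noteq> 0" for t w
    proof -
      have "t ^ Suc m * (A w * g w) = t ^ m * A w * g (t *\<^sub>R w)"
        using f A(1) g(2) unfolding homogeneous_def by metis
      then have "t ^ m * A w * (t * g w) = t ^ m * A w * g (t *\<^sub>R w)" by (simp add: mult_ac)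
      then show ?thesis using A(2)[OF that(2)] that by simp
    qed
    have line: "g (t *\<^sub>R w) = t * g w" if w: "w \<noteq> 0" for t w
    proof (cases "t = 0")
      case True
      obtain q where q: "\<And>t. g (t *\<^sub>R w) = poly q t" using rpf_line[OF g(1), of 0 w] by auto
      have "UNIV - {0} \<subseteq> {t. poly (q - [:0, g w:]) t = 0}" using hom[OF _ w] q by auto
      moreover have "infinite (UNIV - {0 :: real})" by (simp add: infinite_UNIV_char_0)
      ultimately have "q - [:0, g w:] = 0" using poly_roots_finite finite_subset by blast
      then have "q = [:0, g w:]" by simp
      then show ?thesis by (simp only: q) simp
    qed (use hom w in auto)
    have g0: "g 0 = 0" using line[of "axis undefined 1" 0] by (simp add: axis_eq_0_iff)
    show ?thesis
    proof (cases "v = 0")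
      case False
      have "((\<lambda>t. g (0 + t *\<^sub>R v)) has_real_derivative (\<Sum>i\<in>UNIV. v $ i * partial i g 0)) (at 0)"
        by (rule has_real_derivative_along_line) (use rpf_partial(2)[OF g(1)] in simp)
      moreover have "(\<lambda>t. g (0 + t *\<^sub>R v)) = (\<lambda>t. t * g v)" using line[OF False] by simp
      moreover have "((\<lambda>t. t * g v) has_real_derivative g v) (at 0)" by (auto intro!: derivative_eq_intros)
      ultimately have "g v = (\<Sum>i\<in>UNIV. v $ i * partial i g 0)" using DERIV_unique by metis
      then show ?thesis by (simp add: p_def inner_vec_def mult.commute)
    qed (simp add: g0)
  qed
  then show ?thesis by blast
qed

section \<open>Projective flatness at a point\<close>

lemma rpf_inner: "real_polynomial_function (\<lambda>v::real^'n::finite. b \<bullet> v)"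
  by (intro rpf_linear bounded_linear_inner_right)

text \<open>The Kropina metric is defined only where \<open>b \<bullet> v\<close> is nonzero. This
  extends polynomial identities from there to the whole tangent space.\<close>

lemma rpf_eq_zero_off_hyperplane:
  fixes f :: "real^'n::finite \<Rightarrow> real"
  assumes "real_polynomial_function f" "b \<noteq> 0" "\<And>v. b \<bullet> v \<noteq> 0 \<Longrightarrow> f v = 0"
  shows "f v = 0"
proof -
  have "(b \<bullet> v) * f v = 0" for v using assms(3) by (cases "b \<bullet> v = 0") auto
  moreover have "b \<bullet> b \<noteq> 0" using assms(2) by simp
  ultimately show ?thesis using rpf_no_zero_divisors[OF rpf_inner assms(1)] by blast
qed

lemma inner_vanishes_on_hyperplane:
  fixes b c :: "real^'n::finite"
  assumes "b \<noteq> 0" "\<And>v. b \<bullet> v = 0 \<Longrightarrow> c \<bullet> v = 0"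
  shows "c = ((c \<bullet> b) / (b \<bullet> b)) *\<^sub>R b"
proof (rule vector_eq_rdot[THEN iffD1], intro allI)
  fix v
  have "b \<bullet> (v - ((b \<bullet> v) / (b \<bullet> b)) *\<^sub>R b) = 0" using assms(1) by (simp add: inner_diff_right)
  from assms(2)[OF this] have "c \<bullet> v = ((b \<bullet> v) / (b \<bullet> b)) * (c \<bullet> b)" by (simp add: inner_diff_right)
  then show "c \<bullet> v = ((c \<bullet> b) / (b \<bullet> b)) *\<^sub>R b \<bullet> v" by simp
qed

text \<open>With \<open>b \<bullet> w = 1\<close>, the vector
  \<open>v - (b \<bullet> v) *\<^sub>R w\<close> lies in the hyperplane. Expanding the form there
  leaves for \<open>v\<close> only mixed terms with \<open>w\<close>, each carrying a factor
  \<open>b \<bullet> v\<close>.\<close>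

lemma quadratic_vanishes_on_hyperplane:
  fixes b :: "real^'n::finite" and B :: "'n \<Rightarrow> real^'n"
  assumes "b \<noteq> 0" "\<And>v. b \<bullet> v = 0 \<Longrightarrow> (\<Sum>k\<in>UNIV. v $ k * (B k \<bullet> v)) = 0"
  shows "\<exists>e. \<forall>v. (\<Sum>k\<in>UNIV. v $ k * (B k \<bullet> v)) = (e \<bullet> v) * (b \<bullet> v)"
proof -
  define T where "T v w = (\<Sum>k\<in>UNIV. v $ k * (B k \<bullet> w))" for v w
  have T1: "T (v - c *\<^sub>R v') w = T v w - c * T v' w" for v v' w c
    by (simp add: T_def sum_subtractf sum_distrib_left algebra_simps)
  have T2: "T v (w - c *\<^sub>R w') = T v w - c * T v w'" for v w w' c
    by (simp add: T_def sum_subtractf sum_distrib_left inner_diff_right algebra_simps)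
  define w where "w = (1 / (b \<bullet> b)) *\<^sub>R b"
  have bw: "b \<bullet> w = 1" using assms(1) by (simp add: w_def)
  define e where "e = (\<chi> k. B k \<bullet> w) + (\<Sum>k\<in>UNIV. (w $ k) *\<^sub>R B k) - T w w *\<^sub>R b"
  have "T v v = (e \<bullet> v) * (b \<bullet> v)" for v
  proof -
    have ev: "e \<bullet> v = T v w + T w v - (b \<bullet> v) * T w w"
      by (simp add: e_def T_def inner_add_left inner_diff_left inner_sum_left inner_vec_def[of "\<chi> k. B k \<bullet> w"] mult_ac)
    have "b \<bullet> (v - (b \<bullet> v) *\<^sub>R w) = 0" using bw by (simp add: inner_diff_right)
    then have "T (v - (b \<bullet> v) *\<^sub>R w) (v - (b \<bullet> v) *\<^sub>R w) = 0" unfolding T_def by (rule assms(2))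
    then have "T v v - (b \<bullet> v) * T w v - (b \<bullet> v) * (T v w - (b \<bullet> v) * T w w) = 0"
      unfolding T1 T2 .
    then show ?thesis unfolding ev by (simp add: algebra_simps)
  qed
  then show ?thesis unfolding T_def by blast
qed

text \<open>Multiplication by \<open>(m * A * \<beta>)\<^sup>2\<close>. To the one term without a
  factor \<open>A\<close>, the product of the first derivatives contributes 8 and the mixed second
  derivative of \<open>ln A\<close> contributes \<open>- 4 * m\<close>; this is the origin of
  \<open>4 * m - 8\<close>.\<close>

lemma clear_denominators:
  fixes A \<beta> m :: real
  assumes "A \<noteq> 0" "\<beta> \<noteq> 0" "m \<noteq> 0"
    and "1/2 * (4/m * Al / A - 2 * bl / \<beta>) * (4/m * A0 / A - 2 * B0 / \<beta>)
      + (4/m * (A0l / A - A0 * Al / A\<^sup>2) - 2 * (B0l / \<beta> - B0 * bl / \<beta>\<^sup>2))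
      - (4/m * Xl / A - 2 * Bl / \<beta>) = 0"
  shows "(4 * m - 8) * A0 * Al * \<beta>\<^sup>2 = A * (4 * m\<^sup>2 * B0 * bl * A + \<beta> * (4 * m * \<beta> * A0l - 4 * m * A0 * bl
      - 4 * m * B0 * Al - 2 * m\<^sup>2 * A * B0l - 4 * m * Xl * \<beta> + 2 * m\<^sup>2 * Bl * A))"
proof -
  have "(m * A * \<beta>)\<^sup>2 * (1/2 * (4/m * Al / A - 2 * bl / \<beta>) * (4/m * A0 / A - 2 * B0 / \<beta>)
      + (4/m * (A0l / A - A0 * Al / A\<^sup>2) - 2 * (B0l / \<beta> - B0 * bl / \<beta>\<^sup>2))
      - (4/m * Xl / A - 2 * Bl / \<beta>))
    = 2 * (2 * Al * \<beta> - m * bl * A) * (2 * A0 * \<beta> - m * B0 * A)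
      + 4 * m * \<beta>\<^sup>2 * (A0l * A - A0 * Al) - 2 * m\<^sup>2 * A\<^sup>2 * (B0l * \<beta> - B0 * bl)
      - 4 * m * Xl * A * \<beta>\<^sup>2 + 2 * m\<^sup>2 * Bl * \<beta> * A\<^sup>2"
    using assms(1-3) by (simp add: field_simps power2_eq_square)
  then show ?thesis unfolding assms(4) by (simp add: algebra_simps power2_eq_square)
qed

text \<open>Once \<open>A0 / A\<close> and \<open>B0 / \<beta>\<close> are polynomial, the smaller
  factor \<open>m\<^sup>2 * A * \<beta>\<close> clears all denominators, and what remains is linear
  in the unknowns \<open>Xl\<close> and \<open>Bl\<close>.\<close>

lemma clear_denominators':
  fixes A \<beta> m :: real
  assumes "A \<noteq> 0" "\<beta> \<noteq> 0" "m \<noteq> 0"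
    and "1/2 * (4/m * Al / A - 2 * bl / \<beta>) * (4/m * A0 / A - 2 * B0 / \<beta>)
      + (4/m * (A0l / A - A0 * Al / A\<^sup>2) - 2 * (B0l / \<beta> - B0 * bl / \<beta>\<^sup>2))
      - (4/m * Xl / A - 2 * Bl / \<beta>) = 0"
    and "A0 = A * th" "B0 = et * \<beta>" "Xl + A0l = Al * th + A * thl" "Bl + B0l = etl * \<beta> + et * bl"
  shows "\<beta> * (2 * (2 * th - m * et) * Al - 4 * m * Xl)
    = A * (m * (2 * th - m * et) * bl - m * (2 * thl - m * etl) * \<beta> - 2 * m\<^sup>2 * Bl)"
proof -
  have A0l: "A0l = Al * th + A * thl - Xl" and B0l: "B0l = etl * \<beta> + et * bl - Bl" using assms by auto
  have "m\<^sup>2 * A * \<beta> * (1/2 * (4/m * Al / A - 2 * bl / \<beta>) * (4/m * A0 / A - 2 * B0 / \<beta>)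
      + (4/m * (A0l / A - A0 * Al / A\<^sup>2) - 2 * (B0l / \<beta> - B0 * bl / \<beta>\<^sup>2))
      - (4/m * Xl / A - 2 * Bl / \<beta>))
    = 2 * (2 * th - m * et) * (2 * Al * \<beta> - m * bl * A) + 2 * m * (2 * thl - m * etl) * A * \<beta>
      - 8 * m * Xl * \<beta> + 4 * m\<^sup>2 * Bl * A"
    unfolding A0l B0l assms(5,6) using assms(1-3) by (simp add: field_simps power2_eq_square)
  then show ?thesis unfolding assms(4) by (simp add: algebra_simps power2_eq_square)
qed

locale irreducible_form_point =
  fixes m :: nat and A :: "real^'n::finite \<Rightarrow> real"
  assumes m: "m \<ge> 3" and irr: "rpf_irreducible A" and homA: "homogeneous m A"
    and posA: "\<And>v. v \<noteq> 0 \<Longrightarrow> A v > 0"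
begin

lemma rpfA: "real_polynomial_function A"
  using irr by (simp add: rpf_irreducible_def)

lemma A0: "A 0 = 0"
  using homA m unfolding homogeneous_def by (metis power_eq_0_iff scale_zero_left mult_zero_left not_numeral_le_zero zero_power not_gr0)

lemma hom_partialA: "homogeneous (m - 1) (partial l A)"
  using homogeneous_partial[OF rpfA, of "m - 1" l] homA m by simp

definition dvdA :: "(real^'n \<Rightarrow> real) \<Rightarrow> bool" where
  "dvdA f \<longleftrightarrow> (\<exists>e. real_polynomial_function e \<and> (\<forall>v. f v = A v * e v))"

lemma dvdA_mult:
  assumes "real_polynomial_function f" "real_polynomial_function g" "dvdA (\<lambda>v. f v * g v)"
  shows "dvdA f \<or> dvdA g"
proof -
  obtain e where e: "real_polynomial_function e" "\<And>v. f v * g v = A v * e v" using assms by (auto simp: dvdA_def)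
  show ?thesis
    by (rule rpf_irreducible_dvd_mult[OF irr A0 assms(1,2) e]) (auto simp: dvdA_def)
qed

lemma dvdA_low_degree:
  assumes "homogeneous k f" "k < m" "dvdA f" "v \<noteq> 0"
  shows "f v = 0"
  using homogeneous_quotient_zero[OF homA posA assms(1,2) _ _ assms(4)] assms(3) unfolding dvdA_def by blast

text \<open>The derivatives have degree \<open>m - 1\<close>, so divisibility would make them vanish
  away from 0, and then \<open>A\<close> as well by Euler's identity.\<close>

lemma not_dvdA_partial: "\<exists>l. \<not> dvdA (partial l A)"
proof (rule ccontr)
  assume "\<not> ?thesis"
  then have "partial l A v = 0" if "v \<noteq> 0" for l v
    using dvdA_low_degree[OF hom_partialA _ _ that] m by auto
  then have "real m * A (axis undefined 1) = 0"
    using euler_identity[OF rpfA homA, of "axis undefined 1"] by (simp add: axis_eq_0_iff)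
  then show False using posA[of "axis undefined 1"] m by (simp add: axis_eq_0_iff)
qed

lemma dvdA_cancel_partial:
  assumes "real_polynomial_function f" "\<And>l. dvdA (\<lambda>v. partial l A v * f v)"
  shows "dvdA f"
  using not_dvdA_partial dvdA_mult[OF rpf_partial(1)[OF rpfA] assms(1) assms(2)] by blast

lemma dvdA_cancel_inner:
  assumes "b \<noteq> 0" "real_polynomial_function f" "dvdA (\<lambda>v. (b \<bullet> v) * f v)"
  shows "dvdA f"
proof -
  have "\<not> dvdA (\<lambda>v. b \<bullet> v)"
  proof
    assume "dvdA (\<lambda>v. b \<bullet> v)"
    then have "b \<bullet> b = 0" using dvdA_low_degree[of 1 "\<lambda>v. b \<bullet> v" b] assms(1) m by (simp add: homogeneous_def)
    then show False using assms(1) by simp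
  qed
  then show ?thesis using dvdA_mult[OF rpf_inner assms(2,3)] by blast
qed

end

lemma partial_mult_inner:
  fixes f :: "real^'n::finite \<Rightarrow> real"
  assumes "real_polynomial_function f"
  shows "partial l (\<lambda>v. f v * (b \<bullet> v)) v = partial l f v * (b \<bullet> v) + f v * b $ l"
proof -
  have "((\<lambda>v. f v * (b \<bullet> v)) has_derivative
      (\<lambda>h. f v * (b \<bullet> h) + (\<Sum>i\<in>UNIV. h $ i * partial i f v) * (b \<bullet> v))) (at v)"
    by (rule has_derivative_mult[OF rpf_partial(2)[OF assms]
          bounded_linear_imp_has_derivative[OF bounded_linear_inner_right]])
  from partial_eq[OF this, of l] show ?thesis
    by (simp add: inner_axis sum_axis_mult)
qed

lemma partial_sum_coord_mult:
  fixes X :: "'n::finite \<Rightarrow> real^'n \<Rightarrow> real"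
  assumes "\<And>k. real_polynomial_function (X k)"
  shows "partial l (\<lambda>v. \<Sum>k\<in>UNIV. v $ k * X k v) v = X l v + (\<Sum>k\<in>UNIV. v $ k * partial l (X k) v)"
proof -
  have "((\<lambda>v. \<Sum>k\<in>UNIV. v $ k * X k v) has_derivative
      (\<lambda>h. \<Sum>k\<in>UNIV. v $ k * (\<Sum>i\<in>UNIV. h $ i * partial i (X k) v) + h $ k * X k v)) (at v)"
    by (rule has_derivative_sum, rule has_derivative_mult[OF
          bounded_linear_imp_has_derivative[OF bounded_linear_vec_nth] rpf_partial(2)[OF assms]])
  from partial_eq[OF this, of l] show ?thesis
    by (simp add: sum_axis_mult sum.distrib)
qed

text \<open>Here \<open>X k\<close> and \<open>B k\<close> stand for the derivatives of \<open>A\<close> and \<open>b\<close> in the direction of the \<open>k\<close>-th coordinate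
  of the base point, and the last hypothesis is \<open>1/2 \<Lambda>\<^sub>l \<Lambda>\<^sub>0 + \<Lambda>\<^sub>0\<^sub>l - \<partial>\<^sub>l \<Lambda> = 0\<close> for
  \<open>\<Lambda> = (4/m) ln A - 2 ln \<bar>\<beta>\<bar>\<close>.\<close>

lemma (in irreducible_form_point) projectively_flat_point:
  fixes X :: "'n \<Rightarrow> real^'n \<Rightarrow> real" and b :: "real^'n" and B :: "'n \<Rightarrow> real^'n"
  assumes X: "\<And>k. real_polynomial_function (X k)" "\<And>k. homogeneous m (X k)" and b: "b \<noteq> 0"
    and E: "\<And>l v. b \<bullet> v \<noteq> 0 \<Longrightarrow>
      1/2 * (4 / real m * partial l A v / A v - 2 * b $ l / (b \<bullet> v))
          * (4 / real m * (\<Sum>k\<in>UNIV. v $ k * X k v) / A v - 2 * (\<Sum>k\<in>UNIV. v $ k * (B k \<bullet> v)) / (b \<bullet> v))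
      + (4 / real m * ((\<Sum>k\<in>UNIV. v $ k * partial l (X k) v) / A v
            - (\<Sum>k\<in>UNIV. v $ k * X k v) * partial l A v / (A v)\<^sup>2)
         - 2 * ((\<Sum>k\<in>UNIV. v $ k * B k $ l) / (b \<bullet> v) - (\<Sum>k\<in>UNIV. v $ k * (B k \<bullet> v)) * b $ l / (b \<bullet> v)\<^sup>2))
      - (4 / real m * X l v / A v - 2 * (B l \<bullet> v) / (b \<bullet> v)) = 0"
  shows "\<exists>p c d. \<forall>l. (\<forall>v. X l v = (p \<bullet> v) * partial l A v + c $ l * A v) \<and>
    B l = b $ l *\<^sub>R p + d $ l *\<^sub>R b \<and> p $ l = 2 / real m * c $ l - d $ l"
proof -
  define A0 where "A0 v = (\<Sum>k\<in>UNIV. v $ k * X k v)" for v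
  define B0 where "B0 v = (\<Sum>k\<in>UNIV. v $ k * (B k \<bullet> v))" for v
  define A0l where "A0l l v = (\<Sum>k\<in>UNIV. v $ k * partial l (X k) v)" for l v
  define B0l where "B0l l v = (\<Sum>k\<in>UNIV. v $ k * B k $ l)" for l v
  note E = E[folded A0_def B0_def A0l_def B0l_def]
  have m0: "real m \<noteq> 0" using m by simp
  note rpf = rpfA rpf_partial(1)[OF rpfA] X(1) rpf_partial(1)[OF X(1)] rpf_inner rpf_coord
  have rA0: "real_polynomial_function A0" unfolding A0_def[abs_def]
    by (intro real_polynomial_function_sum rpf_mult rpf) auto
  have rB0: "real_polynomial_function B0" unfolding B0_def[abs_def]
    by (intro real_polynomial_function_sum rpf_mult rpf) auto
  have rA0l: "real_polynomial_function (A0l l)" for l unfolding A0l_def[abs_def]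
    by (intro real_polynomial_function_sum rpf_mult rpf) auto
  have rB0l: "real_polynomial_function (B0l l)" for l unfolding B0l_def[abs_def]
    by (intro real_polynomial_function_sum rpf_mult rpf rpf_const) auto
  note rpf = rpf rA0 rB0 rA0l rB0l
  have nz: "A v \<noteq> 0" if "b \<bullet> v \<noteq> 0" for v using posA[of v] that by force
  \<comment> \<open>The cofactor of \<open>A\<close> in \<open>clear_denominators\<close>.\<close>
  define R where "R l v = 4 * (real m)\<^sup>2 * B0 v * b $ l * A v + (b \<bullet> v) * (4 * real m * (b \<bullet> v) * A0l l v
      - 4 * real m * A0 v * b $ l - 4 * real m * B0 v * partial l A v - 2 * (real m)\<^sup>2 * A v * B0l l v
      - 4 * real m * X l v * (b \<bullet> v) + 2 * (real m)\<^sup>2 * (B l \<bullet> v) * A v)" for l v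
  have rR: "real_polynomial_function (R l)" for l unfolding R_def[abs_def]
    by (intro rpf_add rpf_mult real_polynomial_function_diff rpf rpf_const)
  have main: "(4 * real m - 8) * A0 v * partial l A v * (b \<bullet> v)\<^sup>2 - A v * R l v = 0" for l v
  proof (rule rpf_eq_zero_off_hyperplane[OF _ b])
    show "real_polynomial_function (\<lambda>v. (4 * real m - 8) * A0 v * partial l A v * (b \<bullet> v)\<^sup>2 - A v * R l v)"
      unfolding power2_eq_square by (intro rpf_mult real_polynomial_function_diff rpf rR rpf_const)
    show "(4 * real m - 8) * A0 v * partial l A v * (b \<bullet> v)\<^sup>2 - A v * R l v = 0" if "b \<bullet> v \<noteq> 0" for v
      using clear_denominators[OF nz[OF that] that m0 E[OF that]] unfolding R_def by simp
  qed
  \<comment> \<open>Primality cancels both factors \<open>b \<bullet> v\<close>, which have degree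
    below \<open>m\<close>, and then a derivative of \<open>A\<close> that \<open>A\<close> does not
    divide.\<close>
  have "dvdA A0"
  proof (rule dvdA_cancel_partial[OF rA0])
    fix l
    have "dvdA (\<lambda>v. (b \<bullet> v) * ((b \<bullet> v) * (partial l A v * A0 v)))"
      unfolding dvdA_def
    proof (intro exI conjI allI)
      show "real_polynomial_function (\<lambda>v. 1 / (4 * real m - 8) * R l v)" by (intro rpf_mult rR rpf_const)
      fix v
      have "4 * real m - 8 \<noteq> 0" using m by simp
      moreover have "(4 * real m - 8) * ((b \<bullet> v) * ((b \<bullet> v) * (partial l A v * A0 v))) = A v * R l v"
        using main[of v l] by (simp add: power2_eq_square mult_ac)
      ultimately show "(b \<bullet> v) * ((b \<bullet> v) * (partial l A v * A0 v)) = A v * (1 / (4 * real m - 8) * R l v)"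
        by (simp add: field_simps)
    qed
    then have "dvdA (\<lambda>v. (b \<bullet> v) * (partial l A v * A0 v))"
      by (rule dvdA_cancel_inner[OF b, rotated]) (intro rpf_mult rpf)
    then show "dvdA (\<lambda>v. partial l A v * A0 v)"
      by (rule dvdA_cancel_inner[OF b, rotated]) (intro rpf_mult rpf)
  qed
  then obtain g where g: "real_polynomial_function g" "\<And>v. A0 v = A v * g v" by (auto simp: dvdA_def)
  have "homogeneous (Suc m) A0"
    using X(2) unfolding homogeneous_def A0_def by (simp add: sum_distrib_left mult_ac)
  then obtain th where th: "\<And>v. g v = th \<bullet> v"
    using homogeneous_quotient_linear[OF homA posA _ g] by blast
  \<comment> \<open>On the hyperplane only the term of \<open>R\<close> with \<open>B0\<close>
    survives, and for nonzero \<open>v\<close> its other factors can be cancelled.\<close>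
  have "B0 v = 0" if v: "b \<bullet> v = 0" for v
  proof (cases "v = 0")
    case False
    obtain l where l: "b $ l \<noteq> 0" using b by (auto simp: vec_eq_iff)
    have "A v * (4 * (real m)\<^sup>2 * B0 v * b $ l * A v) = 0"
      using main[of v l] v by (simp add: R_def)
    then show ?thesis using posA[OF False] l m by simp
  qed (simp add: B0_def)
  then obtain et where et: "\<And>v. B0 v = (et \<bullet> v) * (b \<bullet> v)"
    using quadratic_vanishes_on_hyperplane[OF b, of B] unfolding B0_def by blast
  \<comment> \<open>The derivative in direction \<open>l\<close> of
    \<open>A0 v = A v * (th \<bullet> v)\<close>; \<open>dB\<close> treats \<open>B0\<close> in the
    same way.\<close>
  have dA: "X l v + A0l l v = partial l A v * (th \<bullet> v) + A v * th $ l" for l v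
  proof -
    have "(\<lambda>v. \<Sum>k\<in>UNIV. v $ k * X k v) = (\<lambda>v. A v * (th \<bullet> v))" using g th by (auto simp: A0_def)
    then show ?thesis
      using partial_sum_coord_mult[where X = X and l = l and v = v, OF X(1)] partial_mult_inner[OF rpfA, of l th v] by (simp add: A0l_def)
  qed
  have dB: "B l \<bullet> v + B0l l v = et $ l * (b \<bullet> v) + (et \<bullet> v) * b $ l" for l v
  proof -
    have "(\<lambda>v. \<Sum>k\<in>UNIV. v $ k * (B k \<bullet> v)) = (\<lambda>v. (et \<bullet> v) * (b \<bullet> v))" using et by (auto simp: B0_def)
    moreover have "partial l (\<lambda>v. c \<bullet> v) v = c $ l" for c v
      using partial_eq[OF bounded_linear_imp_has_derivative[OF bounded_linear_inner_right[of c]], of l v]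
      by (simp add: inner_axis)
    ultimately show ?thesis
      using partial_sum_coord_mult[where X = "\<lambda>k v. B k \<bullet> v" and l = l and v = v, OF rpf_inner] partial_mult_inner[OF rpf_inner[of et], of l b v]
      by (simp add: B0l_def)
  qed
  \<comment> \<open>The combination of the two quotients that occurs in
    \<open>clear_denominators'\<close>; up to the factor \<open>2 * real m\<close> it is the
    covector \<open>p\<close>.\<close>
  define s where "s = 2 *\<^sub>R th - real m *\<^sub>R et"
  have s: "s \<bullet> v = 2 * (th \<bullet> v) - real m * (et \<bullet> v)" "s $ l = 2 * th $ l - real m * et $ l" for v l
    by (auto simp: s_def inner_diff_left)
  have eq: "(b \<bullet> v) * (2 * (s \<bullet> v) * partial l A v - 4 * real m * X l v)
     - A v * (real m * (s \<bullet> v) * b $ l - real m * s $ l * (b \<bullet> v) - 2 * (real m)\<^sup>2 * (B l \<bullet> v)) = 0" for l v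
  proof (rule rpf_eq_zero_off_hyperplane[OF _ b])
    show "real_polynomial_function (\<lambda>v. (b \<bullet> v) * (2 * (s \<bullet> v) * partial l A v - 4 * real m * X l v)
     - A v * (real m * (s \<bullet> v) * b $ l - real m * s $ l * (b \<bullet> v) - 2 * (real m)\<^sup>2 * (B l \<bullet> v)))"
      by (intro rpf_mult real_polynomial_function_diff rpf rpf_const)
    fix v assume v: "b \<bullet> v \<noteq> 0"
    have "A0 v = A v * (th \<bullet> v)" using g th by simp
    from clear_denominators'[OF nz[OF v] v m0 E[OF v] this et dA dB]
    show "(b \<bullet> v) * (2 * (s \<bullet> v) * partial l A v - 4 * real m * X l v)
     - A v * (real m * (s \<bullet> v) * b $ l - real m * s $ l * (b \<bullet> v) - 2 * (real m)\<^sup>2 * (B l \<bullet> v)) = 0"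
      unfolding s by simp
  qed
  define p where "p = (1 / (2 * real m)) *\<^sub>R s"
  \<comment> \<open>Where \<open>b \<bullet> v = 0\<close>, the equation \<open>eq\<close> says that
    \<open>B l - b $ l *\<^sub>R p\<close> vanishes on \<open>v\<close>. This covector is therefore
    a multiple of \<open>b\<close>, and \<open>d $ l\<close> is the multiple.\<close>
  define d where "d = (\<chi> l. ((B l - b $ l *\<^sub>R p) \<bullet> b) / (b \<bullet> b))"
  have B: "B l = b $ l *\<^sub>R p + d $ l *\<^sub>R b" for l
  proof -
    have "(B l - b $ l *\<^sub>R p) \<bullet> v = 0" if v: "b \<bullet> v = 0" for v
    proof (cases "v = 0")
      case False
      have "real m * ((s \<bullet> v) * b $ l - 2 * real m * (B l \<bullet> v)) = 0"
        using eq[of v l] v posA[OF False] by (auto simp: power2_eq_square algebra_simps)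
      then have "(s \<bullet> v) * b $ l = 2 * real m * (B l \<bullet> v)" using m0
        by (simp only: mult_eq_0_iff) simp
      then show ?thesis using m0 by (simp add: inner_diff_left p_def field_simps)
    qed simp
    from inner_vanishes_on_hyperplane[OF b this] show ?thesis unfolding d_def by (simp add: algebra_simps)
  qed
  \<comment> \<open>The relation \<open>p $ l = 2 / real m * c $ l - d $ l\<close> solved for
    \<open>c\<close>.\<close>
  define c where "c = (real m / 2) *\<^sub>R (p + d)"
  have sp: "s = (2 * real m) *\<^sub>R p" using m0 by (simp add: p_def)
  have "X l v - ((p \<bullet> v) * partial l A v + c $ l * A v) = 0" for l v
  proof (rule rpf_eq_zero_off_hyperplane[OF _ b])
    show "real_polynomial_function (\<lambda>v. X l v - ((p \<bullet> v) * partial l A v + c $ l * A v))"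
      by (intro rpf_add rpf_mult real_polynomial_function_diff rpf rpf_const)
    fix v assume v: "b \<bullet> v \<noteq> 0"
    have "4 * real m * (b \<bullet> v) * (X l v - ((p \<bullet> v) * partial l A v + c $ l * A v)) = 0"
      using eq[of v l] unfolding sp B
      by (simp add: c_def inner_add_left power2_eq_square algebra_simps)
    then show "X l v - ((p \<bullet> v) * partial l A v + c $ l * A v) = 0" using v m0 by simp
  qed
  moreover have "p $ l = 2 / real m * c $ l - d $ l" for l using m0 by (simp add: c_def add_divide_distrib)
  ultimately show ?thesis using B by (intro exI[of _ p] exI[of _ c] exI[of _ d]) simp
qed

section \<open>The spray of a Kropina metric\<close>

text \<open>The power of \<open>f\<close> is written through \<open>exp\<close> and
  \<open>ln\<close>, so that the derivative appears as the function times its logarithmic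
  derivative.\<close>

lemma has_derivative_exp_ln_quotient:
  fixes f g :: "'a::real_normed_vector \<Rightarrow> real"
  assumes f: "(f has_derivative f') (at x)" and g: "(g has_derivative g') (at x)" and pos: "f x > 0" "g x \<noteq> 0"
  shows "((\<lambda>x. exp (k * ln (f x)) / (g x)\<^sup>2) has_derivative
    (\<lambda>h. exp (k * ln (f x)) / (g x)\<^sup>2 * (k * f' h / f x - 2 * g' h / g x))) (at x)"
proof -
  have e: "((\<lambda>x. exp (k * ln (f x))) has_derivative (\<lambda>h. exp (k * ln (f x)) * (k * f' h / f x))) (at x)"
    using pos(1) by (auto intro!: derivative_eq_intros f simp: field_simps)
  have q: "((\<lambda>x. (g x)\<^sup>2) has_derivative (\<lambda>h. 2 * g x * g' h)) (at x)"
    by (auto intro!: derivative_eq_intros g)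
  show ?thesis
    by (rule has_derivative_eq_rhs[OF has_derivative_divide'[OF e q]])
      (use pos in \<open>auto simp: field_simps power2_eq_square fun_eq_iff\<close>)
qed

lemma has_derivative_log_derivative:
  fixes f g X Y :: "'a::real_normed_vector \<Rightarrow> real"
  assumes f: "(f has_derivative f') (at x)" and g: "(g has_derivative g') (at x)"
    and X: "(X has_derivative X') (at x)" and Y: "(Y has_derivative Y') (at x)" and nz: "f x \<noteq> 0" "g x \<noteq> 0"
  shows "((\<lambda>x. k * X x / f x - 2 * Y x / g x) has_derivative
    (\<lambda>h. k * (X' h / f x - X x * f' h / (f x)\<^sup>2) - 2 * (Y' h / g x - Y x * g' h / (g x)\<^sup>2))) (at x)"
proof -
  have 1: "((\<lambda>x. k * (X x / f x)) has_derivative (\<lambda>h. k * ((X' h * f x - X x * f' h) / (f x * f x)))) (at x)"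
    by (rule has_derivative_mult_right[OF has_derivative_divide'[OF X f nz(1)]])
  have 2: "((\<lambda>x. 2 * (Y x / g x)) has_derivative (\<lambda>h. 2 * ((Y' h * g x - Y x * g' h) / (g x * g x)))) (at x)"
    by (rule has_derivative_mult_right[OF has_derivative_divide'[OF Y g nz(2)]])
  have "((\<lambda>x. k * (X x / f x) - 2 * (Y x / g x)) has_derivative
      (\<lambda>h. k * (X' h / f x - X x * f' h / (f x)\<^sup>2) - 2 * (Y' h / g x - Y x * g' h / (g x)\<^sup>2))) (at x)"
    by (rule has_derivative_eq_rhs[OF has_derivative_diff[OF 1 2]])
      (use nz in \<open>auto simp: field_simps power2_eq_square fun_eq_iff\<close>)
  then show ?thesis by simp
qed

lemma partial_cong_open:
  assumes "open T" "x \<in> T" "\<And>y. y \<in> T \<Longrightarrow> f y = g y" "(g has_derivative g') (at x)"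
  shows "partial i f x = g' (axis i 1)"
  by (rule partial_eq, rule has_derivative_transform_within_open[OF assms(4,1,2)]) (simp add: assms(3))

lemma positive_definite_imp_invertible:
  assumes "positive_definite M"
  shows "invertible M"
proof -
  have "w = 0" if "M *v w = 0" for w
  proof (rule ccontr)
    assume "w \<noteq> 0"
    then have "(\<Sum>i\<in>UNIV. \<Sum>j\<in>UNIV. M $ i $ j * w $ i * w $ j) > 0" using assms by (auto simp: positive_definite_def)
    moreover have "(\<Sum>i\<in>UNIV. \<Sum>j\<in>UNIV. M $ i $ j * w $ i * w $ j) = w \<bullet> (M *v w)"
      by (simp add: inner_vec_def matrix_vector_mult_def sum_distrib_left mult_ac)
    ultimately show False using that by simp
  qed
  then show ?thesis using matrix_left_invertible_ker invertible_left_inverse by blast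
qed

lemma matrix_inv_right:
  fixes M :: "real^'n::finite^'n"
  assumes "invertible M"
  shows "M ** matrix_inv M = mat 1"
  using someI_ex[of "\<lambda>M'. M ** M' = mat 1 \<and> M' ** M = mat 1"] assms
  unfolding matrix_inv_def invertible_def by blast

lemma kropina_square:
  assumes "m > 0" "form m (c u) v > 0"
  shows "(kropina_change (mth_root m c) (one_form b) u v)\<^sup>2
    = exp (4 / real m * ln (form m (c u) v)) / (b u \<bullet> v)\<^sup>2"
proof -
  have "root m (form m (c u) v) = exp (ln (form m (c u) v) / real m)"
    using assms by (simp add: root_powr_inverse powr_def)
  then have "(root m (form m (c u) v)) ^ 4 = exp (4 / real m * ln (form m (c u) v))"
    by (simp flip: exp_of_nat_mult)
  moreover have "one_form b u v = b u \<bullet> v" by (simp add: one_form_def inner_vec_def)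
  ultimately show ?thesis by (simp add: kropina_change_def mth_root_def power_divide flip: power_mult)
qed

section \<open>The Kropina metric in fixed coordinates\<close>

locale kropina_coords =
  fixes W :: "(real^'n::finite) set" and m :: nat and c :: "real^'n \<Rightarrow> 'n list \<Rightarrow> real" and b :: "real^'n \<Rightarrow> real^'n"
  assumes W: "open W" and m: "m \<ge> 3"
    and c_smooth: "\<And>is. length is = m \<Longrightarrow> smooth_on W (\<lambda>u. c u is)"
    and b_smooth: "smooth_on W b"
    and pos: "\<And>u v. u \<in> W \<Longrightarrow> v \<noteq> 0 \<Longrightarrow> form m (c u) v > 0"
    and irr: "\<And>u. u \<in> W \<Longrightarrow> rpf_irreducible (form m (c u))"
    and hess: "\<And>u v w. u \<in> W \<Longrightarrow> v \<noteq> 0 \<Longrightarrow> w \<noteq> 0 \<Longrightarrow>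
      (\<Sum>i\<in>UNIV. \<Sum>j\<in>UNIV. partial i (partial j (form m (c u))) v * w $ i * w $ j) > 0"
begin

definition A :: "real^'n \<Rightarrow> real^'n \<Rightarrow> real" where "A u = form m (c u)"
definition X :: "'n \<Rightarrow> real^'n \<Rightarrow> real^'n \<Rightarrow> real" where "X k u = form m (\<lambda>is. partial k (\<lambda>u. c u is) u)"
definition B :: "'n \<Rightarrow> real^'n \<Rightarrow> real^'n" where "B k u = frechet_derivative b (at u) (axis k 1)"

lemma rpfA: "real_polynomial_function (A u)" by (simp add: A_def rpf_form)
lemma rpfX: "real_polynomial_function (X k u)" by (simp add: X_def rpf_form)
lemma homA: "homogeneous m (A u)" by (simp add: A_def homogeneous_def form_scaleR)
lemma homX: "homogeneous m (X k u)" by (simp add: X_def homogeneous_def form_scaleR)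
lemma posA: "u \<in> W \<Longrightarrow> v \<noteq> 0 \<Longrightarrow> A u v > 0" by (simp add: A_def pos)
lemma m0: "real m > 0" using m by simp

lemma point: "u \<in> W \<Longrightarrow> irreducible_form_point m (A u)"
  using m irr homA posA by unfold_locales (auto simp: A_def)

lemma has_derivative_coeff_sum:
  assumes "u \<in> W"
  shows "((\<lambda>u. \<Sum>is | length is = m. c u is * \<kappa> is) has_derivative
    (\<lambda>h. \<Sum>k\<in>UNIV. h $ k * (\<Sum>is | length is = m. partial k (\<lambda>u. c u is) u * \<kappa> is))) (at u)"
proof -
  have "((\<lambda>u. \<Sum>is | length is = m. c u is * \<kappa> is) has_derivative
    (\<lambda>h. \<Sum>is | length is = m. (\<Sum>k\<in>UNIV. h $ k * partial k (\<lambda>u. c u is) u) * \<kappa> is)) (at u)"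
    by (intro has_derivative_sum has_derivative_mult_left smooth_on_has_derivative_partial[OF _ assms])
      (auto intro: c_smooth)
  then show ?thesis
    by (rule has_derivative_eq_rhs) (simp add: fun_eq_iff sum_distrib_left sum_distrib_right mult_ac sum.swap[of _ UNIV])
qed

lemma A_has_derivative: "u \<in> W \<Longrightarrow> ((\<lambda>u. A u v) has_derivative (\<lambda>h. \<Sum>k\<in>UNIV. h $ k * X k u v)) (at u)"
  unfolding A_def X_def form_def by (rule has_derivative_coeff_sum)

lemma b_has_derivative: "u \<in> W \<Longrightarrow> (b has_derivative (\<lambda>h. \<Sum>k\<in>UNIV. h $ k *\<^sub>R B k u)) (at u)"
proof -
  assume u: "u \<in> W"
  note d = smooth_on_has_derivative[OF b_smooth u]
  have "frechet_derivative b (at u) = (\<lambda>h. \<Sum>k\<in>UNIV. h $ k *\<^sub>R B k u)"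
    unfolding B_def by (intro ext linear_axis_sum has_derivative_linear[OF d])
  then show ?thesis using d by simp
qed

lemma \<beta>_has_derivative: "u \<in> W \<Longrightarrow> ((\<lambda>u. b u \<bullet> v) has_derivative (\<lambda>h. \<Sum>k\<in>UNIV. h $ k * (B k u \<bullet> v))) (at u)"
  using has_derivative_inner_left[OF b_has_derivative] by (simp add: inner_sum_left)

definition L :: "real^'n \<Rightarrow> real^'n \<Rightarrow> real" where
  "L u v = (kropina_change (mth_root m c) (one_form b) u v)\<^sup>2"

lemma L_eq: "u \<in> W \<Longrightarrow> v \<noteq> 0 \<Longrightarrow> L u v = exp (4 / real m * ln (A u v)) / (b u \<bullet> v)\<^sup>2"
  unfolding L_def A_def by (rule kropina_square) (use m pos in auto)

text \<open>First and second logarithmic derivatives of \<open>L\<close>: \<open>l\<close> and \<open>ll\<close> in \<open>v\<close>, \<open>R\<close> in \<open>u\<close>, and \<open>Rl\<close> mixed.\<close>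

definition l :: "'n \<Rightarrow> real^'n \<Rightarrow> real^'n \<Rightarrow> real" where
  "l i u v = 4 / real m * partial i (A u) v / A u v - 2 * b u $ i / (b u \<bullet> v)"

definition R :: "'n \<Rightarrow> real^'n \<Rightarrow> real^'n \<Rightarrow> real" where
  "R k u v = 4 / real m * X k u v / A u v - 2 * (B k u \<bullet> v) / (b u \<bullet> v)"

definition Rl :: "'n \<Rightarrow> 'n \<Rightarrow> real^'n \<Rightarrow> real^'n \<Rightarrow> real" where
  "Rl i k u v = 4 / real m * (partial i (X k u) v / A u v - X k u v * partial i (A u) v / (A u v)\<^sup>2)
    - 2 * (B k u $ i / (b u \<bullet> v) - (B k u \<bullet> v) * b u $ i / (b u \<bullet> v)\<^sup>2)"

definition ll :: "'n \<Rightarrow> 'n \<Rightarrow> real^'n \<Rightarrow> real^'n \<Rightarrow> real" where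
  "ll i j u v = 4 / real m * (partial i (partial j (A u)) v / A u v - partial j (A u) v * partial i (A u) v / (A u v)\<^sup>2)
    - 2 * (- b u $ j * b u $ i / (b u \<bullet> v)\<^sup>2)"

lemma open_cone: "open {v. b u \<bullet> v \<noteq> 0}"
proof -
  have "open {v. b u \<bullet> v \<in> - {0}}"
    by (intro open_vimage[unfolded vimage_def] open_Compl closed_singleton continuous_intros)
  then show ?thesis by simp
qed

lemma cone_nonzero: "b u \<bullet> v \<noteq> 0 \<Longrightarrow> v \<noteq> 0" by auto

lemma L_has_derivative_v:
  assumes "u \<in> W" "b u \<bullet> v \<noteq> 0"
  shows "(L u has_derivative (\<lambda>h. L u v * (4 / real m * (\<Sum>i\<in>UNIV. h $ i * partial i (A u) v) / A u v
      - 2 * (b u \<bullet> h) / (b u \<bullet> v)))) (at v)"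
proof -
  note v = cone_nonzero[OF assms(2)]
  have "((\<lambda>v. exp (4 / real m * ln (A u v)) / (b u \<bullet> v)\<^sup>2) has_derivative
     (\<lambda>h. L u v * (4 / real m * (\<Sum>i\<in>UNIV. h $ i * partial i (A u) v) / A u v - 2 * (b u \<bullet> h) / (b u \<bullet> v)))) (at v)"
    unfolding L_eq[OF assms(1) v]
    by (rule has_derivative_exp_ln_quotient[OF rpf_partial(2)[OF rpfA]
          bounded_linear_imp_has_derivative[OF bounded_linear_inner_right] posA[OF assms(1) v] assms(2)])
  then show ?thesis
    by (rule has_derivative_transform_within_open[OF _ open_cone[of u]])
      (use assms L_eq cone_nonzero in auto)
qed

lemma partial_L_v: "u \<in> W \<Longrightarrow> b u \<bullet> v \<noteq> 0 \<Longrightarrow> partial i (L u) v = L u v * l i u v"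
  using partial_eq[OF L_has_derivative_v, of u v i] by (simp add: l_def sum_axis_mult inner_axis)

lemma partial_L_u:
  assumes "u \<in> W" "b u \<bullet> v \<noteq> 0"
  shows "partial k (\<lambda>u. L u v) u = L u v * R k u v"
proof -
  note v = cone_nonzero[OF assms(2)]
  have d: "((\<lambda>u. exp (4 / real m * ln (A u v)) / (b u \<bullet> v)\<^sup>2) has_derivative
     (\<lambda>h. L u v * (4 / real m * (\<Sum>k\<in>UNIV. h $ k * X k u v) / A u v
       - 2 * (\<Sum>k\<in>UNIV. h $ k * (B k u \<bullet> v)) / (b u \<bullet> v)))) (at u)"
    unfolding L_eq[OF assms(1) v]
    by (rule has_derivative_exp_ln_quotient[OF A_has_derivative[OF assms(1)] \<beta>_has_derivative[OF assms(1)]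
          posA[OF assms(1) v] assms(2)])
  show ?thesis
    by (subst partial_cong_open[OF W assms(1) _ d]) (use L_eq[OF _ v] in \<open>auto simp: R_def sum_axis_mult\<close>)
qed

text \<open>The product rule for \<open>L\<close> times a logarithmic derivative, where
  \<open>X'\<close> and \<open>Y'\<close> are the derivatives of \<open>A\<close> and
  \<open>\<beta>\<close> in a fixed direction. Fibre directions give the fundamental tensor, base
  directions the mixed derivatives in the spray.\<close>

lemma partial_L_times:
  assumes u: "u \<in> W" and v: "b u \<bullet> v \<noteq> 0"
    and X: "real_polynomial_function X'" and Y: "real_polynomial_function Y'"
    and f: "\<And>y. b u \<bullet> y \<noteq> 0 \<Longrightarrow> f y = L u y * (4 / real m * X' y / A u y - 2 * Y' y / (b u \<bullet> y))"
  shows "partial i f v = L u v * (l i u v * (4 / real m * X' v / A u v - 2 * Y' v / (b u \<bullet> v))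
    + (4 / real m * (partial i X' v / A u v - X' v * partial i (A u) v / (A u v)\<^sup>2)
       - 2 * (partial i Y' v / (b u \<bullet> v) - Y' v * b u $ i / (b u \<bullet> v)\<^sup>2)))"
proof -
  have A0: "A u v \<noteq> 0" using posA[OF u cone_nonzero[OF v]] by simp
  note d = has_derivative_mult[OF L_has_derivative_v[OF u v]
      has_derivative_log_derivative[where k = "4 / real m", OF rpf_partial(2)[OF rpfA]
        bounded_linear_imp_has_derivative[OF bounded_linear_inner_right] rpf_partial(2)[OF X] rpf_partial(2)[OF Y] A0 v]]
  have "partial i f v = L u v * (4 / real m * (partial i X' v / A u v - X' v * partial i (A u) v / (A u v)\<^sup>2)
       - 2 * (partial i Y' v / (b u \<bullet> v) - Y' v * b u $ i / (b u \<bullet> v)\<^sup>2))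
     + L u v * l i u v * (4 / real m * X' v / A u v - 2 * Y' v / (b u \<bullet> v))"
    by (subst partial_cong_open[OF open_cone[of u] _ _ d])
      (use v f in \<open>simp_all add: l_def sum_axis_mult inner_axis\<close>)
  then show ?thesis by (simp only: distrib_left mult.assoc add.commute)
qed

lemma partial_const: "partial i (\<lambda>v. a) v = 0"
  by (rule partial_eq[OF has_derivative_const])

lemma partial_inner: "partial i (\<lambda>v. a \<bullet> v) v = a $ i"
  by (simp add: partial_eq[OF bounded_linear_imp_has_derivative[OF bounded_linear_inner_right]] inner_axis)

lemma partial_L_vv:
  assumes u: "u \<in> W" and v: "b u \<bullet> v \<noteq> 0"
  shows "partial i (\<lambda>y. partial j (L u) y) v = L u v * (l i u v * l j u v + ll i j u v)"
  by (subst partial_L_times[OF u v rpf_partial(1)[OF rpfA, of j] rpf_const[of "b u $ j"]])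
    (auto simp: partial_L_v[OF u] l_def ll_def partial_const)

lemma partial_L_uv:
  assumes u: "u \<in> W" and v: "b u \<bullet> v \<noteq> 0"
  shows "partial i (\<lambda>y. partial k (\<lambda>u. L u y) u) v = L u v * (l i u v * R k u v + Rl i k u v)"
  by (subst partial_L_times[OF u v rpfX[of k u] rpf_inner[of "B k u"]])
    (auto simp: partial_L_u[OF u] R_def Rl_def partial_inner)

lemma euler_A: "(\<Sum>i\<in>UNIV. v $ i * partial i (A u) v) = real m * A u v"
  by (rule euler_identity[OF rpfA homA])

lemma euler_dA: "(\<Sum>i\<in>UNIV. v $ i * partial i (partial j (A u)) v) = (real m - 1) * partial j (A u) v"
proof -
  have "homogeneous (m - 1) (partial j (A u))"
    using homogeneous_partial[OF rpfA, of "m - 1" u j] homA[of u] m by simp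
  from euler_identity[OF rpf_partial(1)[OF rpfA] this, of v] show ?thesis using m by (simp add: of_nat_diff)
qed

lemma euler_dA': "(\<Sum>j\<in>UNIV. v $ j * partial i (partial j (A u)) v) = (real m - 1) * partial i (A u) v"
proof -
  have "(\<lambda>v. \<Sum>j\<in>UNIV. v $ j * partial j (A u) v) = (\<lambda>v. A u v * real m)" using euler_A by (auto simp: mult.commute)
  moreover have "partial i (\<lambda>v. A u v * real m) v = real m * partial i (A u) v"
    using partial_eq[OF has_derivative_mult_left[OF rpf_partial(2)[OF rpfA]], of i] by (simp add: sum_axis_mult)
  ultimately have "real m * partial i (A u) v = partial i (A u) v + (\<Sum>j\<in>UNIV. v $ j * partial i (partial j (A u)) v)"
    using partial_sum_coord_mult[where X = "\<lambda>j. partial j (A u)" and l = i and v = v, OF rpf_partial(1)[OF rpfA]] by simp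
  then show ?thesis by (simp add: algebra_simps)
qed

lemma euler_X: "(\<Sum>i\<in>UNIV. v $ i * partial i (X k u) v) = real m * X k u v"
  by (rule euler_identity[OF rpfX homX])

text \<open>The Hessian is nonnegative on \<open>w + s *\<^sub>R v\<close>, and its entries with
  \<open>v\<close> are evaluated by Euler's identity.\<close>

lemma hessian_cauchy_schwarz:
  assumes u: "u \<in> W" and v: "v \<noteq> 0"
  shows "(real m - 1) * (\<Sum>i\<in>UNIV. w $ i * partial i (A u) v)\<^sup>2
    \<le> real m * A u v * (\<Sum>i\<in>UNIV. \<Sum>j\<in>UNIV. partial i (partial j (A u)) v * w $ i * w $ j)"
proof -
  let ?H = "\<lambda>x y. \<Sum>i\<in>UNIV. \<Sum>j\<in>UNIV. partial i (partial j (A u)) v * x $ i * y $ j"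
  define Aw where "Aw = (\<Sum>i\<in>UNIV. w $ i * partial i (A u) v)"
  have Hv: "?H x v = (real m - 1) * (\<Sum>i\<in>UNIV. x $ i * partial i (A u) v)" for x
  proof -
    have "?H x v = (\<Sum>i\<in>UNIV. x $ i * (\<Sum>j\<in>UNIV. v $ j * partial i (partial j (A u)) v))"
      by (simp add: sum_distrib_left mult_ac)
    then show ?thesis unfolding euler_dA' by (simp add: sum_distrib_left mult_ac)
  qed
  have Hv': "?H v y = (real m - 1) * (\<Sum>j\<in>UNIV. y $ j * partial j (A u) v)" for y
  proof -
    have "?H v y = (\<Sum>j\<in>UNIV. y $ j * (\<Sum>i\<in>UNIV. v $ i * partial i (partial j (A u)) v))"
      by (subst sum.swap) (simp add: sum_distrib_left mult_ac)
    then show ?thesis unfolding euler_dA by (simp add: sum_distrib_left mult_ac)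
  qed
  \<comment> \<open>The minimizer of the resulting quadratic polynomial in \<open>s\<close>.\<close>
  define s where "s = - Aw / (real m * A u v)"
  have A: "A u v > 0" by (rule posA[OF u v])
  have "?H (w + s *\<^sub>R v) (w + s *\<^sub>R v) = ?H w w + s * ?H w v + s * ?H v w + s\<^sup>2 * ?H v v"
    by (simp add: algebra_simps sum.distrib sum_distrib_left power2_eq_square)
  also have "\<dots> = ?H w w + 2 * s * (real m - 1) * Aw + s\<^sup>2 * (real m - 1) * (real m * A u v)"
    unfolding Hv Hv' euler_A Aw_def by (simp add: algebra_simps)
  also have "\<dots> = ?H w w - (real m - 1) * Aw\<^sup>2 / (real m * A u v)"
    using A m0 by (simp add: s_def field_simps power2_eq_square)
  finally have eq: "?H (w + s *\<^sub>R v) (w + s *\<^sub>R v) = ?H w w - (real m - 1) * Aw\<^sup>2 / (real m * A u v)" .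
  have "?H (w + s *\<^sub>R v) (w + s *\<^sub>R v) \<ge> 0"
  proof (cases "w + s *\<^sub>R v = 0")
    case False
    then show ?thesis using hess[OF u v False] unfolding A_def by simp
  qed simp
  then have "(real m - 1) * Aw\<^sup>2 / (real m * A u v) \<le> ?H w w" unfolding eq by simp
  then show ?thesis using A m0 by (simp add: Aw_def field_simps)
qed

text \<open>The \<open>matrix_inv\<close> in the spray can be undone once the tensor is invertible.
  The quadratic form at \<open>w\<close> is expressed by \<open>a\<close>, \<open>y\<close> and the
  normalized Hessian value \<open>k\<close>; the Cauchy-Schwarz inequality for the Hessian then
  leaves a sum of squares.\<close>

lemma kropina_positive_definite:
  assumes u: "u \<in> W" and v: "b u \<bullet> v \<noteq> 0"
  shows "positive_definite (fundamental_tensor (kropina_change (mth_root m c) (one_form b)) u v)"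
  unfolding positive_definite_def
proof (intro allI impI)
  fix w :: "real^'n" assume w: "w \<noteq> 0"
  note v0 = cone_nonzero[OF v]
  let ?H = "\<Sum>i\<in>UNIV. \<Sum>j\<in>UNIV. partial i (partial j (A u)) v * w $ i * w $ j"
  define Aw where "Aw = (\<Sum>i\<in>UNIV. w $ i * partial i (A u) v)"
  define y where "y = (b u \<bullet> w) / (b u \<bullet> v)"
  define a where "a = Aw / (real m * A u v)"
  have A: "A u v > 0" by (rule posA[OF u v0])
  have Lpos: "L u v > 0" using v by (simp add: L_eq[OF u v0])
  have sl: "(\<Sum>i\<in>UNIV. w $ i * l i u v) = 4 * a - 2 * y"
  proof -
    have "(\<Sum>i\<in>UNIV. w $ i * l i u v) = 4 / real m / A u v * Aw - 2 / (b u \<bullet> v) * (\<Sum>i\<in>UNIV. w $ i * b u $ i)"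
      by (simp add: l_def Aw_def right_diff_distrib sum_subtractf sum_distrib_left mult_ac)
    moreover have "(\<Sum>i\<in>UNIV. w $ i * b u $ i) = b u \<bullet> w" by (simp add: inner_vec_def mult.commute)
    ultimately show ?thesis by (simp add: a_def y_def)
  qed
  have sll: "(\<Sum>i\<in>UNIV. \<Sum>j\<in>UNIV. ll i j u v * w $ i * w $ j)
      = 4 / real m * (?H / A u v - Aw\<^sup>2 / (A u v)\<^sup>2) + 2 * y\<^sup>2"
  proof -
    have "ll i j u v * w $ i * w $ j = 4 / real m * (1 / A u v * (partial i (partial j (A u)) v * w $ i * w $ j))
        - 4 / real m * (1 / (A u v)\<^sup>2 * ((w $ i * partial i (A u) v) * (w $ j * partial j (A u) v)))
        + 2 * (1 / (b u \<bullet> v)\<^sup>2 * ((b u $ i * w $ i) * (b u $ j * w $ j)))" for i j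
      by (simp add: ll_def algebra_simps)
    then have "(\<Sum>i\<in>UNIV. \<Sum>j\<in>UNIV. ll i j u v * w $ i * w $ j) = 4 / real m * (1 / A u v * ?H)
        - 4 / real m * (1 / (A u v)\<^sup>2 * (Aw * Aw)) + 2 * (1 / (b u \<bullet> v)\<^sup>2 * ((b u \<bullet> w) * (b u \<bullet> w)))"
      unfolding Aw_def inner_vec_def sum_product
      by (simp only: sum.distrib sum_subtractf sum_distrib_left inner_real_def)
    then show ?thesis by (simp add: y_def power2_eq_square algebra_simps)
  qed
  have "(\<Sum>i\<in>UNIV. \<Sum>j\<in>UNIV. fundamental_tensor (kropina_change (mth_root m c) (one_form b)) u v $ i $ j * w $ i * w $ j)
      = (\<Sum>i\<in>UNIV. \<Sum>j\<in>UNIV. 1/2 * (L u v * (l i u v * l j u v + ll i j u v)) * w $ i * w $ j)"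
    using partial_L_vv[OF u v] by (simp add: fundamental_tensor_def L_def[abs_def])
  also have "\<dots> = L u v / 2 * ((\<Sum>i\<in>UNIV. w $ i * l i u v)\<^sup>2 + (\<Sum>i\<in>UNIV. \<Sum>j\<in>UNIV. ll i j u v * w $ i * w $ j))"
    unfolding power2_eq_square sum_product by (simp add: sum_distrib_left sum.distrib algebra_simps)
  also have "\<dots> > 0"
  proof -
    have H: "?H > 0" using hess[OF u v0 w] by (simp add: A_def)
    define k where "k = ?H / (real m * A u v)"
    have k: "k > 0" using H A m0 by (simp add: k_def)
    have "(real m - 1) * Aw\<^sup>2 \<le> real m * A u v * ?H"
      using hessian_cauchy_schwarz[OF u v0, of w] unfolding Aw_def .
    then have "(real m - 1) * Aw\<^sup>2 / (real m * A u v)\<^sup>2 \<le> real m * A u v * ?H / (real m * A u v)\<^sup>2"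
      by (intro divide_right_mono) auto
    then have "(real m - 1) * a\<^sup>2 \<le> k" using A m0 by (simp add: k_def a_def power_divide power2_eq_square)
    then have ka: "4 * ((real m - 1) * a\<^sup>2) \<le> 4 * k" by simp
    have "Aw\<^sup>2 / (A u v)\<^sup>2 = (real m)\<^sup>2 * a\<^sup>2" using A m0 by (simp add: a_def power_divide power_mult_distrib)
    then have "(4 * a - 2 * y)\<^sup>2 + (4 / real m * (?H / A u v - Aw\<^sup>2 / (A u v)\<^sup>2) + 2 * y\<^sup>2)
        = (4 * a - 2 * y)\<^sup>2 + 4 * k - 4 * real m * a\<^sup>2 + 2 * y\<^sup>2"
      using m0 A by (simp add: k_def field_simps power2_eq_square)
    \<comment> \<open>With \<open>(real m - 1) * a\<^sup>2\<close> set against \<open>k\<close>, the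
      coefficients of \<open>a\<^sup>2\<close>, \<open>a * y\<close> and \<open>y\<^sup>2\<close>
      become 12, -16 and 6, independent of \<open>m\<close>; then the square is completed.\<close>
    also have "\<dots> = 12 * (a - 2 / 3 * y)\<^sup>2 + 2 / 3 * y\<^sup>2 + (4 * k - 4 * ((real m - 1) * a\<^sup>2))"
      by (simp add: power2_eq_square algebra_simps)
    also have "\<dots> > 0"
    proof (cases "a = 0 \<and> y = 0")
      case True
      then show ?thesis using k by simp
    next
      case False
      then have "12 * (a - 2 / 3 * y)\<^sup>2 + 2 / 3 * y\<^sup>2 > 0"
        by (cases "y = 0") (auto intro: add_nonneg_pos)
      then show ?thesis using ka by linarith
    qed
    finally show ?thesis using Lpos unfolding sl sll by simp
  qed
  finally show "(\<Sum>i\<in>UNIV. \<Sum>j\<in>UNIV. fundamental_tensor (kropina_change (mth_root m c) (one_form b)) u v $ i $ j * w $ i * w $ j) > 0" .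
qed

text \<open>Applying the tensor to the spray equation removes the inverse. Contraction with
  \<open>v\<close> then determines \<open>P\<close> as \<open>l0 / 4\<close>, and substituting this
  back eliminates \<open>P\<close>.\<close>

lemma projectively_flat_equation:
  assumes u: "u \<in> W" and v: "b u \<bullet> v \<noteq> 0"
    and G: "\<And>i. spray_coeff (kropina_change (mth_root m c) (one_form b)) u v i = P * v $ i"
  shows "1/2 * l j u v * (\<Sum>k\<in>UNIV. v $ k * R k u v) + (\<Sum>k\<in>UNIV. v $ k * Rl j k u v) - R j u v = 0"
proof -
  let ?F = "kropina_change (mth_root m c) (one_form b)"
  let ?M = "fundamental_tensor ?F u v"
  note v0 = cone_nonzero[OF v]
  have A: "A u v > 0" by (rule posA[OF u v0])
  have Lpos: "L u v > 0" using v by (simp add: L_eq[OF u v0])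
  define T where "T = (\<chi> i. (\<Sum>k\<in>UNIV. partial i (\<lambda>y. partial k (\<lambda>x. (?F x y)\<^sup>2) u) v * v $ k) - partial i (\<lambda>x. (?F x v)\<^sup>2) u)"
  define l0 where "l0 = (\<Sum>k\<in>UNIV. v $ k * R k u v)"
  have T: "T $ i = L u v * (l i u v * l0 + (\<Sum>k\<in>UNIV. v $ k * Rl i k u v) - R i u v)" for i
  proof -
    have "T $ i = (\<Sum>k\<in>UNIV. L u v * (l i u v * R k u v + Rl i k u v) * v $ k) - L u v * R i u v"
      using partial_L_uv[OF u v] partial_L_u[OF u v] by (simp add: T_def L_def[abs_def])
    then show ?thesis by (simp add: l0_def algebra_simps sum.distrib sum_distrib_left)
  qed
  have inv: "invertible ?M" using positive_definite_imp_invertible kropina_positive_definite[OF u v] .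
  have "(matrix_inv ?M *v T) $ i = ((4 * P) *\<^sub>R v) $ i" for i
  proof -
    have "4 * spray_coeff ?F u v i = (matrix_inv ?M *v T) $ i"
      by (simp add: spray_coeff_def T_def matrix_vector_mult_def)
    then show ?thesis using G[of i] by simp
  qed
  then have "matrix_inv ?M *v T = (4 * P) *\<^sub>R v" by (simp add: vec_eq_iff)
  then have "?M *v (matrix_inv ?M *v T) = (4 * P) *\<^sub>R (?M *v v)" by (simp add: matrix_vector_mult_scaleR)
  then have MT: "T = (4 * P) *\<^sub>R (?M *v v)" using matrix_inv_right[OF inv]
    by (simp add: matrix_vector_mul_assoc)
  have \<beta>v: "(\<Sum>j\<in>UNIV. v $ j * b u $ j) = b u \<bullet> v" by (simp add: inner_vec_def mult.commute)
  \<comment> \<open>This contraction and the next two express homogeneity in \<open>v\<close>: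
    \<open>L\<close> has degree 2, its logarithmic derivatives \<open>l\<close> have degree -1 and
    \<open>R\<close> has degree 0.\<close>
  have lv: "(\<Sum>j\<in>UNIV. v $ j * l j u v) = 2"
  proof -
    have "(\<Sum>j\<in>UNIV. v $ j * l j u v) = 4 / real m / A u v * (\<Sum>j\<in>UNIV. v $ j * partial j (A u) v)
        - 2 / (b u \<bullet> v) * (\<Sum>j\<in>UNIV. v $ j * b u $ j)"
      by (simp add: l_def right_diff_distrib sum_subtractf sum_distrib_left mult_ac)
    then show ?thesis unfolding euler_A \<beta>v using A m0 v by simp
  qed
  have llv: "(\<Sum>j\<in>UNIV. v $ j * ll i j u v) = - l i u v" for i
  proof -
    have "(\<Sum>j\<in>UNIV. v $ j * ll i j u v) = 4 / real m / A u v * (\<Sum>j\<in>UNIV. v $ j * partial i (partial j (A u)) v)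
        - 4 / real m * partial i (A u) v / (A u v)\<^sup>2 * (\<Sum>j\<in>UNIV. v $ j * partial j (A u) v)
        + 2 * b u $ i / (b u \<bullet> v)\<^sup>2 * (\<Sum>j\<in>UNIV. v $ j * b u $ j)"
    proof -
      have "v $ j * ll i j u v = 4 / real m / A u v * (v $ j * partial i (partial j (A u)) v)
          - 4 / real m * partial i (A u) v / (A u v)\<^sup>2 * (v $ j * partial j (A u) v)
          + 2 * b u $ i / (b u \<bullet> v)\<^sup>2 * (v $ j * b u $ j)" for j
        by (simp add: ll_def algebra_simps)
      then show ?thesis by (simp only: sum.distrib sum_subtractf sum_distrib_left)
    qed
    then show ?thesis unfolding euler_A euler_dA' \<beta>v l_def using A m0 v
      by (simp add: field_simps power2_eq_square)
  qed
  have Rlv: "(\<Sum>i\<in>UNIV. v $ i * Rl i k u v) = 0" for k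
  proof -
    have "(\<Sum>i\<in>UNIV. v $ i * Rl i k u v) = 4 / real m / A u v * (\<Sum>i\<in>UNIV. v $ i * partial i (X k u) v)
        - 4 / real m * X k u v / (A u v)\<^sup>2 * (\<Sum>i\<in>UNIV. v $ i * partial i (A u) v)
        - 2 / (b u \<bullet> v) * (\<Sum>i\<in>UNIV. v $ i * B k u $ i)
        + 2 * (B k u \<bullet> v) / (b u \<bullet> v)\<^sup>2 * (\<Sum>i\<in>UNIV. v $ i * b u $ i)"
    proof -
      have "v $ i * Rl i k u v = 4 / real m / A u v * (v $ i * partial i (X k u) v)
          - 4 / real m * X k u v / (A u v)\<^sup>2 * (v $ i * partial i (A u) v)
          - 2 / (b u \<bullet> v) * (v $ i * B k u $ i)
          + 2 * (B k u \<bullet> v) / (b u \<bullet> v)\<^sup>2 * (v $ i * b u $ i)" for i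
        by (simp add: Rl_def algebra_simps)
      then show ?thesis by (simp only: sum.distrib sum_subtractf sum_distrib_left)
    qed
    moreover have "(\<Sum>i\<in>UNIV. v $ i * B k u $ i) = B k u \<bullet> v" by (simp add: inner_vec_def mult.commute)
    ultimately show ?thesis unfolding euler_A euler_X \<beta>v using A m0 v
      by (simp add: field_simps power2_eq_square)
  qed
  have Mv: "(?M *v v) $ i = L u v / 2 * l i u v" for i
  proof -
    have "(?M *v v) $ i = (\<Sum>j\<in>UNIV. 1/2 * (L u v * (l i u v * l j u v + ll i j u v)) * v $ j)"
      using partial_L_vv[OF u v] by (simp add: fundamental_tensor_def L_def[abs_def] matrix_vector_mult_def)
    also have "\<dots> = L u v / 2 * (l i u v * (\<Sum>j\<in>UNIV. v $ j * l j u v) + (\<Sum>j\<in>UNIV. v $ j * ll i j u v))"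
      by (simp add: sum_distrib_left sum.distrib algebra_simps)
    finally show ?thesis unfolding lv llv by simp
  qed
  have eq: "l i u v * l0 + (\<Sum>k\<in>UNIV. v $ k * Rl i k u v) - R i u v = 2 * P * l i u v" for i
  proof -
    have "L u v * (l i u v * l0 + (\<Sum>k\<in>UNIV. v $ k * Rl i k u v) - R i u v) = 4 * P * (L u v / 2 * l i u v)"
      unfolding T[symmetric] unfolding MT by (simp only: vector_scaleR_component Mv real_scaleR_def)
    also have "\<dots> = L u v * (2 * P * l i u v)" by simp
    finally show ?thesis using Lpos by (simp only: mult_left_cancel[OF less_imp_neq[symmetric, OF Lpos]])
  qed
  have "(\<Sum>i\<in>UNIV. v $ i * (l i u v * l0 + (\<Sum>k\<in>UNIV. v $ k * Rl i k u v) - R i u v)) = 4 * P"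
  proof -
    have "(\<Sum>i\<in>UNIV. v $ i * (2 * P * l i u v)) = 2 * P * (\<Sum>i\<in>UNIV. v $ i * l i u v)"
      by (simp add: sum_distrib_left mult_ac)
    then show ?thesis unfolding eq lv by simp
  qed
  moreover have "(\<Sum>i\<in>UNIV. v $ i * (l i u v * l0 + (\<Sum>k\<in>UNIV. v $ k * Rl i k u v) - R i u v))
      = (\<Sum>i\<in>UNIV. v $ i * l i u v) * l0 + (\<Sum>k\<in>UNIV. v $ k * (\<Sum>i\<in>UNIV. v $ i * Rl i k u v)) - l0"
  proof -
    have "(\<Sum>i\<in>UNIV. v $ i * (\<Sum>k\<in>UNIV. v $ k * Rl i k u v)) = (\<Sum>k\<in>UNIV. v $ k * (\<Sum>i\<in>UNIV. v $ i * Rl i k u v))"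
      unfolding sum_distrib_left by (subst sum.swap) (simp add: mult.left_commute)
    moreover have "(\<Sum>i\<in>UNIV. v $ i * (l i u v * l0 + (\<Sum>k\<in>UNIV. v $ k * Rl i k u v) - R i u v))
        = (\<Sum>i\<in>UNIV. v $ i * l i u v) * l0 + (\<Sum>i\<in>UNIV. v $ i * (\<Sum>k\<in>UNIV. v $ k * Rl i k u v)) - (\<Sum>i\<in>UNIV. v $ i * R i u v)"
      by (simp only: distrib_left right_diff_distrib sum.distrib sum_subtractf sum_distrib_right mult.assoc)
    ultimately show ?thesis by (simp add: l0_def)
  qed
  ultimately have "l0 = 4 * P" unfolding lv Rlv by simp
  then show ?thesis using eq[of j] unfolding l0_def[symmetric] by (simp add: algebra_simps)
qed

end

section \<open>Projectively flat Kropina metrics in coordinates\<close>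

text \<open>The squared norm of \<open>f\<close>, damped by \<open>exp (- C * t)\<close>, does not
  increase along the segment from \<open>x\<close> to \<open>y\<close>. The estimate asks for an
  inequality on the derivative, so it accepts coefficients that are bounded but not known to be
  continuous.\<close>

lemma gronwall_zero:
  fixes f :: "'a::real_normed_vector \<Rightarrow> 'b::real_inner"
  assumes S: "convex S" "x \<in> S" "y \<in> S" and f: "\<And>z. z \<in> S \<Longrightarrow> (f has_derivative f' z) (at z)"
    and K: "\<And>z h. z \<in> S \<Longrightarrow> f z \<bullet> f' z h \<le> K * norm h * (f z \<bullet> f z)" and x: "f x = 0"
  shows "f y = 0"
proof -
  define \<gamma> where "\<gamma> t = x + t *\<^sub>R (y - x)" for t
  define C where "C = 2 * K * norm (y - x)"
  define g where "g t = f (\<gamma> t) \<bullet> f (\<gamma> t)" for t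
  have \<gamma>: "\<gamma> t \<in> S" if "0 \<le> t" "t \<le> 1" for t
  proof -
    have "\<gamma> t = (1 - t) *\<^sub>R x + t *\<^sub>R y" by (simp add: \<gamma>_def algebra_simps)
    then show ?thesis using convexD_alt[OF S that] by simp
  qed
  have "exp (- C * 1) * g 1 \<le> exp (- C * 0) * g 0"
  proof (rule DERIV_nonpos_imp_nonincreasing[where f = "\<lambda>t. exp (- C * t) * g t"])
    fix t :: real assume t: "0 \<le> t" "t \<le> 1"
    let ?d = "f' (\<gamma> t) (y - x)"
    have "((\<lambda>t. f (\<gamma> t)) has_derivative (\<lambda>s. f' (\<gamma> t) (s *\<^sub>R (y - x)))) (at t)"
      unfolding \<gamma>_def by (rule has_derivative_along_line) (use f[OF \<gamma>[OF t]] in \<open>simp add: \<gamma>_def\<close>)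
    moreover have "f' (\<gamma> t) (s *\<^sub>R (y - x)) = s *\<^sub>R ?d" for s
      by (rule linear_cmul[OF has_derivative_linear[OF f[OF \<gamma>[OF t]]]])
    ultimately have "((\<lambda>t. f (\<gamma> t)) has_derivative (\<lambda>s. s *\<^sub>R ?d)) (at t)" by simp
    from has_derivative_inner[OF this this]
    have "(g has_derivative (\<lambda>s. s * (2 * (f (\<gamma> t) \<bullet> ?d)))) (at t)"
      unfolding g_def by (rule has_derivative_eq_rhs) (auto simp: inner_commute algebra_simps)
    then have "(g has_real_derivative 2 * (f (\<gamma> t) \<bullet> ?d)) (at t)"
      by (simp add: has_field_derivative_def mult_commute_abs)
    then have "((\<lambda>t. exp (- C * t) * g t) has_real_derivative
        exp (- C * t) * (2 * (f (\<gamma> t) \<bullet> ?d) - C * g t)) (at t)"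
      by (auto intro!: derivative_eq_intros simp: algebra_simps)
    moreover have "2 * (f (\<gamma> t) \<bullet> ?d) - C * g t \<le> 0"
      using K[OF \<gamma>[OF t], of "y - x"] by (simp add: C_def g_def)
    ultimately show "\<exists>z. ((\<lambda>t. exp (- C * t) * g t) has_real_derivative z) (at t) \<and> z \<le> 0"
      by (metis exp_ge_zero mult_nonneg_nonpos)
  qed simp
  then have "g 1 \<le> 0" using x by (simp add: g_def \<gamma>_def mult_le_0_iff)
  then have "f y \<bullet> f y \<le> 0" by (simp add: g_def \<gamma>_def)
  then have "f y \<bullet> f y = 0" using inner_ge_zero[of "f y"] by linarith
  then show ?thesis by simp
qed

lemma smooth_on_rpf:
  fixes f :: "real^'n::finite \<Rightarrow> real"
  assumes "real_polynomial_function f"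
  shows "smooth_on UNIV f"
proof -
  have "Ck_on k UNIV f" for k
    using assms
  proof (induction k arbitrary: f)
    case 0
    then show ?case using rpf_isCont by (auto simp: continuous_on_eq_continuous_at)
  next
    case (Suc k)
    have "Ck_on k UNIV (\<lambda>x. \<Sum>i\<in>UNIV. v $ i * partial i f x)" for v
      by (intro Suc.IH real_polynomial_function_sum rpf_mult rpf_const rpf_partial(1) Suc.prems) auto
    then show ?case by (rule Ck_on_SucI[OF open_UNIV rpf_partial(2)[OF Suc.prems]])
  qed
  then show ?thesis by (simp add: smooth_on_def)
qed

lemma partial_commute_rpf: "real_polynomial_function f \<Longrightarrow> partial i (partial j f) v = partial j (partial i f) v"
  using partial_commute[OF open_UNIV _ smooth_on_rpf] by blast

lemma partial_form:
  "partial i (form m c) v = (\<Sum>is | length is = m. c is * partial i (\<lambda>v. prod_list (map (\<lambda>i. v $ i) is)) v)"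
proof -
  let ?\<mu> = "\<lambda>is v. prod_list (map (\<lambda>i. v $ i) is)"
  have "(form m c has_derivative (\<lambda>h. \<Sum>is | length is = m. c is * (\<Sum>i\<in>UNIV. h $ i * partial i (?\<mu> is) v))) (at v)"
    unfolding form_def[abs_def] by (intro has_derivative_sum has_derivative_mult_right rpf_partial(2) rpf_prod_list)
  from partial_eq[OF this, of i] show ?thesis by (simp add: sum_axis_mult)
qed

context irreducible_form_point
begin

text \<open>The left-hand side of the hypothesis is the skew part of a mixed second derivative.\<close>

lemma integrability_point:
  assumes "\<And>k l v. (\<Sum>j\<in>UNIV. e k j * v $ j) * partial l A v - (\<Sum>j\<in>UNIV. e l j * v $ j) * partial k A v + C k l * A v = 0"
  shows "e k l = - e l k" "C k l = real m * e l k"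
proof -
  define E where "E k v = (\<Sum>j\<in>UNIV. e k j * v $ j)" for k v
  define E0 where "E0 v = (\<Sum>k\<in>UNIV. v $ k * E k v)" for v
  have rE: "real_polynomial_function (E k)" for k unfolding E_def[abs_def]
    by (intro real_polynomial_function_sum rpf_mult rpf_const rpf_coord) auto
  have rE0: "real_polynomial_function E0" unfolding E0_def[abs_def]
    by (intro real_polynomial_function_sum rpf_mult rpf_coord rE) auto
  \<comment> \<open>Contraction of the hypothesis with \<open>v $ k\<close>; Euler's identity turns
    the derivative of \<open>A\<close> in direction \<open>k\<close> into a multiple of
    \<open>A\<close>.\<close>
  have eq: "partial l A v * E0 v = A v * (real m * E l v - (\<Sum>k\<in>UNIV. v $ k * C k l))" for l v
  proof -
    have "(\<Sum>k\<in>UNIV. v $ k * (E k v * partial l A v - E l v * partial k A v + C k l * A v)) = 0"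
      using assms by (simp add: E_def)
    moreover have "(\<Sum>k\<in>UNIV. v $ k * (E k v * partial l A v - E l v * partial k A v + C k l * A v))
        = partial l A v * E0 v - E l v * (\<Sum>k\<in>UNIV. v $ k * partial k A v) + A v * (\<Sum>k\<in>UNIV. v $ k * C k l)"
      by (simp add: E0_def algebra_simps sum.distrib sum_subtractf sum_distrib_left)
    ultimately show ?thesis unfolding euler_identity[OF rpfA homA] by (simp add: algebra_simps)
  qed
  have "dvdA E0"
  proof (rule dvdA_cancel_partial[OF rE0])
    fix l
    have "real_polynomial_function (\<lambda>v. real m * E l v - (\<Sum>k\<in>UNIV. v $ k * C k l))"
      by (intro real_polynomial_function_diff real_polynomial_function_sum rpf_mult rpf_const rpf_coord rE) auto
    then show "dvdA (\<lambda>v. partial l A v * E0 v)" using eq unfolding dvdA_def by blast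
  qed
  \<comment> \<open>Degree 2 lies below \<open>m\<close>, so divisibility by \<open>A\<close> makes
    the quadratic form \<open>E0\<close> zero; polarization then gives that \<open>e\<close> is
    skew.\<close>
  moreover have "homogeneous 2 E0"
    by (simp add: homogeneous_def E0_def E_def sum_distrib_left power2_eq_square mult_ac)
  ultimately have E0: "E0 v = 0" if "v \<noteq> 0" for v
    using dvdA_low_degree[of 2 E0 v] m that by simp
  have E0': "E0 v = 0" for v using E0 by (cases "v = 0") (auto simp: E0_def)
  have E_axis: "E k (axis j 1) = e k j" for k j
    using sum_axis_mult[of j "e k"] by (simp add: E_def mult.commute)
  have E0_axis: "E0 (axis j 1) = e j j" for j
    using sum_axis_mult[of j "\<lambda>k. E k (axis j 1)"] by (simp add: E0_def E_axis)
  have E_add: "E k (v + w) = E k v + E k w" for k v w by (simp add: E_def distrib_left sum.distrib)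
  have "E0 (axis k 1 + axis l 1) = e k k + e k l + e l k + e l l"
    using sum_axis_mult[of k "\<lambda>i. E i (axis k 1 + axis l 1)"] sum_axis_mult[of l "\<lambda>i. E i (axis k 1 + axis l 1)"]
    by (simp add: E0_def distrib_right sum.distrib E_add E_axis)
  then show "e k l = - e l k" using E0'[of "axis k 1 + axis l 1"] E0_axis[of k] E0_axis[of l] E0' by simp
  have ne: "axis k (1::real) \<noteq> 0" by (simp add: axis_eq_0_iff)
  have "real m * E l (axis k 1) - (\<Sum>i\<in>UNIV. axis k 1 $ i * C i l) = 0"
    using eq[of l "axis k 1"] E0' posA[OF ne] by simp
  then show "C k l = real m * e l k" using sum_axis_mult[of k "\<lambda>i. C i l"] by (simp add: E_axis)
qed

end

lemma unit_orthogonal_exists: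
  assumes "CARD('n::finite) \<ge> 2"
  shows "\<exists>v::real^'n. norm v = 1 \<and> p \<bullet> v = 0"
proof -
  obtain y :: "real^'n" where "y \<noteq> 0" "orthogonal p y"
    using orthogonal_to_vector_exists[of p] assms by auto
  then show ?thesis by (intro exI[of _ "y /\<^sub>R norm y"]) (simp add: orthogonal_def)
qed

section \<open>The fields \<open>p\<close>, \<open>q\<close>, \<open>d\<close> and the zeros of
  \<open>b\<close>\<close>

locale kropina_flat = kropina_coords W m c b
  for W :: "(real^'n::finite) set" and m c b +
  fixes P :: "real^'n \<Rightarrow> real^'n \<Rightarrow> real"
  assumes flat: "\<And>u v i. u \<in> W \<Longrightarrow> b u \<bullet> v \<noteq> 0 \<Longrightarrow>
    spray_coeff (kropina_change (mth_root m c) (one_form b)) u v i = P u v * v $ i"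
begin

text \<open>The three covectors are chosen as one triple, since the relations couple them. Existence
  is established where \<open>b u\<close> is nonzero; elsewhere the choice carries no
  information.\<close>

definition pqd :: "real^'n \<Rightarrow> (real^'n) \<times> (real^'n) \<times> (real^'n) \<Rightarrow> bool" where
  "pqd u = (\<lambda>(p, q, d). \<forall>l. (\<forall>v. X l u v = (p \<bullet> v) * partial l (A u) v + q $ l * A u v) \<and>
    B l u = b u $ l *\<^sub>R p + d $ l *\<^sub>R b u \<and> p $ l = 2 / real m * q $ l - d $ l)"

definition p :: "real^'n \<Rightarrow> real^'n" where "p u = fst (SOME t. pqd u t)"
definition q :: "real^'n \<Rightarrow> real^'n" where "q u = fst (snd (SOME t. pqd u t))"
definition d :: "real^'n \<Rightarrow> real^'n" where "d u = snd (snd (SOME t. pqd u t))"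

lemma pqd_exists:
  assumes u: "u \<in> W" and b: "b u \<noteq> 0"
  shows "\<exists>t. pqd u t"
proof -
  interpret pt: irreducible_form_point m "A u" by (rule point[OF u])
  have "\<exists>p q d. \<forall>l. (\<forall>v. X l u v = (p \<bullet> v) * partial l (A u) v + q $ l * A u v) \<and>
    B l u = b u $ l *\<^sub>R p + d $ l *\<^sub>R b u \<and> p $ l = 2 / real m * q $ l - d $ l"
  proof (rule pt.projectively_flat_point[where X = "\<lambda>k. X k u" and B = "\<lambda>k. B k u", OF rpfX homX b])
    fix i v assume v: "b u \<bullet> v \<noteq> 0"
    have R: "(\<Sum>k\<in>UNIV. v $ k * R k u v) = 4 / real m * (\<Sum>k\<in>UNIV. v $ k * X k u v) / A u v
        - 2 * (\<Sum>k\<in>UNIV. v $ k * (B k u \<bullet> v)) / (b u \<bullet> v)"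
    proof -
      have "v $ k * R k u v = 4 / real m / A u v * (v $ k * X k u v) - 2 / (b u \<bullet> v) * (v $ k * (B k u \<bullet> v))" for k
        by (simp add: R_def algebra_simps)
      then have "(\<Sum>k\<in>UNIV. v $ k * R k u v) = 4 / real m / A u v * (\<Sum>k\<in>UNIV. v $ k * X k u v)
          - 2 / (b u \<bullet> v) * (\<Sum>k\<in>UNIV. v $ k * (B k u \<bullet> v))"
        by (simp only: sum_subtractf sum_distrib_left)
      then show ?thesis by simp
    qed
    have Rl: "(\<Sum>k\<in>UNIV. v $ k * Rl i k u v)
        = 4 / real m * ((\<Sum>k\<in>UNIV. v $ k * partial i (X k u) v) / A u v
            - (\<Sum>k\<in>UNIV. v $ k * X k u v) * partial i (A u) v / (A u v)\<^sup>2)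
         - 2 * ((\<Sum>k\<in>UNIV. v $ k * B k u $ i) / (b u \<bullet> v) - (\<Sum>k\<in>UNIV. v $ k * (B k u \<bullet> v)) * b u $ i / (b u \<bullet> v)\<^sup>2)"
    proof -
      have "v $ k * Rl i k u v = 4 / real m / A u v * (v $ k * partial i (X k u) v)
          - 4 / real m * partial i (A u) v / (A u v)\<^sup>2 * (v $ k * X k u v)
          - 2 / (b u \<bullet> v) * (v $ k * B k u $ i)
          + 2 * b u $ i / (b u \<bullet> v)\<^sup>2 * (v $ k * (B k u \<bullet> v))" for k
        by (simp add: Rl_def algebra_simps)
      then have "(\<Sum>k\<in>UNIV. v $ k * Rl i k u v) = 4 / real m / A u v * (\<Sum>k\<in>UNIV. v $ k * partial i (X k u) v)
          - 4 / real m * partial i (A u) v / (A u v)\<^sup>2 * (\<Sum>k\<in>UNIV. v $ k * X k u v)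
          - 2 / (b u \<bullet> v) * (\<Sum>k\<in>UNIV. v $ k * B k u $ i)
          + 2 * b u $ i / (b u \<bullet> v)\<^sup>2 * (\<Sum>k\<in>UNIV. v $ k * (B k u \<bullet> v))"
        by (simp only: sum.distrib sum_subtractf sum_distrib_left)
      then show ?thesis by (simp add: algebra_simps)
    qed
    show "1/2 * (4 / real m * partial i (A u) v / A u v - 2 * b u $ i / (b u \<bullet> v))
          * (4 / real m * (\<Sum>k\<in>UNIV. v $ k * X k u v) / A u v - 2 * (\<Sum>k\<in>UNIV. v $ k * (B k u \<bullet> v)) / (b u \<bullet> v))
      + (4 / real m * ((\<Sum>k\<in>UNIV. v $ k * partial i (X k u) v) / A u v
            - (\<Sum>k\<in>UNIV. v $ k * X k u v) * partial i (A u) v / (A u v)\<^sup>2)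
         - 2 * ((\<Sum>k\<in>UNIV. v $ k * B k u $ i) / (b u \<bullet> v) - (\<Sum>k\<in>UNIV. v $ k * (B k u \<bullet> v)) * b u $ i / (b u \<bullet> v)\<^sup>2))
      - (4 / real m * X i u v / A u v - 2 * (B i u \<bullet> v) / (b u \<bullet> v)) = 0"
      using projectively_flat_equation[OF u v flat[OF u v], of i] unfolding R Rl unfolding l_def R_def .
  qed
  then show ?thesis unfolding pqd_def by auto
qed

lemma
  assumes u: "u \<in> W" and b: "b u \<noteq> 0"
  shows X_eq: "X i u v = (p u \<bullet> v) * partial i (A u) v + q u $ i * A u v"
    and B_eq: "B i u = b u $ i *\<^sub>R p u + d u $ i *\<^sub>R b u"
    and p_eq: "p u $ i = 2 / real m * q u $ i - d u $ i"
proof -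
  have *: "pqd u (p u, q u, d u)" using someI_ex[OF pqd_exists[OF u b]] by (simp add: p_def q_def d_def)
  then show "X i u v = (p u \<bullet> v) * partial i (A u) v + q u $ i * A u v"
    "B i u = b u $ i *\<^sub>R p u + d u $ i *\<^sub>R b u" "p u $ i = 2 / real m * q u $ i - d u $ i"
    unfolding pqd_def by auto
qed

lemma p_inner_eq: "u \<in> W \<Longrightarrow> b u \<noteq> 0 \<Longrightarrow> p u \<bullet> v = 2 / real m * (q u \<bullet> v) - d u \<bullet> v"
  using p_eq[of u] by (simp add: inner_vec_def left_diff_distrib sum_subtractf sum_distrib_left mult.assoc)

lemma X_sum_eq:
  assumes "u \<in> W" "b u \<noteq> 0"
  shows "(\<Sum>k\<in>UNIV. v $ k * X k u v) = (real m * (p u \<bullet> v) + q u \<bullet> v) * A u v"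
proof -
  have "(\<Sum>k\<in>UNIV. v $ k * X k u v) = (p u \<bullet> v) * (\<Sum>k\<in>UNIV. v $ k * partial k (A u) v) + (q u \<bullet> v) * A u v"
    by (simp add: X_eq[OF assms] inner_vec_def[of "q u"] algebra_simps sum.distrib sum_distrib_left)
  then show ?thesis unfolding euler_A by (simp add: algebra_simps)
qed

lemma B_sum_eq:
  assumes "u \<in> W" "b u \<noteq> 0"
  shows "(\<Sum>k\<in>UNIV. h $ k * (B k u \<bullet> v)) = (b u \<bullet> h) * (p u \<bullet> v) + (d u \<bullet> h) * (b u \<bullet> v)"
  by (simp add: B_eq[OF assms] inner_vec_def[of "b u" h] inner_vec_def[of "d u" h] inner_add_left algebra_simps
      sum.distrib sum_distrib_left)

lemma continuous_on_form_coeff: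
  fixes g :: "real^'n \<Rightarrow> 'n list \<Rightarrow> real"
  assumes "\<And>is. length is = m \<Longrightarrow> continuous_on S (\<lambda>u. g u is)"
  shows "continuous_on (S \<times> UNIV) (\<lambda>(u, v). form m (g u) v)"
proof -
  have "continuous_on (S \<times> UNIV) (\<lambda>x. \<Sum>is | length is = m. g (fst x) is * prod_list (map (\<lambda>i. snd x $ i) is))"
  proof (intro continuous_on_sum continuous_on_mult)
    fix "is" :: "'n list" assume "is \<in> {is. length is = m}"
    then show "continuous_on (S \<times> UNIV) (\<lambda>x. g (fst x) is)"
      using assms by (intro continuous_on_compose2[OF _ continuous_on_fst[OF continuous_on_id]]) auto
    show "continuous_on (S \<times> (UNIV :: (real^'n) set)) (\<lambda>x. prod_list (map (\<lambda>i. snd x $ i) is))"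
    proof (induction "is")
      case (Cons a "is")
      have "continuous_on (S \<times> (UNIV :: (real^'n) set)) (\<lambda>x. snd x $ a)"
        by (intro continuous_on_component continuous_on_snd continuous_on_id)
      from continuous_on_mult[OF this Cons] show ?case by simp
    qed simp
  qed
  then show ?thesis by (simp add: form_def case_prod_beta')
qed

text \<open>All bounds come from \<open>A\<close> and \<open>X\<close> on the unit sphere bundle
  over \<open>S\<close>, where \<open>A\<close> has a positive minimum \<open>\<delta>\<close>. The
  size of \<open>b u\<close> does not enter, so they persist near zeros of \<open>b\<close>. A unit
  vector orthogonal to \<open>p u\<close> isolates \<open>q u\<close>; the direction of
  \<open>p u\<close> itself then bounds \<open>p u\<close>.\<close>

lemma pd_bounded:
  assumes S: "compact S" "S \<subseteq> W"
  shows "\<exists>K. \<forall>u\<in>S. b u \<noteq> 0 \<longrightarrow> norm (p u) \<le> K \<and> norm (d u) \<le> K"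
proof (cases "S = {}")
  case False
  let ?T = "S \<times> sphere (0::real^'n) 1"
  have T: "compact ?T" using S by (intro compact_Times) auto
  have Tne: "?T \<noteq> {}" using False by simp
  have sub: "?T \<subseteq> W \<times> UNIV" using S by auto
  have cA: "continuous_on ?T (\<lambda>(u, v). A u v)"
    unfolding A_def by (rule continuous_on_subset[OF continuous_on_form_coeff sub])
      (use c_smooth smooth_on_continuous_on in auto)
  have cX: "continuous_on ?T (\<lambda>(u, v). X k u v)" for k
    unfolding X_def by (rule continuous_on_subset[OF continuous_on_form_coeff sub])
      (use c_smooth smooth_on_continuous_on smooth_on_partial in blast)
  obtain z where z: "z \<in> ?T" "\<And>y. y \<in> ?T \<Longrightarrow> (\<lambda>(u, v). A u v) z \<le> (\<lambda>(u, v). A u v) y"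
    using continuous_attains_inf[OF T Tne cA] by blast
  define \<delta> where "\<delta> = (\<lambda>(u, v). A u v) z"
  have \<delta>: "\<delta> > 0"
  proof -
    obtain u v where "z = (u, v)" "u \<in> S" "norm v = 1" using z(1) by auto
    moreover from this have "v \<noteq> 0" by auto
    ultimately show ?thesis using S posA by (auto simp: \<delta>_def)
  qed
  have A\<delta>: "A u v \<ge> \<delta>" if "u \<in> S" "norm v = 1" for u v
    using z(2)[of "(u, v)"] that by (simp add: \<delta>_def)
  have "\<exists>M. \<forall>y\<in>?T. norm ((\<lambda>(u, v). X k u v) y) \<le> M" for k
    using compact_imp_bounded[OF compact_continuous_image[OF cX T]] unfolding bounded_iff by auto
  then obtain M' where M': "\<And>k y. y \<in> ?T \<Longrightarrow> norm ((\<lambda>(u, v). X k u v) y) \<le> M' k" by metis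
  define M where "M = (\<Sum>k\<in>UNIV. \<bar>M' k\<bar>)"
  have XM: "\<bar>X k u v\<bar> \<le> M" if "u \<in> S" "norm v = 1" for k u v
  proof -
    have "\<bar>X k u v\<bar> \<le> \<bar>M' k\<bar>" using M'[of "(u, v)" k] that by simp
    also have "\<dots> \<le> M" unfolding M_def by (rule member_le_sum) auto
    finally show ?thesis .
  qed
  have M0: "M \<ge> 0" by (simp add: M_def sum_nonneg)
  define N where "N = real CARD('n) * (M / \<delta>)"
  have N0: "N \<ge> 0" using M0 \<delta> by (simp add: N_def)
  have "norm (p u) \<le> 2 * N \<and> norm (d u) \<le> 4 * N" if u: "u \<in> S" and bu: "b u \<noteq> 0" for u
  proof -
    have uW: "u \<in> W" using u S by blast
    have "CARD('n) \<ge> 2" using card_ge_2_if_irreducible_form[OF irr[OF uW]] m by simp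
    then obtain v where v: "norm v = 1" "p u \<bullet> v = 0" using unit_orthogonal_exists by blast
    have q: "\<bar>q u $ k\<bar> \<le> M / \<delta>" for k
    proof -
      have "X k u v = q u $ k * A u v" using X_eq[OF uW bu] v by simp
      then have "\<bar>q u $ k\<bar> * A u v \<le> M" using XM[OF u v(1), of k] A\<delta>[OF u v(1)] \<delta> by (simp add: abs_mult)
      moreover have "\<bar>q u $ k\<bar> * \<delta> \<le> \<bar>q u $ k\<bar> * A u v" using A\<delta>[OF u v(1)] by (intro mult_left_mono) auto
      ultimately show ?thesis using \<delta> by (simp add: field_simps)
    qed
    have nq: "norm (q u) \<le> N"
    proof -
      have "norm (q u) \<le> (\<Sum>k\<in>UNIV. \<bar>q u $ k\<bar>)" by (rule norm_le_l1_cart)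
      also have "\<dots> \<le> (\<Sum>k\<in>(UNIV::'n set). M / \<delta>)" by (intro sum_mono q)
      finally show ?thesis by (simp add: N_def)
    qed
    have np: "norm (p u) \<le> 2 * N"
    proof (cases "p u = 0")
      case False
      \<comment> \<open>In this direction the contracted derivative of \<open>A\<close> is
        \<open>(real m * norm (p u) + q u \<bullet> w) * A u w\<close> by
        \<open>X_sum_eq\<close>.\<close>
      define w where "w = p u /\<^sub>R norm (p u)"
      have w: "norm w = 1" "p u \<bullet> w = norm (p u)" using False by (auto simp: w_def power2_norm_eq_inner[symmetric] power2_eq_square)
      have Aw: "A u w \<ge> \<delta>" by (rule A\<delta>[OF u w(1)])
      have "\<bar>\<Sum>k\<in>UNIV. w $ k * X k u w\<bar> \<le> (\<Sum>k\<in>(UNIV::'n set). M)"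
      proof (rule sum_abs[THEN order_trans], rule sum_mono)
        fix k
        have "\<bar>w $ k\<bar> \<le> 1" using component_le_norm_cart[of w k] w by simp
        then show "\<bar>w $ k * X k u w\<bar> \<le> M"
          using XM[OF u w(1), of k] mult_mono[of "\<bar>w $ k\<bar>" 1 "\<bar>X k u w\<bar>" M] by (simp add: abs_mult)
      qed
      then have "\<bar>real m * norm (p u) + q u \<bullet> w\<bar> * A u w \<le> real CARD('n) * M"
        using X_sum_eq[OF uW bu, of w] w Aw \<delta> by (simp add: abs_mult)
      moreover have "\<bar>real m * norm (p u) + q u \<bullet> w\<bar> * \<delta> \<le> \<bar>real m * norm (p u) + q u \<bullet> w\<bar> * A u w"
        using Aw by (intro mult_left_mono) auto
      ultimately have "\<bar>real m * norm (p u) + q u \<bullet> w\<bar> \<le> N" using \<delta> by (simp add: N_def field_simps)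
      moreover have "\<bar>q u \<bullet> w\<bar> \<le> N" using Cauchy_Schwarz_ineq2[of "q u" w] w nq by simp
      ultimately have "real m * norm (p u) \<le> 2 * N" by linarith
      moreover have "1 * norm (p u) \<le> real m * norm (p u)" using m by (intro mult_right_mono) auto
      ultimately show ?thesis by linarith
    qed (use N0 in simp)
    have "d u = (2 / real m) *\<^sub>R q u - p u" using p_eq[OF uW bu] by (simp add: vec_eq_iff)
    then have "norm (d u) \<le> (2 / real m) * norm (q u) + norm (p u)"
      using norm_triangle_ineq4[of "(2 / real m) *\<^sub>R q u" "p u"] by simp
    moreover have "(2 / real m) * norm (q u) \<le> 1 * norm (q u)" using m by (intro mult_right_mono) auto
    ultimately show ?thesis using np nq N0 by simp
  qed
  then show ?thesis using N0 by (intro exI[of _ "4 * N"]) force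
qed simp

text \<open>The derivative of \<open>b\<close> is bounded by a constant times the norm of
  \<open>b\<close>, so the Gronwall estimate spreads a zero over \<open>S\<close>. Where
  \<open>b z = 0\<close> the required inequality is trivial, so the arbitrary values of
  \<open>p\<close> and \<open>d\<close> there do no harm.\<close>

lemma b_vanishing:
  assumes S: "compact S" "convex S" "S \<subseteq> W" "x \<in> S" "y \<in> S" and x: "b x = 0"
  shows "b y = 0"
proof -
  obtain K where K: "\<And>u. u \<in> S \<Longrightarrow> b u \<noteq> 0 \<Longrightarrow> norm (p u) \<le> K \<and> norm (d u) \<le> K" using pd_bounded[OF S(1,3)] by blast
  show ?thesis
  proof (rule gronwall_zero[where f = b and S = S and x = x and f' = "\<lambda>z h. \<Sum>k\<in>UNIV. h $ k *\<^sub>R B k z" and K = "2 * K"])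
    fix z assume z: "z \<in> S"
    then have zW: "z \<in> W" using S by blast
    show "(b has_derivative (\<lambda>h. \<Sum>k\<in>UNIV. h $ k *\<^sub>R B k z)) (at z)" by (rule b_has_derivative[OF zW])
    fix h
    show "b z \<bullet> (\<Sum>k\<in>UNIV. h $ k *\<^sub>R B k z) \<le> (2 * K) * norm h * (b z \<bullet> b z)"
    proof (cases "b z = 0")
      case False
      have "b z \<bullet> (\<Sum>k\<in>UNIV. h $ k *\<^sub>R B k z) = (\<Sum>k\<in>UNIV. h $ k * (B k z \<bullet> b z))"
        by (simp add: inner_sum_right inner_commute)
      also have "\<dots> = (b z \<bullet> h) * (p z \<bullet> b z) + (d z \<bullet> h) * (b z \<bullet> b z)" by (rule B_sum_eq[OF zW False])
      also have "\<dots> \<le> norm (b z) * norm h * (K * norm (b z)) + K * norm h * (norm (b z) * norm (b z))"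
      proof (rule add_mono)
        have "(b z \<bullet> h) * (p z \<bullet> b z) \<le> \<bar>b z \<bullet> h\<bar> * \<bar>p z \<bullet> b z\<bar>" by (metis abs_ge_self abs_mult)
        also have "\<dots> \<le> (norm (b z) * norm h) * (norm (p z) * norm (b z))"
          by (intro mult_mono Cauchy_Schwarz_ineq2) auto
        also have "\<dots> \<le> (norm (b z) * norm h) * (K * norm (b z))"
          using K[OF z False] by (intro mult_left_mono mult_right_mono) auto
        finally show "(b z \<bullet> h) * (p z \<bullet> b z) \<le> norm (b z) * norm h * (K * norm (b z))" .
        have "d z \<bullet> h \<le> norm (d z) * norm h" by (rule norm_cauchy_schwarz)
        also have "\<dots> \<le> K * norm h" using K[OF z False] by (intro mult_right_mono) auto
        finally have "(d z \<bullet> h) * (b z \<bullet> b z) \<le> K * norm h * (b z \<bullet> b z)" by (intro mult_right_mono) auto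
        then show "(d z \<bullet> h) * (b z \<bullet> b z) \<le> K * norm h * (norm (b z) * norm (b z))"
          by (simp add: dot_square_norm power2_eq_square)
      qed
      also have "\<dots> = (2 * K) * norm h * (b z \<bullet> b z)" by (simp add: dot_square_norm power2_eq_square)
      finally show ?thesis .
    qed simp
  qed (use S x in auto)
qed

end

section \<open>Regularity of the fields and the Riccati equation\<close>

context kropina_flat
begin

definition support :: "(real^'n) set" where "support = {u \<in> W. b u \<noteq> 0}"

lemma supportD: "u \<in> support \<Longrightarrow> u \<in> W" "u \<in> support \<Longrightarrow> b u \<noteq> 0"
  by (auto simp: support_def)

lemma open_preimage_b:
  assumes "open T"
  shows "open {u \<in> W. b u \<in> T}"
proof -
  have "open (W \<inter> b -` T)"
    using continuous_on_open_vimage[OF W, of b] smooth_on_continuous_on[OF b_smooth] assms by (auto simp: Int_commute)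
  then show ?thesis by (simp add: vimage_def Int_def)
qed

lemma open_support: "open support"
  using open_preimage_b[of "- {0}"] by (simp add: support_def open_Compl)

lemma smooth_coeff_partial: "length is = m \<Longrightarrow> smooth_on W (partial k (\<lambda>u. c u is))"
  by (intro smooth_on_partial c_smooth)

lemma X_has_derivative:
  assumes u: "u \<in> W"
  shows "((\<lambda>u. X i u v) has_derivative (\<lambda>h. \<Sum>k\<in>UNIV. h $ k *
    form m (\<lambda>is. partial k (partial i (\<lambda>u. c u is)) u) v)) (at u)"
proof -
  let ?\<mu> = "\<lambda>is. prod_list (map (\<lambda>i. v $ i) is)"
  have "((\<lambda>u. \<Sum>is | length is = m. partial i (\<lambda>u. c u is) u * ?\<mu> is) has_derivative
    (\<lambda>h. \<Sum>is | length is = m. (\<Sum>k\<in>UNIV. h $ k * partial k (partial i (\<lambda>u. c u is)) u) * ?\<mu> is)) (at u)"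
    by (intro has_derivative_sum has_derivative_mult_left smooth_on_has_derivative_partial[OF _ u])
      (auto intro: smooth_coeff_partial)
  then show ?thesis unfolding X_def form_def
    by (rule has_derivative_eq_rhs)
      (simp add: fun_eq_iff sum_distrib_left sum_distrib_right mult_ac sum.swap[of _ UNIV])
qed

lemma X_partial_commute:
  "u \<in> W \<Longrightarrow> partial k (\<lambda>u. X i u v) u = partial i (\<lambda>u. X k u v) u"
proof -
  assume u: "u \<in> W"
  have "partial k (\<lambda>u. X i u v) u = form m (\<lambda>is. partial k (partial i (\<lambda>u. c u is)) u) v" for i k
    using partial_eq[OF X_has_derivative[OF u, where i = i and v = v], of k] by (simp add: sum_axis_mult)
  then show ?thesis using partial_commute[OF W u c_smooth] by (simp add: form_def)
qed

text \<open>Base derivatives act on the coefficients and fibre derivatives on the monomials, so they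
  are interchanged term by term.\<close>

lemma dA_has_derivative:
  assumes u: "u \<in> W"
  shows "((\<lambda>u. partial i (A u) v) has_derivative (\<lambda>h. \<Sum>k\<in>UNIV. h $ k * partial i (X k u) v)) (at u)"
  unfolding A_def X_def partial_form by (rule has_derivative_coeff_sum[OF u])

lemma b_component_smooth: "smooth_on W (\<lambda>u. b u $ j)"
  by (rule smooth_on_bounded_linear_comp[OF W bounded_linear_vec_nth b_smooth])

lemma partial_b: "u \<in> W \<Longrightarrow> partial k (\<lambda>u. b u $ j) u = B k u $ j"
  using partial_eq[OF bounded_linear.has_derivative[OF bounded_linear_vec_nth b_has_derivative], of u k j]
    sum_axis_mult[of k "\<lambda>k. B k u $ j"] by simp

lemma B_differentiable: "u \<in> W \<Longrightarrow> (\<lambda>u. B k u) differentiable (at u)"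
  using smooth_on_has_derivative[OF smooth_on_frechet_derivative[OF b_smooth, of "axis k 1"]]
  unfolding B_def[abs_def] differentiable_def by blast

lemma B_partial_commute:
  assumes u: "u \<in> W"
  shows "partial k (\<lambda>u. B i u $ j) u = partial i (\<lambda>u. B k u $ j) u"
proof -
  have *: "partial k (\<lambda>u. B i u $ j) u = partial k (partial i (\<lambda>u. b u $ j)) u" for k i
  proof -
    have "(partial i (\<lambda>u. b u $ j) has_derivative
        (\<lambda>h. \<Sum>k\<in>UNIV. h $ k * partial k (partial i (\<lambda>u. b u $ j)) u)) (at u)"
      by (rule smooth_on_has_derivative_partial[OF smooth_on_partial[OF b_component_smooth] u])
    from partial_cong_open[OF W u _ this, of "\<lambda>u. B i u $ j" k] partial_b show ?thesis
      by (simp add: sum_axis_mult)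
  qed
  show ?thesis unfolding * by (rule partial_commute[OF W u b_component_smooth])
qed

text \<open>The contracted derivatives of \<open>A\<close> and \<open>b u \<bullet> v\<close>,
  divided by these functions, are \<open>m p + q\<close> and \<open>p + d\<close> evaluated at
  \<open>v\<close>. With \<open>p = (2/m) q - d\<close> this expresses
  \<open>p u \<bullet> v\<close> through differentiable data, independently of how the triple was
  chosen.\<close>

lemma p_inner_differentiable:
  assumes u: "u \<in> support" and v: "b u \<bullet> v \<noteq> 0"
  shows "(\<lambda>u. p u \<bullet> v) differentiable (at u)"
proof -
  note uW = supportD(1)[OF u]
  let ?g = "\<lambda>u. 1/2 * (2 / real m * (\<Sum>k\<in>UNIV. v $ k * X k u v) / A u v - (\<Sum>k\<in>UNIV. v $ k * (B k u \<bullet> v)) / (b u \<bullet> v))"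
  have "v \<noteq> 0" using v by auto
  then have Av: "A u v \<noteq> 0" if "u \<in> W" for u using posA[OF that] by force
  have dX: "(\<lambda>u. X k u v) differentiable (at u)" for k using X_has_derivative[OF uW] unfolding differentiable_def by blast
  have dB: "(\<lambda>u. B k u \<bullet> v) differentiable (at u)" for k
    by (intro differentiable_inner B_differentiable[OF uW] differentiable_const)
  have db: "(\<lambda>u. b u \<bullet> v) differentiable (at u)" using \<beta>_has_derivative[OF uW] unfolding differentiable_def by blast
  have dA: "(\<lambda>u. A u v) differentiable (at u)" using A_has_derivative[OF uW] unfolding differentiable_def by blast
  have "?g differentiable (at u)"
    by (intro differentiable_mult differentiable_diff differentiable_divide differentiable_sum differentiable_const
        dX dA db dB ballI finite) (use Av[OF uW] v in auto)
  then obtain g' where g': "(?g has_derivative g') (at u)" unfolding differentiable_def by blast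
  have op: "open {u \<in> W. b u \<in> {w. w \<bullet> v \<noteq> 0}}"
  proof (rule open_preimage_b)
    have "open {w. w \<bullet> v \<in> - {0}}"
      by (intro open_vimage[unfolded vimage_def] open_Compl closed_singleton continuous_intros)
    then show "open {w. w \<bullet> v \<noteq> 0}" by simp
  qed
  have eq: "?g u = p u \<bullet> v" if u: "u \<in> W" "b u \<bullet> v \<noteq> 0" for u
  proof -
    have b: "b u \<noteq> 0" using u by auto
    have "?g u = 1/2 * (2 / real m * (real m * (p u \<bullet> v) + q u \<bullet> v) - (p u \<bullet> v + d u \<bullet> v))"
      unfolding X_sum_eq[OF u(1) b] B_sum_eq[OF u(1) b] using Av[OF u(1)] u(2) by (simp add: add_divide_distrib)
    also have "\<dots> = 1/2 * (2 * (p u \<bullet> v) + (2 / real m * (q u \<bullet> v) - d u \<bullet> v) - p u \<bullet> v)"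
      using m0 by (simp add: field_simps)
    finally show ?thesis unfolding p_inner_eq[OF u(1) b, symmetric] by simp
  qed
  have "((\<lambda>u. p u \<bullet> v) has_derivative g') (at u)"
    by (rule has_derivative_transform_within_open[OF g' op]) (use uW v eq in auto)
  then show ?thesis unfolding differentiable_def by blast
qed

lemma p_component_differentiable:
  assumes u: "u \<in> support"
  shows "(\<lambda>u. p u $ k) differentiable (at u)"
proof (cases "b u $ k = 0")
  case False
  then show ?thesis using p_inner_differentiable[OF u, of "axis k 1"] by (simp add: inner_axis)
next
  case True
  obtain j where j: "b u $ j \<noteq> 0" using supportD(2)[OF u] by (auto simp: vec_eq_iff)
  \<comment> \<open>An axis that lies in the kernel of \<open>b u\<close> is a difference of two
    vectors outside it.\<close>
  have "(\<lambda>u. p u \<bullet> (axis j 1 + axis k 1) - p u \<bullet> axis j 1) differentiable (at u)"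
    using True j by (intro differentiable_diff p_inner_differentiable[OF u]) (auto simp: inner_add_right inner_axis)
  then show ?thesis by (simp add: inner_add_right inner_axis)
qed

lemma q_component_differentiable:
  assumes u: "u \<in> support"
  shows "(\<lambda>u. q u $ k) differentiable (at u)"
proof -
  note uW = supportD(1)[OF u]
  define v :: "real^'n" where "v = axis k 1"
  have v: "v \<noteq> 0" by (simp add: v_def axis_eq_0_iff)
  have Av: "A u v \<noteq> 0" if "u \<in> W" for u using posA[OF that v] by force
  let ?g = "\<lambda>u. (X k u v - p u $ k * partial k (A u) v) / A u v"
  have "(\<lambda>u. X k u v) differentiable (at u)" "(\<lambda>u. A u v) differentiable (at u)"
    "(\<lambda>u. partial k (A u) v) differentiable (at u)"
    using X_has_derivative[OF uW] A_has_derivative[OF uW] dA_has_derivative[OF uW]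
    unfolding differentiable_def by blast+
  then have "?g differentiable (at u)"
    by (intro differentiable_mult differentiable_diff differentiable_divide p_component_differentiable[OF u] Av uW)
  then obtain g' where g': "(?g has_derivative g') (at u)" unfolding differentiable_def by blast
  have "((\<lambda>u. q u $ k) has_derivative g') (at u)"
    by (rule has_derivative_transform_within_open[OF g' open_support u])
      (use Av supportD X_eq[of _ k v] in \<open>auto simp: v_def inner_axis\<close>)
  then show ?thesis unfolding differentiable_def by blast
qed

lemma d_component_differentiable:
  assumes u: "u \<in> support"
  shows "(\<lambda>u. d u $ k) differentiable (at u)"
proof -
  have "(\<lambda>u. 2 / real m * q u $ k - p u $ k) differentiable (at u)"
    by (intro differentiable_mult differentiable_diff differentiable_const p_component_differentiable[OF u]
        q_component_differentiable[OF u])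
  then obtain g' where g': "((\<lambda>u. 2 / real m * q u $ k - p u $ k) has_derivative g') (at u)"
    unfolding differentiable_def by blast
  have "((\<lambda>u. d u $ k) has_derivative g') (at u)"
    by (rule has_derivative_transform_within_open[OF g' open_support u]) (use p_eq supportD in auto)
  then show ?thesis unfolding differentiable_def by blast
qed

lemma differentiable_has_derivative_partial:
  "f differentiable (at u) \<Longrightarrow> (f has_derivative (\<lambda>h. \<Sum>k\<in>UNIV. h $ k * partial k f u)) (at u)"
  for f :: "real^'n \<Rightarrow> real"
  using has_derivative_partial unfolding differentiable_def by blast

definition dp :: "'n \<Rightarrow> 'n \<Rightarrow> real^'n \<Rightarrow> real" where "dp k j u = partial k (\<lambda>u. p u $ j) u"
definition dq :: "'n \<Rightarrow> 'n \<Rightarrow> real^'n \<Rightarrow> real" where "dq k j u = partial k (\<lambda>u. q u $ j) u"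
definition dd :: "'n \<Rightarrow> 'n \<Rightarrow> real^'n \<Rightarrow> real" where "dd k j u = partial k (\<lambda>u. d u $ j) u"

lemma dp_has_derivative: "u \<in> support \<Longrightarrow> ((\<lambda>u. p u $ j) has_derivative (\<lambda>h. \<Sum>k\<in>UNIV. h $ k * dp k j u)) (at u)"
  unfolding dp_def by (intro differentiable_has_derivative_partial p_component_differentiable)
lemma dq_has_derivative: "u \<in> support \<Longrightarrow> ((\<lambda>u. q u $ j) has_derivative (\<lambda>h. \<Sum>k\<in>UNIV. h $ k * dq k j u)) (at u)"
  unfolding dq_def by (intro differentiable_has_derivative_partial q_component_differentiable)
lemma dd_has_derivative: "u \<in> support \<Longrightarrow> ((\<lambda>u. d u $ j) has_derivative (\<lambda>h. \<Sum>k\<in>UNIV. h $ k * dd k j u)) (at u)"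
  unfolding dd_def by (intro differentiable_has_derivative_partial d_component_differentiable)

text \<open>The formula for \<open>X\<close> is substituted back after differentiation. Second fibre
  derivatives of \<open>A\<close> then occur only with the coefficient
  \<open>(p u \<bullet> v)\<^sup>2\<close>, symmetrically in \<open>i\<close> and \<open>k\<close>,
  and drop out of the skew part.\<close>

lemma partial_X_u:
  assumes u: "u \<in> support"
  shows "partial k (\<lambda>u. X i u v) u = (\<Sum>j\<in>UNIV. dp k j u * v $ j) * partial i (A u) v
    + (p u \<bullet> v) * (p u $ i * partial k (A u) v + (p u \<bullet> v) * partial i (partial k (A u)) v + q u $ k * partial i (A u) v)
    + dq k i u * A u v + q u $ i * ((p u \<bullet> v) * partial k (A u) v + q u $ k * A u v)"
proof -
  note uW = supportD(1)[OF u] and bu = supportD(2)[OF u]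
  have pv: "((\<lambda>u. p u \<bullet> v) has_derivative (\<lambda>h. \<Sum>j\<in>UNIV. (\<Sum>k\<in>UNIV. h $ k * dp k j u) * v $ j)) (at u)"
    unfolding inner_vec_def inner_real_def
    by (intro has_derivative_sum has_derivative_mult_left dp_has_derivative u)
  have "((\<lambda>u. (p u \<bullet> v) * partial i (A u) v + q u $ i * A u v) has_derivative
      (\<lambda>h. ((p u \<bullet> v) * (\<Sum>k\<in>UNIV. h $ k * partial i (X k u) v)
          + (\<Sum>j\<in>UNIV. (\<Sum>k\<in>UNIV. h $ k * dp k j u) * v $ j) * partial i (A u) v)
        + (q u $ i * (\<Sum>k\<in>UNIV. h $ k * X k u v) + (\<Sum>k\<in>UNIV. h $ k * dq k i u) * A u v))) (at u)"
    by (intro has_derivative_add has_derivative_mult pv dA_has_derivative A_has_derivative dq_has_derivative u uW)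
  from partial_cong_open[OF open_support u _ this, of "\<lambda>u. X i u v" k]
  have "partial k (\<lambda>u. X i u v) u = ((p u \<bullet> v) * partial i (X k u) v + (\<Sum>j\<in>UNIV. dp k j u * v $ j) * partial i (A u) v)
      + (q u $ i * X k u v + dq k i u * A u v)"
    using X_eq supportD by (simp add: sum_axis_mult)
  moreover have "partial i (X k u) v = p u $ i * partial k (A u) v + (p u \<bullet> v) * partial i (partial k (A u)) v
      + q u $ k * partial i (A u) v"
  proof -
    have "X k u = (\<lambda>v. (p u \<bullet> v) * partial k (A u) v + q u $ k * A u v)" using X_eq[OF uW bu] by blast
    moreover have "((\<lambda>v. (p u \<bullet> v) * partial k (A u) v + q u $ k * A u v) has_derivative
       (\<lambda>h. ((p u \<bullet> v) * (\<Sum>i\<in>UNIV. h $ i * partial i (partial k (A u)) v) + (p u \<bullet> h) * partial k (A u) v)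
         + q u $ k * (\<Sum>i\<in>UNIV. h $ i * partial i (A u) v))) (at v)"
      by (intro has_derivative_add has_derivative_mult has_derivative_mult_right rpf_partial(2) rpf_partial(1) rpfA
          bounded_linear_imp_has_derivative bounded_linear_inner_right)
    ultimately show ?thesis using partial_eq[of "X k u" _ v i] by (simp add: sum_axis_mult inner_axis)
  qed
  ultimately show ?thesis using X_eq[OF uW bu, of k v] by (simp add: algebra_simps)
qed

lemma partial_B_u:
  assumes u: "u \<in> support"
  shows "partial k (\<lambda>u. B i u $ j) u = (b u $ k * p u $ i + d u $ k * b u $ i) * p u $ j + b u $ i * dp k j u
    + dd k i u * b u $ j + d u $ i * (b u $ k * p u $ j + d u $ k * b u $ j)"
proof -
  note uW = supportD(1)[OF u] and bu = supportD(2)[OF u]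
  have db: "((\<lambda>u. b u $ j) has_derivative (\<lambda>h. \<Sum>k\<in>UNIV. h $ k * B k u $ j)) (at u)" for j
    using smooth_on_has_derivative_partial[OF b_component_smooth uW] by (simp add: partial_b[OF uW])
  have "((\<lambda>u. b u $ i * p u $ j + d u $ i * b u $ j) has_derivative
      (\<lambda>h. (b u $ i * (\<Sum>k\<in>UNIV. h $ k * dp k j u) + (\<Sum>k\<in>UNIV. h $ k * B k u $ i) * p u $ j)
        + (d u $ i * (\<Sum>k\<in>UNIV. h $ k * B k u $ j) + (\<Sum>k\<in>UNIV. h $ k * dd k i u) * b u $ j))) (at u)"
    by (intro has_derivative_add has_derivative_mult db dp_has_derivative dd_has_derivative u)
  from partial_cong_open[OF open_support u _ this, of "\<lambda>u. B i u $ j" k]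
  have "partial k (\<lambda>u. B i u $ j) u = (b u $ i * dp k j u + B k u $ i * p u $ j) + (d u $ i * B k u $ j + dd k i u * b u $ j)"
    using B_eq supportD by (simp add: sum_axis_mult)
  then show ?thesis using B_eq[OF uW bu, of k] by (simp add: algebra_simps)
qed

text \<open>The mixed second derivatives of \<open>A\<close> leave only a skew defect, which those of \<open>\<beta>\<close> kill.\<close>

lemma dp_eq:
  assumes u: "u \<in> support"
  shows "dp k j u = p u $ k * p u $ j"
proof -
  note uW = supportD(1)[OF u] and bu = supportD(2)[OF u]
  interpret pt: irreducible_form_point m "A u" by (rule point[OF uW])
  define e where "e k j = dp k j u - p u $ k * p u $ j" for k j
  define C where "C k l = dq k l u - dq l k u" for k l
  define D where "D k l = dd k l u - dd l k u" for k l
  have 1: "(\<Sum>j\<in>UNIV. e k j * v $ j) * partial l (A u) v - (\<Sum>j\<in>UNIV. e l j * v $ j) * partial k (A u) v + C k l * A u v = 0" for k l v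
  proof -
    have e: "(\<Sum>j\<in>UNIV. e k j * v $ j) = (\<Sum>j\<in>UNIV. dp k j u * v $ j) - p u $ k * (p u \<bullet> v)" for k
      by (simp add: e_def inner_vec_def left_diff_distrib sum_subtractf sum_distrib_left mult.assoc)
    have "partial l (partial k (A u)) v = partial k (partial l (A u)) v"
      by (rule partial_commute_rpf[OF rpfA])
    then show ?thesis
      using X_partial_commute[OF uW, of k l v] unfolding partial_X_u[OF u] e C_def by (simp add: algebra_simps)
  qed
  have skew: "e k l = - e l k" and C: "C k l = real m * e l k" for k l
    using pt.integrability_point[OF 1, of k l] by auto
  \<comment> \<open>Skew part of the derivative of \<open>p = (2/m) q - d\<close>: the term with
    \<open>C\<close> gives \<open>- 2 * e k l\<close>, and the skew part of \<open>e\<close> the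
    same again.\<close>
  have D: "D k l = - 4 * e k l" for k l
  proof -
    have pd: "dp k l u = 2 / real m * dq k l u - dd k l u" for k l
    proof -
      have "((\<lambda>u. 2 / real m * q u $ l - d u $ l) has_derivative
          (\<lambda>h. 2 / real m * (\<Sum>k\<in>UNIV. h $ k * dq k l u) - (\<Sum>k\<in>UNIV. h $ k * dd k l u))) (at u)"
        by (intro has_derivative_diff has_derivative_mult_right dq_has_derivative dd_has_derivative u)
      from partial_cong_open[OF open_support u _ this, of "\<lambda>u. p u $ l" k] show ?thesis
        using p_eq supportD by (simp add: sum_axis_mult dp_def)
    qed
    have "D k l = 2 / real m * C k l - (e k l - e l k)"
      unfolding D_def C_def e_def pd by (simp add: algebra_simps)
    then show ?thesis unfolding C using skew[of l k] m0 by simp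
  qed
  have B2: "b u $ l * e k j - b u $ k * e l j + D k l * b u $ j = 0" for k l j
    using B_partial_commute[OF uW, of k l j] unfolding partial_B_u[OF u] e_def D_def by (simp add: algebra_simps)
  have diag: "e k k = 0" for k using skew[of k k] by simp
  \<comment> \<open>Some component of \<open>b u\<close> is nonzero; it is taken as \<open>j\<close>
    in \<open>B2\<close>. If it is the component \<open>k\<close> or \<open>l\<close>, what remains
    is, up to sign, \<open>3 * e k l\<close> times it; if both of these components vanish,
    \<open>D k l\<close> times it.\<close>
  have "e k l = 0" for k l
  proof -
    consider "b u $ k \<noteq> 0" | "b u $ l \<noteq> 0" | j where "b u $ k = 0" "b u $ l = 0" "b u $ j \<noteq> 0"
      using bu by (auto simp: vec_eq_iff)
    then show ?thesis
    proof cases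
      case 1
      have "3 * (b u $ k * e k l) = 0" using B2[of k l k] unfolding D diag skew[of l k] by (simp add: algebra_simps)
      then show ?thesis using 1 by simp
    next
      case 2
      have "3 * (b u $ l * e k l) = 0" using B2[of k l l] unfolding D diag skew[of l k] by (simp add: algebra_simps)
      then show ?thesis using 2 by simp
    next
      case 3
      then show ?thesis using B2[of k l j] skew[of k l] by (simp add: D)
    qed
  qed
  then show ?thesis by (simp add: e_def)
qed

lemma p_has_derivative:
  assumes u: "u \<in> support"
  shows "(p has_derivative (\<lambda>h. (p u \<bullet> h) *\<^sub>R p u)) (at u)"
proof -
  have "((\<lambda>u. \<Sum>j\<in>UNIV. p u $ j *\<^sub>R axis j (1::real)) has_derivative
      (\<lambda>h. \<Sum>j\<in>UNIV. (\<Sum>k\<in>UNIV. h $ k * dp k j u) *\<^sub>R axis j 1)) (at u)"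
    by (intro has_derivative_sum has_derivative_scaleR_left dp_has_derivative u)
  moreover have "(\<lambda>u. \<Sum>j\<in>UNIV. p u $ j *\<^sub>R axis j 1) = p"
  proof
    show "(\<Sum>j\<in>UNIV. p u $ j *\<^sub>R axis j 1) = p u" for u
      using basis_expansion[of "p u"] by (simp add: scalar_mult_eq_scaleR)
  qed
  moreover have "(\<Sum>j\<in>UNIV. (\<Sum>k\<in>UNIV. h $ k * dp k j u) *\<^sub>R axis j 1) = (p u \<bullet> h) *\<^sub>R p u" for h :: "real^'n"
  proof -
    have "(\<Sum>k\<in>UNIV. h $ k * dp k j u) = (p u \<bullet> h) * p u $ j" for j
      by (simp add: dp_eq[OF u] inner_vec_def sum_distrib_left sum_distrib_right mult_ac)
    then have "(\<Sum>j\<in>UNIV. (\<Sum>k\<in>UNIV. h $ k * dp k j u) *\<^sub>R axis j 1)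
        = (p u \<bullet> h) *\<^sub>R (\<Sum>j\<in>UNIV. p u $ j *\<^sub>R axis j (1::real))" by (simp add: scaleR_sum_right)
    then show ?thesis using basis_expansion[of "p u"] by (simp add: scalar_mult_eq_scaleR)
  qed
  ultimately show ?thesis by simp
qed

text \<open>The Riccati equation for \<open>p\<close> is solved by \<open>p = p\<^sub>0 / (1 - p\<^sub>0 \<bullet> (u - u\<^sub>0))\<close>.\<close>

lemma p_solution:
  assumes S: "compact S" "convex S" "S \<subseteq> support" "u0 \<in> S" "u \<in> S"
  shows "(1 - p u0 \<bullet> (u - u0)) *\<^sub>R p u = p u0"
proof -
  have "S \<subseteq> W" using S supportD by blast
  then obtain K where K: "\<And>u. u \<in> S \<Longrightarrow> norm (p u) \<le> K" using pd_bounded[OF S(1)] S(3) supportD(2) by blast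
  \<comment> \<open>The claimed solution, multiplied out to avoid a division. By the Riccati
    equation the derivative of \<open>H\<close> is linear in \<open>H\<close>, and
    \<open>H u0 = 0\<close>.\<close>
  define H where "H u = (1 - p u0 \<bullet> (u - u0)) *\<^sub>R p u - p u0" for u
  have "H u = 0"
  proof (rule gronwall_zero[where f = H and S = S and x = u0 and f' = "\<lambda>z h. (H z \<bullet> h) *\<^sub>R p z" and K = K])
    fix z assume z: "z \<in> S"
    then have zO: "z \<in> support" using S by blast
    have r: "((\<lambda>u. 1 - p u0 \<bullet> (u - u0)) has_derivative (\<lambda>h. - (p u0 \<bullet> h))) (at z)"
      by (auto intro!: derivative_eq_intros)
    have "(H has_derivative (\<lambda>h. ((1 - p u0 \<bullet> (z - u0)) *\<^sub>R ((p z \<bullet> h) *\<^sub>R p z) + (- (p u0 \<bullet> h)) *\<^sub>R p z) - 0)) (at z)"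
      unfolding H_def by (intro has_derivative_diff has_derivative_scaleR r p_has_derivative zO has_derivative_const)
    then show "(H has_derivative (\<lambda>h. (H z \<bullet> h) *\<^sub>R p z)) (at z)"
      by (rule has_derivative_eq_rhs) (simp add: H_def inner_diff_left algebra_simps)
    fix h
    have "H z \<bullet> (H z \<bullet> h) *\<^sub>R p z \<le> \<bar>H z \<bullet> h\<bar> * \<bar>H z \<bullet> p z\<bar>" by (metis abs_ge_self abs_mult inner_scaleR_right)
    also have "\<dots> \<le> (norm (H z) * norm h) * (norm (H z) * norm (p z))" by (intro mult_mono Cauchy_Schwarz_ineq2) auto
    also have "\<dots> \<le> (norm (H z) * norm h) * (norm (H z) * K)" using K[OF z] by (intro mult_left_mono) auto
    also have "\<dots> = K * norm h * (H z \<bullet> H z)" by (simp add: dot_square_norm power2_eq_square)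
    finally show "H z \<bullet> (H z \<bullet> h) *\<^sub>R p z \<le> K * norm h * (H z \<bullet> H z)" .
  qed (use S in \<open>auto simp: H_def\<close>)
  then show ?thesis by (simp add: H_def)
qed

section \<open>Constancy of the metric along projectively transported vectors\<close>

lemma A_total_derivative:
  assumes u: "u \<in> W" and V: "(V has_derivative V') (at u)"
  shows "((\<lambda>u. A u (V u)) has_derivative
    (\<lambda>h. (\<Sum>k\<in>UNIV. h $ k * X k u (V u)) + (\<Sum>i\<in>UNIV. V' h $ i * partial i (A u) (V u)))) (at u)"
proof -
  let ?\<mu> = "\<lambda>is v. prod_list (map (\<lambda>i. v $ i) is)"
  have "((\<lambda>u. \<Sum>is | length is = m. c u is * ?\<mu> is (V u)) has_derivative
     (\<lambda>h. \<Sum>is | length is = m. c u is * (\<Sum>i\<in>UNIV. V' h $ i * partial i (?\<mu> is) (V u))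
        + (\<Sum>k\<in>UNIV. h $ k * partial k (\<lambda>u. c u is) u) * ?\<mu> is (V u))) (at u)"
    by (intro has_derivative_sum has_derivative_mult smooth_on_has_derivative_partial[OF _ u]
        has_derivative_compose[OF V rpf_partial(2)[OF rpf_prod_list]]) (auto intro: c_smooth)
  then show ?thesis unfolding A_def X_def partial_form unfolding form_def
    by (rule has_derivative_eq_rhs)
      (simp add: fun_eq_iff sum.distrib sum_distrib_left sum_distrib_right mult_ac sum.swap[of _ UNIV])
qed

text \<open>\<open>V u\<close> is the image of the constant vector \<open>\<xi>\<close> under the
  differential of the inverse projective map. Along it \<open>A\<close> and
  \<open>b u \<bullet> V u\<close> grow at the relative rates \<open>q - m p\<close> and
  \<open>d - p\<close>, and \<open>(d - p) - (2/m) (q - m p)\<close> vanishes. Stated for the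
  reciprocal of the metric, this also covers vectors on which \<open>b\<close> is zero.\<close>

lemma kropina_constant:
  assumes S: "compact S" "convex S" "S \<subseteq> support" "u0 \<in> S" "u \<in> S" and \<xi>: "\<xi> \<noteq> 0"
    and r: "\<And>u. u \<in> S \<Longrightarrow> 1 - p u0 \<bullet> (u - u0) > 0"
    and V: "V = (\<lambda>u. (1 - p u0 \<bullet> (u - u0)) *\<^sub>R (\<xi> - (p u0 \<bullet> \<xi>) *\<^sub>R (u - u0)))"
  shows "(b u \<bullet> V u) * exp (- (2 / real m) * ln (A u (V u))) = (b u0 \<bullet> \<xi>) * exp (- (2 / real m) * ln (A u0 \<xi>))"
    and "V u \<noteq> 0"
proof -
  have V0: "V u \<noteq> 0" if u: "u \<in> S" for u
  proof
    assume "V u = 0"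
    then have *: "\<xi> = (p u0 \<bullet> \<xi>) *\<^sub>R (u - u0)" using r[OF u] by (simp add: V)
    then have "p u0 \<bullet> \<xi> = (p u0 \<bullet> \<xi>) * (p u0 \<bullet> (u - u0))" by (metis inner_scaleR_right)
    then have "(p u0 \<bullet> \<xi>) * (1 - p u0 \<bullet> (u - u0)) = 0" by (simp add: algebra_simps)
    then have "p u0 \<bullet> \<xi> = 0" using r[OF u] by simp
    then show False using * \<xi> by simp
  qed
  then show "V u \<noteq> 0" using S by blast
  define Q where "Q u = (b u \<bullet> V u) * exp (- (2 / real m) * ln (A u (V u)))" for u
  have "(Q has_derivative (\<lambda>h. 0)) (at z within S)" if z: "z \<in> S" for z
  proof -
    have zO: "z \<in> support" and zW: "z \<in> W" and bz: "b z \<noteq> 0" using z S supportD by auto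
    define \<rho> where "\<rho> = 1 - p u0 \<bullet> (z - u0)"
    have p0: "p u0 = \<rho> *\<^sub>R p z" using p_solution[OF S(1-4) z] by (simp add: \<rho>_def)
    have \<rho>: "\<rho> > 0" using r[OF z] by (simp add: \<rho>_def)
    have Az: "A z (V z) > 0" by (rule posA[OF zW V0[OF z]])
    have Vz: "V z = \<rho> *\<^sub>R (\<xi> - (p u0 \<bullet> \<xi>) *\<^sub>R (z - u0))" by (simp add: V \<rho>_def)
    have pV: "p z \<bullet> V z = (p u0 \<bullet> \<xi>) * \<rho>"
    proof -
      have "p z \<bullet> V z = p u0 \<bullet> (\<xi> - (p u0 \<bullet> \<xi>) *\<^sub>R (z - u0))" unfolding Vz by (simp add: p0)
      also have "\<dots> = (p u0 \<bullet> \<xi>) * (1 - p u0 \<bullet> (z - u0))" by (simp add: inner_diff_right right_diff_distrib)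
      finally show ?thesis by (simp add: \<rho>_def)
    qed
    have dV: "(V has_derivative (\<lambda>h. - (p z \<bullet> h) *\<^sub>R V z - (p z \<bullet> V z) *\<^sub>R h)) (at z)"
    proof -
      have r: "((\<lambda>u. 1 - p u0 \<bullet> (u - u0)) has_derivative (\<lambda>h. - (p u0 \<bullet> h))) (at z)"
        by (auto intro!: derivative_eq_intros)
      have w: "((\<lambda>u. \<xi> - (p u0 \<bullet> \<xi>) *\<^sub>R (u - u0)) has_derivative (\<lambda>h. - ((p u0 \<bullet> \<xi>) *\<^sub>R h))) (at z)"
        by (auto intro!: derivative_eq_intros)
      show ?thesis unfolding V
      proof (rule has_derivative_eq_rhs[OF has_derivative_scaleR[OF r w]], rule ext)
        fix h :: "real^'n"
        have 1: "(1 - p u0 \<bullet> (z - u0)) *\<^sub>R - ((p u0 \<bullet> \<xi>) *\<^sub>R h) = - ((p z \<bullet> V z) *\<^sub>R h)"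
          unfolding pV by (simp only: \<rho>_def scaleR_minus_right scaleR_scaleR mult.commute)
        have 2: "(- (p u0 \<bullet> h)) *\<^sub>R (\<xi> - (p u0 \<bullet> \<xi>) *\<^sub>R (z - u0)) = - (p z \<bullet> h) *\<^sub>R V z"
        proof -
          have "p u0 \<bullet> h = \<rho> * (p z \<bullet> h)" by (simp add: p0)
          then show ?thesis unfolding Vz by (simp add: mult.commute)
        qed
        have 3: "(1 - p u0 \<bullet> (z - u0)) *\<^sub>R (\<xi> - (p u0 \<bullet> \<xi>) *\<^sub>R (z - u0)) = V z" by (simp add: V)
        show "(1 - p u0 \<bullet> (z - u0)) *\<^sub>R - ((p u0 \<bullet> \<xi>) *\<^sub>R h)
            + (- (p u0 \<bullet> h)) *\<^sub>R (\<xi> - (p u0 \<bullet> \<xi>) *\<^sub>R (z - u0))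
          = - (p z \<bullet> h) *\<^sub>R ((1 - p u0 \<bullet> (z - u0)) *\<^sub>R (\<xi> - (p u0 \<bullet> \<xi>) *\<^sub>R (z - u0)))
            - (p z \<bullet> ((1 - p u0 \<bullet> (z - u0)) *\<^sub>R (\<xi> - (p u0 \<bullet> \<xi>) *\<^sub>R (z - u0)))) *\<^sub>R h"
          unfolding 3 unfolding 1 2 by simp
      qed
    qed
    have dA: "((\<lambda>u. A u (V u)) has_derivative (\<lambda>h. (q z \<bullet> h - real m * (p z \<bullet> h)) * A z (V z))) (at z)"
    proof (rule has_derivative_eq_rhs[OF A_total_derivative[OF zW dV]], rule ext)
      fix h
      have 1: "(\<Sum>k\<in>UNIV. h $ k * X k z (V z)) = (p z \<bullet> V z) * (\<Sum>i\<in>UNIV. h $ i * partial i (A z) (V z)) + (q z \<bullet> h) * A z (V z)"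
        by (simp add: X_eq[OF zW bz] inner_vec_def[of "q z"] algebra_simps sum.distrib sum_distrib_left)
      have 2: "(\<Sum>i\<in>UNIV. (- (p z \<bullet> h) *\<^sub>R V z - (p z \<bullet> V z) *\<^sub>R h) $ i * partial i (A z) (V z))
          = - (p z \<bullet> h) * (\<Sum>i\<in>UNIV. V z $ i * partial i (A z) (V z)) - (p z \<bullet> V z) * (\<Sum>i\<in>UNIV. h $ i * partial i (A z) (V z))"
        by (simp add: algebra_simps sum.distrib sum_subtractf sum_distrib_left sum_negf)
      show "(\<Sum>k\<in>UNIV. h $ k * X k z (V z)) + (\<Sum>i\<in>UNIV. (- (p z \<bullet> h) *\<^sub>R V z - (p z \<bullet> V z) *\<^sub>R h) $ i * partial i (A z) (V z))
          = (q z \<bullet> h - real m * (p z \<bullet> h)) * A z (V z)"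
        unfolding 1 2 euler_A by (simp add: algebra_simps)
    qed
    have db: "((\<lambda>u. b u \<bullet> V u) has_derivative (\<lambda>h. (d z \<bullet> h - p z \<bullet> h) * (b z \<bullet> V z))) (at z)"
    proof (rule has_derivative_eq_rhs[OF has_derivative_inner[OF b_has_derivative[OF zW] dV]], rule ext)
      fix h
      have "(\<Sum>k\<in>UNIV. h $ k *\<^sub>R B k z) \<bullet> V z = (\<Sum>k\<in>UNIV. h $ k * (B k z \<bullet> V z))"
        by (simp add: inner_sum_left)
      then show "b z \<bullet> (- (p z \<bullet> h) *\<^sub>R V z - (p z \<bullet> V z) *\<^sub>R h) + (\<Sum>k\<in>UNIV. h $ k *\<^sub>R B k z) \<bullet> V z
          = (d z \<bullet> h - p z \<bullet> h) * (b z \<bullet> V z)"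
        unfolding B_sum_eq[OF zW bz] by (simp add: inner_diff_right algebra_simps)
    qed
    have de: "((\<lambda>u. exp (- (2 / real m) * ln (A u (V u)))) has_derivative
        (\<lambda>h. exp (- (2 / real m) * ln (A z (V z))) * (- (2 / real m) * (q z \<bullet> h - real m * (p z \<bullet> h))))) (at z)"
    proof -
      have "((\<lambda>u. ln (A u (V u))) has_derivative (\<lambda>h. (q z \<bullet> h - real m * (p z \<bullet> h)))) (at z)"
        by (rule has_derivative_eq_rhs[OF has_derivative_ln[OF Az dA]]) (use Az in auto)
      from has_derivative_exp[OF has_derivative_mult_right[OF this]] show ?thesis
        by (rule has_derivative_eq_rhs) (auto simp: mult_ac)
    qed
    have "(Q has_derivative (\<lambda>h. 0)) (at z)"
      unfolding Q_def
    proof (rule has_derivative_eq_rhs[OF has_derivative_mult[OF db de]], rule ext)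
      fix h
      have "d z \<bullet> h - p z \<bullet> h + - (2 / real m) * (q z \<bullet> h - real m * (p z \<bullet> h)) = 0"
        using p_inner_eq[OF zW bz, of h] m0 by (simp add: right_diff_distrib)
      then have "(b z \<bullet> V z) * exp (- (2 / real m) * ln (A z (V z)))
        * (d z \<bullet> h - p z \<bullet> h + - (2 / real m) * (q z \<bullet> h - real m * (p z \<bullet> h))) = 0" by simp
      then show "(b z \<bullet> V z) * (exp (- (2 / real m) * ln (A z (V z))) * (- (2 / real m) * (q z \<bullet> h - real m * (p z \<bullet> h))))
          + (d z \<bullet> h - p z \<bullet> h) * (b z \<bullet> V z) * exp (- (2 / real m) * ln (A z (V z))) = 0"
        by (simp only: distrib_left mult_ac add_ac)
    qed
    then show ?thesis by (rule has_derivative_at_withinI)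
  qed
  from has_derivative_zero_constant[OF S(2) this] have "Q u = Q u0" using S by metis
  moreover have "V u0 = \<xi>" by (simp add: V)
  ultimately show "(b u \<bullet> V u) * exp (- (2 / real m) * ln (A u (V u))) = (b u0 \<bullet> \<xi>) * exp (- (2 / real m) * ln (A u0 \<xi>))"
    unfolding Q_def by simp
qed

end

section \<open>Changes of coordinates\<close>

lemma smooth_open_vimage:
  assumes "open V" "smooth_on V \<phi>" "open B"
  shows "open {x \<in> V. \<phi> x \<in> B}"
proof -
  have "open (\<phi> -` B \<inter> V)"
    using continuous_on_open_vimage[OF assms(1), of \<phi>] smooth_on_continuous_on[OF assms(2)] assms(3) by auto
  moreover have "\<phi> -` B \<inter> V = {x \<in> V. \<phi> x \<in> B}" by auto
  ultimately show ?thesis by simp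
qed

text \<open>The chart \<open>\<tau>\<close> lives on part of the image of \<open>\<phi>\<close>, so
  the domain of the composite shrinks to \<open>V'\<close>. The formula for the inverse is claimed
  on the image only, where \<open>inv_into\<close> is determined.\<close>

lemma local_coords_compose:
  assumes V: "local_coords V \<phi>" and B: "local_coords B \<tau>" "B \<subseteq> \<phi> ` V"
  defines "V' \<equiv> {x \<in> V. \<phi> x \<in> B}"
  shows "local_coords V' (\<tau> \<circ> \<phi>)" and "(\<tau> \<circ> \<phi>) ` V' = \<tau> ` B"
    and "\<And>w. w \<in> \<tau> ` B \<Longrightarrow> inv_into V' (\<tau> \<circ> \<phi>) w = inv_into V \<phi> (inv_into B \<tau> w)"
proof -
  note v = V[unfolded local_coords_def] and b = B(1)[unfolded local_coords_def]
  have \<phi>V': "\<phi> ` V' = B" using B(2) by (auto simp: V'_def)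
  have V'V: "V' \<subseteq> V" by (auto simp: V'_def)
  show im: "(\<tau> \<circ> \<phi>) ` V' = \<tau> ` B" using \<phi>V' by (metis image_comp)
  have inj: "inj_on (\<tau> \<circ> \<phi>) V'"
    using v b \<phi>V' V'V by (intro comp_inj_on) (auto intro: inj_on_subset)
  have V'o: "open V'" unfolding V'_def using v b by (intro smooth_open_vimage) auto
  show inv: "inv_into V' (\<tau> \<circ> \<phi>) w = inv_into V \<phi> (inv_into B \<tau> w)" if w: "w \<in> \<tau> ` B" for w
  proof (rule inv_into_f_eq[OF inj])
    obtain u where u: "u \<in> B" "w = \<tau> u" using w by blast
    then have "inv_into B \<tau> w = u" using b by (simp add: inv_into_f_f)
    moreover have "inv_into V \<phi> u \<in> V" "\<phi> (inv_into V \<phi> u) = u"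
      using B(2) u by (auto intro: inv_into_into f_inv_into_f)
    ultimately show "inv_into V \<phi> (inv_into B \<tau> w) \<in> V'" "(\<tau> \<circ> \<phi>) (inv_into V \<phi> (inv_into B \<tau> w)) = w"
      using u by (auto simp: V'_def)
  qed
  have s1: "smooth_on V' (\<lambda>x. \<tau> (\<phi> x))"
    by (rule smooth_on_compose[OF V'o equalityD1[OF \<phi>V'] smooth_on_subset[OF _ V'V]]) (use v b in blast)+
  have "inv_into B \<tau> ` \<tau> ` B \<subseteq> \<phi> ` V" using B(2) b by (auto simp: inv_into_f_f)
  then have "smooth_on (\<tau> ` B) (\<lambda>w. inv_into V \<phi> (inv_into B \<tau> w))"
    by (rule smooth_on_compose[rotated]) (use v b in blast)+
  then have s2: "smooth_on (\<tau> ` B) (inv_into V' (\<tau> \<circ> \<phi>))"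
    by (rule smooth_on_cong[rotated 2]) (use inv b in simp_all)
  show "local_coords V' (\<tau> \<circ> \<phi>)"
    unfolding local_coords_def im using V'o inj b s1 s2 by (simp add: o_def)
qed

lemma local_coords_inv:
  assumes "local_coords V \<phi>" "u \<in> \<phi> ` V"
  shows "inv_into V \<phi> u \<in> V" "\<phi> (inv_into V \<phi> u) = u"
    "(inv_into V \<phi> has_derivative frechet_derivative (inv_into V \<phi>) (at u)) (at u)"
proof -
  show "inv_into V \<phi> u \<in> V" "\<phi> (inv_into V \<phi> u) = u"
    using assms by (auto intro: inv_into_into f_inv_into_f)
  show "(inv_into V \<phi> has_derivative frechet_derivative (inv_into V \<phi>) (at u)) (at u)"
    using assms by (intro smooth_on_has_derivative[of "\<phi> ` V"]) (auto simp: local_coords_def)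
qed

lemma coord_compose:
  assumes V: "local_coords V \<phi>" and B: "local_coords B \<tau>" "B \<subseteq> \<phi> ` V" and w: "w \<in> \<tau> ` B"
  defines "V' \<equiv> {x \<in> V. \<phi> x \<in> B}"
  shows "coord_metric V' (\<tau> \<circ> \<phi>) F w \<xi> = coord_metric B \<tau> (coord_metric V \<phi> F) w \<xi>"
    and "(w, \<xi>) \<in> coord_dom V' (\<tau> \<circ> \<phi>) D \<longleftrightarrow> (w, \<xi>) \<in> coord_dom B \<tau> (coord_dom V \<phi> D)"
proof -
  note c = local_coords_compose[OF V B, folded V'_def]
  have o: "open (\<tau> ` B)" using B by (simp add: local_coords_def)
  note i = local_coords_inv[OF B(1) w]
  have u: "inv_into B \<tau> w \<in> \<phi> ` V" using i(1) B(2) by blast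
  have "((\<lambda>w. inv_into V \<phi> (inv_into B \<tau> w)) has_derivative
      (\<lambda>\<xi>. frechet_derivative (inv_into V \<phi>) (at (inv_into B \<tau> w)) (frechet_derivative (inv_into B \<tau>) (at w) \<xi>))) (at w)"
    by (rule has_derivative_compose[OF i(3) local_coords_inv(3)[OF V u]])
  then have "(inv_into V' (\<tau> \<circ> \<phi>) has_derivative
      (\<lambda>\<xi>. frechet_derivative (inv_into V \<phi>) (at (inv_into B \<tau> w)) (frechet_derivative (inv_into B \<tau>) (at w) \<xi>))) (at w)"
    by (rule has_derivative_transform_within_open[OF _ o w]) (simp add: c(3))
  then have d: "frechet_derivative (inv_into V' (\<tau> \<circ> \<phi>)) (at w)
      = (\<lambda>\<xi>. frechet_derivative (inv_into V \<phi>) (at (inv_into B \<tau> w)) (frechet_derivative (inv_into B \<tau>) (at w) \<xi>))"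
    by (rule frechet_derivative_at[symmetric])
  show "coord_metric V' (\<tau> \<circ> \<phi>) F w \<xi> = coord_metric B \<tau> (coord_metric V \<phi> F) w \<xi>"
    by (simp add: coord_metric_def c(3)[OF w] d)
  show "(w, \<xi>) \<in> coord_dom V' (\<tau> \<circ> \<phi>) D \<longleftrightarrow> (w, \<xi>) \<in> coord_dom B \<tau> (coord_dom V \<phi> D)"
    using w u unfolding coord_dom_def c(2) by (simp add: c(3)[OF w] d)
qed

text \<open>The projective transformations centred at \<open>u\<^sub>0\<close> that straighten \<open>p = p\<^sub>0 / (1 - p\<^sub>0 \<bullet> (u - u\<^sub>0))\<close>.\<close>

locale projective_map =
  fixes u0 p0 :: "real^'n::finite" and r :: real
  assumes r: "r > 0" "norm p0 * r < 1"
begin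

definition \<rho> :: "real^'n \<Rightarrow> real" where "\<rho> u = 1 - p0 \<bullet> (u - u0)"
definition \<tau> :: "real^'n \<Rightarrow> real^'n" where "\<tau> u = inverse (\<rho> u) *\<^sub>R (u - u0)"
text \<open>Plays for the inverse map \<open>\<theta>\<close> the role of \<open>\<rho>\<close>:
  \<open>\<kappa> (\<tau> u)\<close> is the reciprocal of \<open>\<rho> u\<close>.\<close>

definition \<kappa> :: "real^'n \<Rightarrow> real" where "\<kappa> w = 1 + p0 \<bullet> w"
definition \<theta> :: "real^'n \<Rightarrow> real^'n" where "\<theta> w = inverse (\<kappa> w) *\<^sub>R w + u0"

lemma \<rho>_pos: "u \<in> cball u0 r \<Longrightarrow> \<rho> u > 0"
proof -
  assume "u \<in> cball u0 r"
  then have "norm (u - u0) \<le> r" by (simp add: dist_norm norm_minus_commute)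
  have "p0 \<bullet> (u - u0) \<le> norm p0 * norm (u - u0)" by (rule norm_cauchy_schwarz)
  also have "\<dots> \<le> norm p0 * r" using \<open>norm (u - u0) \<le> r\<close> by (intro mult_left_mono) auto
  finally show "\<rho> u > 0" using r by (simp add: \<rho>_def)
qed

lemma \<kappa>_\<tau>: "\<rho> u \<noteq> 0 \<Longrightarrow> \<kappa> (\<tau> u) = inverse (\<rho> u)"
  by (simp add: \<kappa>_def \<tau>_def) (simp add: \<rho>_def field_simps)

lemma \<theta>_\<tau>: "\<rho> u \<noteq> 0 \<Longrightarrow> \<theta> (\<tau> u) = u"
  by (simp add: \<theta>_def \<kappa>_\<tau>) (simp add: \<tau>_def)

lemma \<tau>_\<theta>: "\<kappa> w \<noteq> 0 \<Longrightarrow> \<tau> (\<theta> w) = w"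
proof -
  assume k: "\<kappa> w \<noteq> 0"
  have "\<rho> (\<theta> w) = inverse (\<kappa> w)" using k by (simp add: \<rho>_def \<theta>_def) (simp add: \<kappa>_def field_simps)
  then show ?thesis using k by (simp add: \<tau>_def) (simp add: \<theta>_def)
qed

lemma open_\<kappa>: "open {w. \<kappa> w > 0}"
  unfolding \<kappa>_def by (intro open_Collect_less continuous_intros)

lemma smooth_\<theta>: "smooth_on {w. \<kappa> w > 0} \<theta>"
  unfolding \<theta>_def[abs_def]
proof (intro smooth_on_add smooth_on_scaleR smooth_on_inverse smooth_on_const open_\<kappa>)
  show "smooth_on {w. \<kappa> w > 0} \<kappa>" unfolding \<kappa>_def[abs_def]
    by (intro smooth_on_add smooth_on_const smooth_on_bounded_linear bounded_linear_inner_right open_\<kappa>[unfolded \<kappa>_def])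
  show "smooth_on {w. \<kappa> w > 0} (\<lambda>w. w)"
    by (intro smooth_on_bounded_linear bounded_linear_ident open_\<kappa>)
qed auto

text \<open>This writes the image as a preimage under the smooth map \<open>\<theta>\<close>, so
  that its openness follows from continuity.\<close>

lemma image_\<tau>: "\<tau> ` ball u0 r = {w \<in> {w. \<kappa> w > 0}. \<theta> w \<in> ball u0 r}"
proof (intro equalityI subsetI)
  fix w assume "w \<in> \<tau> ` ball u0 r"
  then obtain u where u: "u \<in> ball u0 r" "w = \<tau> u" by blast
  then have "\<rho> u > 0" using \<rho>_pos by simp
  then show "w \<in> {w \<in> {w. \<kappa> w > 0}. \<theta> w \<in> ball u0 r}" using u by (simp add: \<kappa>_\<tau> \<theta>_\<tau>)
next
  fix w assume "w \<in> {w \<in> {w. \<kappa> w > 0}. \<theta> w \<in> ball u0 r}"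
  then show "w \<in> \<tau> ` ball u0 r" using \<tau>_\<theta>[of w] by (intro image_eqI[of _ _ "\<theta> w"]) auto
qed

lemma inv_\<tau>: "w \<in> \<tau> ` ball u0 r \<Longrightarrow> inv_into (ball u0 r) \<tau> w = \<theta> w"
proof -
  assume "w \<in> \<tau> ` ball u0 r"
  moreover have "inj_on \<tau> (ball u0 r)"
  proof (rule inj_on_inverseI[where g = \<theta>])
    show "\<theta> (\<tau> u) = u" if "u \<in> ball u0 r" for u using \<rho>_pos[of u] that by (intro \<theta>_\<tau>) auto
  qed
  ultimately show ?thesis using \<tau>_\<theta>[of w] image_\<tau> by (intro inv_into_f_eq) auto
qed

lemma local_coords_\<tau>: "local_coords (ball u0 r) \<tau>"
  unfolding local_coords_def
proof (intro conjI)
  show o: "open (\<tau> ` ball u0 r)" unfolding image_\<tau>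
    by (rule smooth_open_vimage[OF open_\<kappa> smooth_\<theta> open_ball])
  show "inj_on \<tau> (ball u0 r)"
  proof (rule inj_on_inverseI[where g = \<theta>])
    show "\<theta> (\<tau> u) = u" if "u \<in> ball u0 r" for u using \<rho>_pos[of u] that by (intro \<theta>_\<tau>) auto
  qed
  have "smooth_on (ball u0 r) \<rho>"
  proof -
    have "smooth_on (ball u0 r) (\<lambda>u. (1 + p0 \<bullet> u0) + (- p0) \<bullet> u)"
      by (intro smooth_on_add smooth_on_const smooth_on_bounded_linear bounded_linear_inner_right open_ball)
    then show ?thesis by (rule smooth_on_cong[OF open_ball, rotated]) (simp add: \<rho>_def inner_diff_right)
  qed
  moreover have "smooth_on (ball u0 r) (\<lambda>u. u - u0)"
  proof -
    have "smooth_on (ball u0 r) (\<lambda>u. u + (- u0))"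
      by (intro smooth_on_add smooth_on_const smooth_on_bounded_linear bounded_linear_ident open_ball)
    then show ?thesis by simp
  qed
  moreover have "\<rho> u \<noteq> 0" if "u \<in> ball u0 r" for u using \<rho>_pos[of u] that by simp
  ultimately show "smooth_on (ball u0 r) \<tau>" unfolding \<tau>_def[abs_def]
    by (intro smooth_on_scaleR smooth_on_inverse open_ball) auto
  have "smooth_on (\<tau> ` ball u0 r) \<theta>" using smooth_\<theta> by (rule smooth_on_subset) (auto simp: image_\<tau>)
  then show "smooth_on (\<tau> ` ball u0 r) (inv_into (ball u0 r) \<tau>)"
    by (rule smooth_on_cong[OF o, rotated]) (simp add: inv_\<tau>)
qed simp

lemma frechet_derivative_inv_\<tau>:
  assumes u: "u \<in> ball u0 r"
  shows "frechet_derivative (inv_into (ball u0 r) \<tau>) (at (\<tau> u)) \<xi> = \<rho> u *\<^sub>R (\<xi> - (p0 \<bullet> \<xi>) *\<^sub>R (u - u0))"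
proof -
  have o: "open (\<tau> ` ball u0 r)" using local_coords_\<tau> by (simp add: local_coords_def)
  have \<rho>: "\<rho> u > 0" using \<rho>_pos u by simp
  have k: "\<kappa> (\<tau> u) = inverse (\<rho> u)" using \<rho> by (simp add: \<kappa>_\<tau>)
  have dk: "(\<kappa> has_derivative (\<lambda>h. p0 \<bullet> h)) (at (\<tau> u))"
    unfolding \<kappa>_def[abs_def] by (auto intro!: derivative_eq_intros)
  have "(\<theta> has_derivative (\<lambda>h. (inverse (\<kappa> (\<tau> u)) *\<^sub>R h + (- (inverse (\<kappa> (\<tau> u)) * (p0 \<bullet> h) * inverse (\<kappa> (\<tau> u)))) *\<^sub>R \<tau> u) + 0)) (at (\<tau> u))"
    unfolding \<theta>_def[abs_def] using \<rho>
    by (intro has_derivative_add has_derivative_scaleR has_derivative_ident has_derivative_const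
        Deriv.has_derivative_inverse dk) (simp add: k)
  then have "(inv_into (ball u0 r) \<tau> has_derivative
      (\<lambda>h. (inverse (\<kappa> (\<tau> u)) *\<^sub>R h + (- (inverse (\<kappa> (\<tau> u)) * (p0 \<bullet> h) * inverse (\<kappa> (\<tau> u)))) *\<^sub>R \<tau> u) + 0)) (at (\<tau> u))"
    by (rule has_derivative_transform_within_open[OF _ o]) (use u inv_\<tau> in auto)
  from frechet_derivative_at[OF this, symmetric]
  show ?thesis using \<rho> by (simp add: k) (simp add: \<tau>_def scaleR_diff_right mult_ac)
qed

end

text \<open>Matches the metric with the reciprocal quantity of
  \<open>kropina_constant\<close>.\<close>

lemma kropina_value:
  assumes "m > 0" "form m (c u) v > 0"
  shows "kropina_change (mth_root m c) (one_form b) u v = inverse ((b u \<bullet> v) * exp (- (2 / real m) * ln (form m (c u) v)))"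
proof -
  have "root m (form m (c u) v) = exp (ln (form m (c u) v) / real m)"
    using assms by (simp add: root_powr_inverse powr_def)
  then have "(root m (form m (c u) v))\<^sup>2 = exp (2 / real m * ln (form m (c u) v))"
    by (simp flip: exp_of_nat_mult)
  moreover have "one_form b u v = b u \<bullet> v" by (simp add: one_form_def inner_vec_def)
  ultimately show ?thesis by (simp add: kropina_change_def mth_root_def exp_minus divide_inverse mult.commute)
qed

lemma (in kropina_flat) minkowskian_coords:
  assumes u0: "u0 \<in> W"
  shows "\<exists>S \<tau> E \<Phi>. u0 \<in> S \<and> S \<subseteq> W \<and> local_coords S \<tau> \<and>
    coord_dom S \<tau> {(u, v). u \<in> W \<and> b u \<bullet> v \<noteq> 0} = \<tau> ` S \<times> E \<and>
    (\<forall>w\<in>\<tau> ` S. \<forall>\<xi>\<in>E. coord_metric S \<tau> (kropina_change (mth_root m c) (one_form b)) w \<xi> = \<Phi> \<xi>)"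
proof -
  obtain r where r: "r > 0" "cball u0 r \<subseteq> W" using W u0 open_contains_cball by blast
  show ?thesis
  proof (cases "b u0 = 0")
    case True
    have b0: "b u = 0" if "u \<in> cball u0 r" for u
      using b_vanishing[OF compact_cball convex_cball r(2) _ that True] r(1) by simp
    \<comment> \<open>Here \<open>b\<close> vanishes on the whole ball, so the domain of the metric
      is empty over it and any chart serves; \<open>p0 = 0\<close> gives a translation.\<close>
    interpret pm: projective_map u0 0 r by unfold_locales (use r in auto)
    have "b (inv_into (ball u0 r) pm.\<tau> w) = 0" if "w \<in> pm.\<tau> ` ball u0 r" for w
      using local_coords_inv(1)[OF pm.local_coords_\<tau> that] b0 by simp
    then have "coord_dom (ball u0 r) pm.\<tau> {(u, v). u \<in> W \<and> b u \<bullet> v \<noteq> 0} = pm.\<tau> ` ball u0 r \<times> {}"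
      by (auto simp: coord_dom_def)
    moreover have "ball u0 r \<subseteq> W" "u0 \<in> ball u0 r" using r by auto
    ultimately show ?thesis using pm.local_coords_\<tau>
      by (intro exI[of _ "ball u0 r"] exI[of _ pm.\<tau>] exI[of _ "{}"]) simp
  next
    case False
    \<comment> \<open>Keeps the ball inside \<open>W\<close> and \<open>norm (p u0) * s\<close>
      below 1, so that the denominator \<open>1 - p u0 \<bullet> (u - u0)\<close> stays
      positive.\<close>
    define s where "s = min r (1 / (2 * (norm (p u0) + 1)))"
    have n: "2 * (norm (p u0) + 1) > 0" by (simp add: add_nonneg_pos)
    have s: "s > 0" "s \<le> r" "s \<le> 1 / (2 * (norm (p u0) + 1))" using r(1) n by (auto simp: s_def)
    have "norm (p u0) * s \<le> norm (p u0) * (1 / (2 * (norm (p u0) + 1)))" using s by (intro mult_left_mono) auto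
    also have "\<dots> < 1" using n by (simp add: divide_less_eq)
    finally interpret pm: projective_map u0 "p u0" s by unfold_locales (use s in auto)
    have SW: "cball u0 s \<subseteq> W" using r(2) s by auto
    have SO: "cball u0 s \<subseteq> support"
    proof
      fix u assume u: "u \<in> cball u0 s"
      \<comment> \<open>\<open>b_vanishing\<close> read backwards: a zero at \<open>u\<close> would
        spread to \<open>u0\<close>.\<close>
      have "b u \<noteq> 0"
        using b_vanishing[OF compact_cball convex_cball SW u, of u0] False s by auto
      then show "u \<in> support" using SW u by (auto simp: support_def)
    qed
    let ?\<tau> = pm.\<tau> and ?S = "ball u0 s"
    let ?V = "\<lambda>\<xi> u. (1 - p u0 \<bullet> (u - u0)) *\<^sub>R (\<xi> - (p u0 \<bullet> \<xi>) *\<^sub>R (u - u0))"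
    have const: "(b u \<bullet> ?V \<xi> u) * exp (- (2 / real m) * ln (A u (?V \<xi> u))) = (b u0 \<bullet> \<xi>) * exp (- (2 / real m) * ln (A u0 \<xi>))"
      and Vnz: "?V \<xi> u \<noteq> 0" if "u \<in> ?S" "\<xi> \<noteq> 0" for u \<xi>
      using kropina_constant[OF compact_cball convex_cball SO _ _ that(2) _ refl, of u0 u] that s pm.\<rho>_pos
      unfolding pm.\<rho>_def by auto
    have V0: "?V 0 u = 0" for u by simp
    have frd: "inv_into ?S ?\<tau> (?\<tau> u) = u" "frechet_derivative (inv_into ?S ?\<tau>) (at (?\<tau> u)) \<xi> = ?V \<xi> u" if u: "u \<in> ?S" for u \<xi>
      using pm.local_coords_\<tau> pm.frechet_derivative_inv_\<tau>[OF u, of \<xi>] u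
      by (auto simp: local_coords_def inv_into_f_f pm.\<rho>_def)
    define E where "E = {\<xi>. b u0 \<bullet> \<xi> \<noteq> 0}"
    define \<Phi> where "\<Phi> \<xi> = inverse ((b u0 \<bullet> \<xi>) * exp (- (2 / real m) * ln (A u0 \<xi>)))" for \<xi>
    \<comment> \<open>The constant quantity is \<open>b u\<close> applied to the transported vector,
      times an exponential. Whether it is zero therefore depends on \<open>\<xi>\<close> alone,
      which makes the domain independent of the point.\<close>
    have dom: "b u \<bullet> ?V \<xi> u \<noteq> 0 \<longleftrightarrow> \<xi> \<in> E" if u: "u \<in> ?S" for u \<xi>
    proof (cases "\<xi> = 0")
      case False
      have "b u \<bullet> ?V \<xi> u = 0 \<longleftrightarrow> b u0 \<bullet> \<xi> = 0" using const[OF u False] by (metis exp_not_eq_zero mult_eq_0_iff)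
      then show ?thesis by (simp add: E_def)
    qed (simp add: E_def)
    have domE: "coord_dom ?S ?\<tau> {(u, v). u \<in> W \<and> b u \<bullet> v \<noteq> 0} = ?\<tau> ` ?S \<times> E"
    proof (intro equalityI subsetI)
      fix x assume "x \<in> coord_dom ?S ?\<tau> {(u, v). u \<in> W \<and> b u \<bullet> v \<noteq> 0}"
      then obtain u \<xi> where "x = (?\<tau> u, \<xi>)" "u \<in> ?S" "b u \<bullet> ?V \<xi> u \<noteq> 0"
        by (auto simp: coord_dom_def frd)
      then show "x \<in> ?\<tau> ` ?S \<times> E" using dom by auto
    next
      fix x assume "x \<in> ?\<tau> ` ?S \<times> E"
      then obtain u \<xi> where "x = (?\<tau> u, \<xi>)" "u \<in> ?S" "\<xi> \<in> E" by auto
      moreover from this have "u \<in> W" using SW by auto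
      ultimately show "x \<in> coord_dom ?S ?\<tau> {(u, v). u \<in> W \<and> b u \<bullet> v \<noteq> 0}"
        using dom by (simp add: coord_dom_def frd)
    qed
    have met: "coord_metric ?S ?\<tau> (kropina_change (mth_root m c) (one_form b)) w \<xi> = \<Phi> \<xi>"
      if w: "w \<in> ?\<tau> ` ?S" and \<xi>: "\<xi> \<in> E" for w \<xi>
    proof -
      obtain u where u: "u \<in> ?S" "w = ?\<tau> u" using w by blast
      have "\<xi> \<noteq> 0" using \<xi> by (auto simp: E_def)
      note c = const[OF u(1) this] and nz = Vnz[OF u(1) this]
      have uW: "u \<in> W" using u SW by auto
      have "coord_metric ?S ?\<tau> (kropina_change (mth_root m c) (one_form b)) w \<xi>
          = kropina_change (mth_root m c) (one_form b) u (?V \<xi> u)"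
        unfolding coord_metric_def u(2) frd[OF u(1)] ..
      also have "\<dots> = inverse ((b u \<bullet> ?V \<xi> u) * exp (- (2 / real m) * ln (A u (?V \<xi> u))))"
        unfolding A_def by (rule kropina_value) (use posA[OF uW nz] m in \<open>auto simp: A_def\<close>)
      also have "\<dots> = \<Phi> \<xi>" unfolding c \<Phi>_def ..
      finally show ?thesis .
    qed
    show ?thesis
    proof (intro exI conjI ballI)
      show "?S \<subseteq> W" "u0 \<in> ?S" using SW s(1) by auto
    qed (fact pm.local_coords_\<tau> domE met)+
  qed
qed

section \<open>The main theorem\<close>

text \<open>Agreement is asked for all \<open>v\<close> but only over \<open>W\<close>, because the
  transformed data describe \<open>coord_metric\<close> only over the image of the chart.\<close>

lemma spray_coeff_cong:
  assumes W: "open W" "u \<in> W" and FG: "\<And>u v. u \<in> W \<Longrightarrow> F u v = G u v"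
  shows "spray_coeff F u v i = spray_coeff G u v i"
proof -
  have p: "partial k (\<lambda>x. (F x y)\<^sup>2) u = partial k (\<lambda>x. (G x y)\<^sup>2) u" for k y
  proof -
    have "((\<lambda>x. (F x y)\<^sup>2) has_derivative D) (at u) \<longleftrightarrow> ((\<lambda>x. (G x y)\<^sup>2) has_derivative D) (at u)" for D
      using has_derivative_transform_within_open[OF _ W, of "\<lambda>x. (F x y)\<^sup>2" D UNIV "\<lambda>x. (G x y)\<^sup>2"]
        has_derivative_transform_within_open[OF _ W, of "\<lambda>x. (G x y)\<^sup>2" D UNIV "\<lambda>x. (F x y)\<^sup>2"] FG by auto
    then show ?thesis by (simp add: partial_def frechet_derivative_def)
  qed
  have "F u = G u" using FG[OF W(2)] by blast
  then show ?thesis unfolding spray_coeff_def p fundamental_tensor_def by simp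
qed

text \<open>The Hessian form is a repeated directional derivative along a frozen \<open>w\<close>;
  the chain rule is applied to each of the two derivatives.\<close>

lemma hessian_compose_linear:
  fixes f :: "real^'n::finite \<Rightarrow> real" and L :: "real^'n \<Rightarrow> real^'n"
  assumes f: "real_polynomial_function f" and L: "linear L"
  shows "(\<Sum>i\<in>UNIV. \<Sum>j\<in>UNIV. partial i (partial j (\<lambda>v. f (L v))) v * w $ i * w $ j)
    = (\<Sum>i\<in>UNIV. \<Sum>j\<in>UNIV. partial i (partial j f) (L v) * L w $ i * L w $ j)"
proof -
  have chain: "(\<Sum>i\<in>UNIV. w $ i * partial i (\<lambda>v. g (L v)) v) = (\<Sum>i\<in>UNIV. L w $ i * partial i g (L v))"
    if g: "real_polynomial_function g" for g v
  proof -
    have d: "((\<lambda>v. g (L v)) has_derivative (\<lambda>h. \<Sum>i\<in>UNIV. L h $ i * partial i g (L v))) (at v)"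
      by (rule has_derivative_compose[OF bounded_linear_imp_has_derivative rpf_partial(2)[OF g]])
        (use L in \<open>simp add: linear_conv_bounded_linear\<close>)
    from has_derivative_unique[OF rpf_partial(2)[OF rpf_compose_linear[OF g L]] d] show ?thesis by metis
  qed
  have sum: "(\<Sum>i\<in>UNIV. \<Sum>j\<in>UNIV. partial i (partial j g) v * w $ i * w $ j)
      = (\<Sum>i\<in>UNIV. w $ i * partial i (\<lambda>v. \<Sum>j\<in>UNIV. w $ j * partial j g v) v)"
    if g: "real_polynomial_function g" for g :: "real^'n \<Rightarrow> real" and v w
  proof -
    have "((\<lambda>v. \<Sum>j\<in>UNIV. w $ j * partial j g v) has_derivative
        (\<lambda>h. \<Sum>j\<in>UNIV. w $ j * (\<Sum>i\<in>UNIV. h $ i * partial i (partial j g) v))) (at v)"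
      by (intro has_derivative_sum has_derivative_mult_right rpf_partial g)
    from partial_eq[OF this] show ?thesis by (simp add: sum_axis_mult sum_distrib_left mult_ac)
  qed
  let ?h = "\<lambda>v. \<Sum>j\<in>UNIV. L w $ j * partial j f v"
  have h: "real_polynomial_function ?h"
    by (intro real_polynomial_function_sum rpf_mult rpf_const rpf_partial f) auto
  show ?thesis
    unfolding sum[OF f] sum[OF rpf_compose_linear[OF f L]] chain[OF f] by (rule chain[OF h])
qed

lemma smooth_on_pullback_coeff:
  assumes W: "open W" and M: "\<And>i j. smooth_on W (\<lambda>u. M u j i)"
    and f: "\<And>js. length js = length is \<Longrightarrow> smooth_on W (\<lambda>u. f u js)"
  shows "smooth_on W (\<lambda>u. pullback_coeff (M u) (f u) is)"
  using f
proof (induction "is" arbitrary: f)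
  case (Cons i "is")
  have "smooth_on W (\<lambda>u. pullback_coeff (M u) (\<lambda>js. f u (j # js)) is)" for j
    by (rule Cons.IH) (simp add: Cons.prems)
  then show ?case by (simp add: W M smooth_on_sum smooth_on_mult)
qed simp

section \<open>Pulling the data back to a chart\<close>

locale kropina_in_coords =
  fixes U :: "(real^'n::finite) set" and m :: nat and a :: "real^'n \<Rightarrow> 'n list \<Rightarrow> real" and b :: "real^'n \<Rightarrow> real^'n"
    and V :: "(real^'n) set" and \<phi> :: "real^'n \<Rightarrow> real^'n"
  assumes U: "open U" and m: "m \<ge> 3" and fin: "mth_root_finsler_on U m a"
    and irr: "\<forall>x\<in>U. irreducible (form_poly m (a x))" and b: "smooth_on U b"
    and V: "V \<subseteq> U" "local_coords V \<phi>"
begin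

definition \<psi> :: "real^'n \<Rightarrow> real^'n" where "\<psi> = inv_into V \<phi>"
definition D\<psi> :: "real^'n \<Rightarrow> real^'n \<Rightarrow> real^'n" where "D\<psi> u = frechet_derivative \<psi> (at u)"
definition c :: "real^'n \<Rightarrow> 'n list \<Rightarrow> real" where
  "c u = pullback_coeff (\<lambda>j i. D\<psi> u (axis i 1) $ j) (a (\<psi> u))"
text \<open>The covector composed with the differential, written as a sum over axes so that the
  closure properties of \<open>smooth_on\<close> apply directly.\<close>

definition b' :: "real^'n \<Rightarrow> real^'n" where
  "b' u = (\<Sum>i\<in>UNIV. (\<Sum>j\<in>UNIV. b (\<psi> u) $ j * D\<psi> u (axis i 1) $ j) *\<^sub>R axis i 1)"

lemma W: "open (\<phi> ` V)" and smooth_\<psi>: "smooth_on (\<phi> ` V) \<psi>" and smooth_\<phi>: "smooth_on V \<phi>" and openV: "open V"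
  and inj: "inj_on \<phi> V"
  using V(2) by (auto simp: local_coords_def \<psi>_def)

lemma \<psi>_in: "u \<in> \<phi> ` V \<Longrightarrow> \<psi> u \<in> V"
  unfolding \<psi>_def by (rule inv_into_into)

lemma \<psi>_has_derivative: "u \<in> \<phi> ` V \<Longrightarrow> (\<psi> has_derivative D\<psi> u) (at u)"
  unfolding D\<psi>_def by (rule smooth_on_has_derivative[OF smooth_\<psi>])

text \<open>Differentiating both composites of \<open>\<phi>\<close> and \<open>\<psi>\<close> shows
  their differentials to be mutually inverse. Irreducibility and positivity are carried over by this
  linear isomorphism.\<close>

lemma D\<psi>_inverse:
  assumes u: "u \<in> \<phi> ` V"
  shows "\<exists>L'. linear L' \<and> (\<forall>v. D\<psi> u (L' v) = v) \<and> (\<forall>v. L' (D\<psi> u v) = v)"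
proof -
  let ?L = "frechet_derivative \<phi> (at (\<psi> u))"
  have d\<phi>: "(\<phi> has_derivative ?L) (at (\<psi> u))" by (rule smooth_on_has_derivative[OF smooth_\<phi> \<psi>_in[OF u]])
  have "((\<lambda>u. \<phi> (\<psi> u)) has_derivative (\<lambda>v. ?L (D\<psi> u v))) (at u)"
    by (rule has_derivative_compose[OF \<psi>_has_derivative[OF u] d\<phi>])
  moreover have "((\<lambda>u. \<phi> (\<psi> u)) has_derivative (\<lambda>v. v)) (at u)"
    by (rule has_derivative_transform_within_open[OF has_derivative_ident W u]) (simp add: \<psi>_def f_inv_into_f)
  ultimately have 1: "?L (D\<psi> u v) = v" for v using has_derivative_unique by metis
  have \<phi>\<psi>: "\<phi> (\<psi> u) = u" using u by (simp add: \<psi>_def f_inv_into_f)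
  have "((\<lambda>x. \<psi> (\<phi> x)) has_derivative (\<lambda>v. D\<psi> u (?L v))) (at (\<psi> u))"
    by (rule has_derivative_compose[OF d\<phi>]) (simp add: \<phi>\<psi> \<psi>_has_derivative[OF u])
  moreover have "((\<lambda>x. \<psi> (\<phi> x)) has_derivative (\<lambda>v. v)) (at (\<psi> u))"
    by (rule has_derivative_transform_within_open[OF has_derivative_ident openV \<psi>_in[OF u]])
      (simp add: \<psi>_def inv_into_f_f[OF inj])
  ultimately have 2: "D\<psi> u (?L v) = v" for v using has_derivative_unique by metis
  show ?thesis using 1 2 has_derivative_linear[OF d\<phi>] by blast
qed

lemma linear_D\<psi>: "u \<in> \<phi> ` V \<Longrightarrow> linear (D\<psi> u)"
  using has_derivative_linear[OF \<psi>_has_derivative] .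

lemma D\<psi>_component: "u \<in> \<phi> ` V \<Longrightarrow> D\<psi> u v $ j = (\<Sum>i\<in>UNIV. D\<psi> u (axis i 1) $ j * v $ i)"
  by (subst linear_axis_sum[OF linear_D\<psi>]) (simp_all add: mult.commute)

lemma form_c: "u \<in> \<phi> ` V \<Longrightarrow> form m (c u) v = form m (a (\<psi> u)) (D\<psi> u v)"
  unfolding c_def by (rule form_pullback[symmetric], rule D\<psi>_component)

lemma b'_inner: "u \<in> \<phi> ` V \<Longrightarrow> b' u \<bullet> v = b (\<psi> u) \<bullet> D\<psi> u v"
proof -
  assume u: "u \<in> \<phi> ` V"
  have "b (\<psi> u) \<bullet> D\<psi> u v = (\<Sum>j\<in>UNIV. b (\<psi> u) $ j * (\<Sum>i\<in>UNIV. D\<psi> u (axis i 1) $ j * v $ i))"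
    unfolding inner_vec_def inner_real_def
    by (intro sum.cong refl arg_cong2[where f = "(*)"] D\<psi>_component u)
  also have "\<dots> = (\<Sum>j\<in>UNIV. \<Sum>i\<in>UNIV. v $ i * (b (\<psi> u) $ j * D\<psi> u (axis i 1) $ j))"
    by (simp add: sum_distrib_left mult_ac)
  also have "\<dots> = (\<Sum>i\<in>UNIV. \<Sum>j\<in>UNIV. v $ i * (b (\<psi> u) $ j * D\<psi> u (axis i 1) $ j))" by (rule sum.swap)
  also have "\<dots> = b' u \<bullet> v"
    by (simp add: b'_def inner_sum_left inner_axis' sum_distrib_left mult_ac)
  finally show ?thesis by simp
qed

lemma smooth_D\<psi>: "smooth_on (\<phi> ` V) (\<lambda>u. D\<psi> u v $ j)"
  unfolding D\<psi>_def
  by (intro smooth_on_bounded_linear_comp[OF W bounded_linear_vec_nth] smooth_on_frechet_derivative smooth_\<psi>)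

lemma smooth_compose_\<psi>: "smooth_on U f \<Longrightarrow> smooth_on (\<phi> ` V) (\<lambda>u. f (\<psi> u))"
  by (rule smooth_on_compose[OF W _ smooth_\<psi>, of U]) (use \<psi>_in V(1) in blast)+

lemma coords: "kropina_coords (\<phi> ` V) m c b'"
proof
  show "open (\<phi> ` V)" "m \<ge> 3" by (rule W, rule m)
  show "smooth_on (\<phi> ` V) (\<lambda>u. c u is)" if "length is = m" for "is"
    unfolding c_def
    by (intro smooth_on_pullback_coeff W smooth_D\<psi> smooth_compose_\<psi>)
      (use fin that in \<open>auto simp: mth_root_finsler_on_def\<close>)
  show "smooth_on (\<phi> ` V) b'"
    unfolding b'_def
    by (intro smooth_on_sum smooth_on_scaleR smooth_on_mult smooth_on_const W smooth_D\<psi>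
        smooth_on_bounded_linear_comp[OF W bounded_linear_vec_nth] smooth_compose_\<psi> b)
  fix u assume u: "u \<in> \<phi> ` V"
  then have \<psi>U: "\<psi> u \<in> U" using \<psi>_in V by auto
  obtain L' where L': "linear L'" "\<And>v. D\<psi> u (L' v) = v" "\<And>v. L' (D\<psi> u v) = v" using D\<psi>_inverse[OF u] by blast
  have nz: "D\<psi> u v \<noteq> 0" if v: "v \<noteq> 0" for v
    using v L'(3)[of v] linear_0[OF L'(1)] by auto
  have fc: "form m (c u) = (\<lambda>v. form m (a (\<psi> u)) (D\<psi> u v))" using form_c[OF u] by blast
  show "rpf_irreducible (form m (c u))" unfolding fc
    by (rule rpf_irreducible_compose_linear[OF rpf_irreducible_form linear_D\<psi>[OF u] L'(1-3)])
      (use irr \<psi>U in auto)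
  fix v :: "real^'n" assume v: "v \<noteq> 0"
  have "root m (form m (a (\<psi> u)) (D\<psi> u v)) > 0"
    using fin \<psi>U nz[OF v] unfolding mth_root_finsler_on_def finsler_metric_on_def mth_root_def by blast
  then show "form m (c u) v > 0" using m form_c[OF u] by simp
  fix w :: "real^'n" assume w: "w \<noteq> 0"
  have "positive_definite (\<chi> i j. partial i (\<lambda>y. partial j (\<lambda>y. form m (a (\<psi> u)) y) y) (D\<psi> u v))"
    using fin \<psi>U nz[OF v] unfolding mth_root_finsler_on_def by blast
  then show "(\<Sum>i\<in>UNIV. \<Sum>j\<in>UNIV. partial i (partial j (form m (c u))) v * w $ i * w $ j) > 0"
    using nz[OF w] unfolding fc hessian_compose_linear[OF rpf_form linear_D\<psi>[OF u]]
    by (simp add: positive_definite_def)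
qed

lemma coord_metric_eq:
  "u \<in> \<phi> ` V \<Longrightarrow> coord_metric V \<phi> (kropina_change (mth_root m a) (one_form b)) u v
    = kropina_change (mth_root m c) (one_form b') u v"
proof -
  assume u: "u \<in> \<phi> ` V"
  have "one_form b' u v = one_form b (\<psi> u) (D\<psi> u v)"
    using b'_inner[OF u, of v] by (simp add: one_form_def inner_vec_def)
  then show ?thesis
    by (simp add: coord_metric_def kropina_change_def mth_root_def form_c[OF u] flip: \<psi>_def D\<psi>_def)
qed

lemma coord_dom_eq: "coord_dom V \<phi> (kropina_dom U (one_form b)) = {(u, v). u \<in> \<phi> ` V \<and> b' u \<bullet> v \<noteq> 0}"
proof -
  have "(u, v) \<in> coord_dom V \<phi> (kropina_dom U (one_form b)) \<longleftrightarrow> b' u \<bullet> v \<noteq> 0" if u: "u \<in> \<phi> ` V" for u v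
  proof -
    have "\<psi> u \<in> U" using \<psi>_in[OF u] V by blast
    then show ?thesis using b'_inner[OF u, of v] u
      by (simp add: coord_dom_def kropina_dom_def one_form_def inner_vec_def \<psi>_def D\<psi>_def)
  qed
  moreover have "u \<in> \<phi> ` V" if "(u, v) \<in> coord_dom V \<phi> D" for u v D using that by (simp add: coord_dom_def)
  ultimately show ?thesis by blast
qed

end

text \<open>The projectively flat chart need not be the Minkowskian one: the latter arises from it
  by a further chart \<open>\<tau>\<close> around \<open>\<phi> x\<close>, and the two are
  composed.\<close>

lemma projectively_flat_imp_minkowskian:
  fixes U :: "(real^'n::finite) set"
  assumes U: "open U" "m \<ge> 3" "mth_root_finsler_on U m a" "\<forall>x\<in>U. irreducible (form_poly m (a x))" "smooth_on U b"
    and flat: "locally_projectively_flat U (kropina_dom U (one_form b)) (kropina_change (mth_root m a) (one_form b))"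
  shows "locally_minkowskian U (kropina_dom U (one_form b)) (kropina_change (mth_root m a) (one_form b))"
  unfolding locally_minkowskian_def
proof
  let ?F = "kropina_change (mth_root m a) (one_form b)" and ?D = "kropina_dom U (one_form b)"
  fix x assume "x \<in> U"
  then obtain V \<phi> P where V: "x \<in> V" "V \<subseteq> U" "local_coords V \<phi>"
    and P: "\<And>u v i. (u, v) \<in> coord_dom V \<phi> ?D \<Longrightarrow> spray_coeff (coord_metric V \<phi> ?F) u v i = P u v * v $ i"
    using flat unfolding locally_projectively_flat_def by (smt (verit) case_prodD)
  interpret kc: kropina_in_coords U m a b V \<phi> by unfold_locales (use U V in auto)
  let ?G = "kropina_change (mth_root m kc.c) (one_form kc.b')"
  interpret co: kropina_coords "\<phi> ` V" m kc.c kc.b' by (rule kc.coords)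
  interpret fl: kropina_flat "\<phi> ` V" m kc.c kc.b' P
  proof
    fix u v i assume u: "u \<in> \<phi> ` V" and v: "kc.b' u \<bullet> v \<noteq> 0"
    have "spray_coeff ?G u v i = spray_coeff (coord_metric V \<phi> ?F) u v i"
      by (rule spray_coeff_cong[OF kc.W u]) (simp add: kc.coord_metric_eq)
    then show "spray_coeff ?G u v i = P u v * v $ i" using P[of u v i] u v by (simp add: kc.coord_dom_eq)
  qed
  obtain S \<tau> E \<Phi> where S: "\<phi> x \<in> S" "S \<subseteq> \<phi> ` V" "local_coords S \<tau>"
    and dom: "coord_dom S \<tau> {(u, v). u \<in> \<phi> ` V \<and> kc.b' u \<bullet> v \<noteq> 0} = \<tau> ` S \<times> E"
    and met: "\<forall>w\<in>\<tau> ` S. \<forall>\<xi>\<in>E. coord_metric S \<tau> ?G w \<xi> = \<Phi> \<xi>"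
    using fl.minkowskian_coords[OF imageI[OF V(1)]]
    by (elim exE conjE) (rule that)
  define V' where "V' = {x \<in> V. \<phi> x \<in> S}"
  note lc = local_coords_compose[OF V(3) S(3,2), folded V'_def]
    and cc = coord_compose[OF V(3) S(3,2), folded V'_def]
  have domE: "coord_dom V' (\<tau> \<circ> \<phi>) ?D = (\<tau> \<circ> \<phi>) ` V' \<times> E"
  proof -
    have "(w, \<xi>) \<in> coord_dom V' (\<tau> \<circ> \<phi>) ?D \<longleftrightarrow> w \<in> \<tau> ` S \<and> \<xi> \<in> E" for w \<xi>
    proof (cases "w \<in> \<tau> ` S")
      case True
      then show ?thesis using cc(2)[OF True] dom by (simp add: kc.coord_dom_eq)
    next
      case False
      then show ?thesis using lc(2) by (auto simp: coord_dom_def)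
    qed
    then show ?thesis unfolding lc(2) by auto
  qed
  have metE: "coord_metric V' (\<tau> \<circ> \<phi>) ?F w \<xi> = \<Phi> \<xi>" if w: "w \<in> (\<tau> \<circ> \<phi>) ` V'" and \<xi>: "\<xi> \<in> E" for w \<xi>
  proof -
    have w: "w \<in> \<tau> ` S" using w lc(2) by blast
    then have "inv_into S \<tau> w \<in> \<phi> ` V" using local_coords_inv(1)[OF S(3)] S(2) by blast
    then have "coord_metric S \<tau> (coord_metric V \<phi> ?F) w \<xi> = coord_metric S \<tau> ?G w \<xi>"
      by (simp add: coord_metric_def[of S] kc.coord_metric_eq)
    then show ?thesis using cc(1)[OF w] met[rule_format, OF w \<xi>] by simp
  qed
  show "\<exists>V \<phi> E \<Phi>. x \<in> V \<and> V \<subseteq> U \<and> local_coords V \<phi> \<and> coord_dom V \<phi> ?D = \<phi> ` V \<times> E \<and>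
      (\<forall>u\<in>\<phi> ` V. \<forall>v\<in>E. coord_metric V \<phi> ?F u v = \<Phi> v)"
  proof (intro exI conjI ballI)
    show "x \<in> V'" "V' \<subseteq> U" using V S by (auto simp: V'_def)
  qed (fact lc(1) domE metE)+
qed

text \<open>Where the metric does not depend on the point, its base derivatives vanish on the fibre
  \<open>E\<close>; the spray is then zero and \<open>P = 0\<close> serves.\<close>

lemma minkowskian_imp_projectively_flat:
  fixes U :: "(real^'n::finite) set"
  assumes mink: "locally_minkowskian U (kropina_dom U (one_form b)) F"
  shows "locally_projectively_flat U (kropina_dom U (one_form b)) F"
  unfolding locally_projectively_flat_def
proof
  let ?D = "kropina_dom U (one_form b)"
  fix x assume "x \<in> U"
  then obtain V \<phi> E \<Phi> where V: "x \<in> V" "V \<subseteq> U" "local_coords V \<phi>" and dom: "coord_dom V \<phi> ?D = \<phi> ` V \<times> E"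
    and met: "\<And>u v. u \<in> \<phi> ` V \<Longrightarrow> v \<in> E \<Longrightarrow> coord_metric V \<phi> F u v = \<Phi> v"
    using mink unfolding locally_minkowskian_def by meson
  let ?G = "coord_metric V \<phi> F"
  have W: "open (\<phi> ` V)" using V(3) by (simp add: local_coords_def)
  have "spray_coeff ?G u v i = 0" if uv: "(u, v) \<in> coord_dom V \<phi> ?D" for u v i
  proof -
    have u: "u \<in> \<phi> ` V" and v: "v \<in> E" using uv dom by auto
    let ?L = "frechet_derivative (inv_into V \<phi>) (at u)"
    have "bounded_linear ?L" using local_coords_inv(3)[OF V(3) u] by (rule has_derivative_bounded_linear)
    \<comment> \<open>\<open>E\<close> is the complement of the zero set of a linear form, hence
      open. The fibre derivatives in the spray see a neighbourhood of \<open>v\<close>, so the base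
      derivatives have to vanish on one.\<close>
    moreover have "E = {v. b (inv_into V \<phi> u) \<bullet> ?L v \<noteq> 0}"
    proof -
      have "inv_into V \<phi> u \<in> U" using local_coords_inv(1)[OF V(3) u] V(2) by blast
      then have "v \<in> E \<longleftrightarrow> b (inv_into V \<phi> u) \<bullet> ?L v \<noteq> 0" for v
        using dom u by (auto simp: coord_dom_def kropina_dom_def one_form_def inner_vec_def set_eq_iff)
      then show ?thesis by blast
    qed
    moreover have "open {v. b (inv_into V \<phi> u) \<bullet> ?L v \<in> - {0}}" if "bounded_linear ?L"
      using that by (intro open_vimage[unfolded vimage_def] open_Compl closed_singleton continuous_on_inner
          continuous_on_const linear_continuous_on)
    ultimately have E: "open E" by simp
    have 1: "partial k (\<lambda>x. (?G x y)\<^sup>2) u = 0" if y: "y \<in> E" for k y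
      using partial_cong_open[OF W u _ has_derivative_const, of "\<lambda>x. (?G x y)\<^sup>2" "(\<Phi> y)\<^sup>2"] met y by simp
    have 2: "partial l (\<lambda>y. partial k (\<lambda>x. (?G x y)\<^sup>2) u) v = 0" for l k
      using partial_cong_open[OF E v _ has_derivative_const, of "\<lambda>y. partial k (\<lambda>x. (?G x y)\<^sup>2) u" 0] 1 by simp
    show ?thesis unfolding spray_coeff_def 2 1[OF v] by simp
  qed
  then show "\<exists>V \<phi> P. x \<in> V \<and> V \<subseteq> U \<and> local_coords V \<phi> \<and>
      (\<forall>(u, v)\<in>coord_dom V \<phi> ?D. (\<forall>c>0. P u (c *\<^sub>R v) = c * P u v) \<and>
        (\<forall>i. spray_coeff (coord_metric V \<phi> F) u v i = P u v * v $ i))"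
    using V by (intro exI[of _ V] exI[of _ \<phi>] exI[of _ "\<lambda>_ _. 0"]) auto
qed

theorem theorem1p2:
  fixes U :: "(real^'n::finite) set"
    and m :: nat
    and a :: "real^'n \<Rightarrow> 'n list \<Rightarrow> real"
    and b :: "real^'n \<Rightarrow> real^'n"
  assumes "open U"
    and "m \<ge> 3"
    and "mth_root_finsler_on U m a"
    and "\<forall>x\<in>U. irreducible (form_poly m (a x))"
    and "smooth_on U b"
  shows "locally_projectively_flat U (kropina_dom U (one_form b))
           (kropina_change (mth_root m a) (one_form b))
     \<longleftrightarrow> locally_minkowskian U (kropina_dom U (one_form b))
           (kropina_change (mth_root m a) (one_form b))"
  by (rule iffI[OF projectively_flat_imp_minkowskian[OF assms] minkowskian_imp_projectively_flat])

end
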